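(* Let $(X,S,\phi)$ be a system such that the interaction $\phi$ is irreducibly quantified, and suppose that the locale $X$ has a free action of a group $G$. Assume that either $X$ is transferable, or $\phi$ is simple and $X$ is weakly transferable. Let $\mathcal C=(Z^1_{\mathrm{unif}}(S^X))^G$ be the space of shift-invariant closed uniform forms and $\mathcal E=\partial\bigl(C^0_{\mathrm{unif}}(S^X)^G\bigr)$ the image under $\partial$ of the space of shift-invariant uniform functions vanishing at the base configuration. Then the boundary map $\delta$ induces a canonical isomorphism of $\mathbb R$-linear spaces $$\mathcal C/\mathcal E\;\cong\;\mathrm{Hom}(G,\mathrm{Consv}^\phi(S)).$$ Moreover, a choice of a fundamental domain $\Lambda_0$ for the action of $G$ on $X$ gives an $\mathbb R$-linear map $\lambda\colon \mathrm{Hom}(G,\mathrm{Consv}^\phi(S))\to\mathcal C$ with $\delta\circ\lambda=\mathrm{id}$, and hence a decomposition of $\mathbb R$-linear spaces $$\mathcal C\;\cong\;\mathcal E\oplus \mathrm{Hom}(G,\mathrm{Consv}^\phi(S)).$$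
   Context: Locales. A locale $X=(X,E)$, $E\subset X\times X$, is a directed graph that is symmetric ($(x,y)\in E\Rightarrow(y,x)\in E$), simple ($(x,x)\notin E$), locally finite (each vertex lies on finitely many edges) and connected. Write $e=(o(e),t(e))$, $\bar e=(t(e),o(e))$. Paths are finite sequences of consecutive edges (length $0$ allowed); $d_X$ is the graph distance; a subset of $X$ is connected if the induced subgraph is connected. A ball is a set $B(x,R)=\{x'\in X: d_X(x,x')\le R\}$ with $x\in X$, $R>0$ ($R$ is its radius); $B(\Lambda,R)=\bigcup_{x\in\Lambda}B(x,R)$, and $B(e,R)=B(o(e),R)\cup B(t(e),R)$. $X$ is weakly transferable if for every ball $B$ the complement $X\setminus B$ is a nonempty finite disjoint union of connected infinite graphs. $X$ is transferable if it is weakly transferable and either (a) there is a ball $B$ such that $X\setminus B$ has three or more connected components, or (b) for any $r\in\mathbb N$ there is a ball $B$ of radius at least $r$ with $X\setminus B$ connected. Systems. $S$ is a nonempty set with a designated base state $*\in S$. An interaction is a map $\phi\colon S\times S\to S\times S$ such that $\hat\imath\circ\phi\circ\hat\imath\circ\phi(s_1,s_2)=(s_1,s_2)$ whenever $\phi(s_1,s_2)\ne(s_1,s_2)$, where $\hat\imath$ swaps the components. A system is a triple $(X,S,\phi)$ of a locale, a set of states and an interaction. $S^X=\prod_{x\in X}S$; $\star$ is the configuration with all components $*$; $S^X_*$ is the set of $\eta=(\eta_x)\in S^X$ with $\eta_x=*$ for all but finitely many $x$. For $e\in E$, $\eta^e$ is obtained from $\eta$ by replacing $(\eta_{o(e)},\eta_{t(e)})$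 by $\phi(\eta_{o(e)},\eta_{t(e)})$. $\Phi=\{(\eta,\eta^e):\eta\in S^X,e\in E\}$, $\Phi_*=\Phi\cap(S^X_*\times S^X_* )$; $(S^X,\Phi)$ and $(S^X_*,\Phi_* )$ are symmetric directed graphs. Conserved quantities. A conserved quantity is $\xi\colon S\to\mathbb R$ with $\xi( * )=0$ and $\xi(s_1)+\xi(s_2)=\xi(s_1')+\xi(s_2')$ for all $(s_1,s_2)$, where $(s_1',s_2')=\phi(s_1,s_2)$; $\mathrm{Consv}^\phi(S)$ is the $\mathbb R$-linear space of these, $c_\phi$ its dimension. For $W\subset X$, $\xi_W(\eta)=\sum_{x\in W}\xi(\eta_x)$ for $\eta\in S^X_*$. $\phi$ is irreducibly quantified if for any finite locale $Y$ and $\eta,\eta'\in S^Y$ with $\xi_Y(\eta)=\xi_Y(\eta')$ for all $\xi\in\mathrm{Consv}^\phi(S)$ there is a finite path from $\eta$ to $\eta'$ in $(S^Y,\Phi)$. $\phi$ is simple if $c_\phi=1$ and for any nonzero $\xi\in\mathrm{Consv}^\phi(S)$ the additive submonoid of $\mathbb R$ generated by $\xi(S)$ is isomorphic to $\mathbb N=\{0,1,\dots\}$ or $\mathbb Z$. Functions and forms. $C(A)$ is the space of functions $A\to\mathbb R$. For finite $\Lambda\subset X$, $C(S^\Lambda)$ is regarded as the subspace of $C(S^X_* )$ of functions depending only on $\eta|_\Lambda$; $C_\Lambda(S^X)$ is the space of $f\in C(S^\Lambda)$ with $f(\eta)=0$ whenever $\eta_x=*$ for some $x\in\Lambda$. Every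 $f\in C(S^X_* )$ has a unique expansion $f=\sum_{\Lambda\subset X,|\Lambda|<\infty}f_\Lambda$ with $f_\Lambda\in C_\Lambda(S^X)$; $f$ is uniform if there is $R>0$ with $f_\Lambda=0$ whenever $\mathrm{diam}(\Lambda)=\sup_{x,x'\in\Lambda}d_X(x,x')>R$. $C^0_{\mathrm{unif}}(S^X)$ is the space of uniform $f$ with $f(\star)=0$. A form is a function $\omega\colon\Phi_*\to\mathbb R$ with $\omega(\bar\varphi)=-\omega(\varphi)$ ($\bar\varphi$ the reversed transition), identified with $(\omega_e)_{e\in E}$, $\omega_e(\eta)=\omega((\eta,\eta^e))$. It is closed if its sum along every closed path of $(S^X_*,\Phi_* )$ is $0$, and uniform if there is $R>0$ such that $\omega_e\in C(S^{B(e,R)})$ for all $e\in E$. $Z^1_{\mathrm{unif}}(S^X)$ is the space of closed uniform forms. $\partial f=(\nabla_ef)_{e\in E}$, $\nabla_ef(\eta)=f(\eta^e)-f(\eta)$; $\partial$ maps $C^0_{\mathrm{unif}}(S^X)$ to $Z^1_{\mathrm{unif}}(S^X)$. Group action. An action of $G$ on $X$ is a homomorphism from $G$ to the group of bijections $X\to X$ preserving $E$; it is free if $\sigma(x)=\tau(x)$ for some $x\in X$ implies $\sigma=\tau$. A fundamental domain is a subset $\Lambda_0\subset X$ containing exactly one vertex of each $G$-orbit. $G$ acts by $\eta^\sigma=(\eta_{\sigma(x)})_{x}$, $(\sigma f)(\eta)=f(\eta^\sigma)$, and $(\sigma\omega)((\eta,\eta'))=\omega((\eta^\sigma,\eta'^\sigma))$;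 shift-invariant means $G$-invariant, $U^G$ denotes the $G$-invariant subspace. $\mathrm{Hom}(G,V)$ is the space of group homomorphisms. The map $\delta\colon\mathcal C\to\mathrm{Hom}(G,\mathrm{Consv}^\phi(S))$ is the connecting homomorphism of group cohomology for $0\to\mathrm{Consv}^\phi(S)\to C^0_{\mathrm{unif}}(S^X)\xrightarrow{\partial}Z^1_{\mathrm{unif}}(S^X)\to0$ (first map $\xi\mapsto\xi_X$; this sequence is exact under the hypotheses of the theorem): choose $f\in C^0_{\mathrm{unif}}(S^X)$ with $\partial f=\omega$; then $\delta(\omega)(\sigma)$ is the conserved quantity $\xi$ with $\xi_X=f-\sigma(f)$. The map $\lambda$ given by $\Lambda_0$ is $\lambda(\psi)=\partial\bigl(\sum_{\tau\in G}\psi(\tau)_{\tau(\Lambda_0)}\bigr)$, and the decomposition is $\omega\mapsto(\omega-\lambda(\delta(\omega)),\delta(\omega))$. *)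

theory Defs
  imports
    Complex_Main
    "HOL-Algebra.Module"
    "HOL-Algebra.AbelCoset"
    "HOL-Algebra.Group_Action"
    "HOL-Algebra.Elementary_Groups"
    "HOL-Library.Function_Algebras"
begin

section \<open>Real vector spaces with explicit carriers\<close>

text \<open>Real vector spaces are HOL-Algebra modules over the ring of reals. The ring multiplication
  and unit that the record type \<open>module\<close> inherits from \<open>ring\<close> play no role and stay unspecified.\<close>

definition real_ring :: "real ring" where
  "real_ring = \<lparr>carrier = UNIV, monoid.mult = (*), one = 1, zero = 0, add = (+)\<rparr>"

text \<open>The space \<open>C(A)\<close> of functions from \<open>A\<close> to the reals, as extensional functions. Its subspaces
  are obtained by updating the carrier.\<close>

definition fun_space :: "'a set \<Rightarrow> (real, 'a \<Rightarrow> real) module" where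
  "fun_space A = \<lparr>carrier = A \<rightarrow>\<^sub>E UNIV, monoid.mult = undefined, one = undefined,
     zero = (\<lambda>a\<in>A. 0), add = (\<lambda>f g. \<lambda>a\<in>A. f a + g a), smult = (\<lambda>c f. \<lambda>a\<in>A. c * f a)\<rparr>"

definition quot_space :: "(real, 'a) module \<Rightarrow> 'a set \<Rightarrow> (real, 'a set) module" where
  "quot_space M H = \<lparr>carrier = a_rcosets\<^bsub>M\<^esub> H, monoid.mult = undefined, one = undefined,
     zero = H, add = set_add M, smult = (\<lambda>c A. \<Union>a\<in>A. H +>\<^bsub>M\<^esub> (c \<odot>\<^bsub>M\<^esub> a))\<rparr>"

definition direct_sum :: "(real, 'a) module \<Rightarrow> (real, 'b) module \<Rightarrow> (real, 'a \<times> 'b) module" where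
  "direct_sum M N = \<lparr>carrier = carrier M \<times> carrier N, monoid.mult = undefined, one = undefined,
     zero = (\<zero>\<^bsub>M\<^esub>, \<zero>\<^bsub>N\<^esub>),
     add = (\<lambda>(a, b) (a', b'). (a \<oplus>\<^bsub>M\<^esub> a', b \<oplus>\<^bsub>N\<^esub> b')),
     smult = (\<lambda>c (a, b). (c \<odot>\<^bsub>M\<^esub> a, c \<odot>\<^bsub>N\<^esub> b))\<rparr>"

definition Hom_space :: "('g, 'm) monoid_scheme \<Rightarrow> (real, 'a) module \<Rightarrow> (real, 'g \<Rightarrow> 'a) module" where
  "Hom_space G M = \<lparr>carrier = hom G (add_monoid M) \<inter> extensional (carrier G),
     monoid.mult = undefined, one = undefined,
     zero = (\<lambda>\<sigma>\<in>carrier G. \<zero>\<^bsub>M\<^esub>),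
     add = (\<lambda>\<psi> \<chi>. \<lambda>\<sigma>\<in>carrier G. \<psi> \<sigma> \<oplus>\<^bsub>M\<^esub> \<chi> \<sigma>),
     smult = (\<lambda>c \<psi>. \<lambda>\<sigma>\<in>carrier G. c \<odot>\<^bsub>M\<^esub> \<psi> \<sigma>)\<rparr>"

definition linear_map :: "(real, 'a) module \<Rightarrow> (real, 'b) module \<Rightarrow> ('a \<Rightarrow> 'b) \<Rightarrow> bool" where
  "linear_map M N h \<longleftrightarrow>
     Module.module real_ring M \<and> Module.module real_ring N \<and>
     h \<in> carrier M \<rightarrow> carrier N \<and>
     (\<forall>a\<in>carrier M. \<forall>b\<in>carrier M. h (a \<oplus>\<^bsub>M\<^esub> b) = h a \<oplus>\<^bsub>N\<^esub> h b) \<and>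
     (\<forall>c. \<forall>a\<in>carrier M. h (c \<odot>\<^bsub>M\<^esub> a) = c \<odot>\<^bsub>N\<^esub> h a)"

definition linear_iso :: "(real, 'a) module \<Rightarrow> (real, 'b) module \<Rightarrow> ('a \<Rightarrow> 'b) \<Rightarrow> bool" where
  "linear_iso M N h \<longleftrightarrow> linear_map M N h \<and> bij_betw h (carrier M) (carrier N)"

section \<open>Locales\<close>

definition connected_in :: "('x \<times> 'x) set \<Rightarrow> 'x set \<Rightarrow> bool" where
  "connected_in E A \<longleftrightarrow> (\<forall>x\<in>A. \<forall>y\<in>A. (x, y) \<in> (Restr E A)\<^sup>*)"

definition conn_components :: "('x \<times> 'x) set \<Rightarrow> 'x set \<Rightarrow> 'x set set" where
  "conn_components E A = A // (Restr E A)\<^sup>*"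

definition graph_locale :: "'x set \<Rightarrow> ('x \<times> 'x) set \<Rightarrow> bool" where
  "graph_locale V E \<longleftrightarrow>
     V \<noteq> {} \<and> E \<subseteq> V \<times> V \<and> sym E \<and> irrefl E \<and>
     (\<forall>x\<in>V. finite {e \<in> E. fst e = x \<or> snd e = x}) \<and> connected_in E V"

text \<open>Used for connected graphs only, where the minimum exists.\<close>

definition gdist :: "('x \<times> 'x) set \<Rightarrow> 'x \<Rightarrow> 'x \<Rightarrow> nat" where
  "gdist E x y = (LEAST n. (x, y) \<in> E ^^ n)"

definition gball :: "'x set \<Rightarrow> ('x \<times> 'x) set \<Rightarrow> 'x \<Rightarrow> real \<Rightarrow> 'x set" where
  "gball V E x R = {y \<in> V. real (gdist E x y) \<le> R}"

definition edge_ball :: "'x set \<Rightarrow> ('x \<times> 'x) set \<Rightarrow> 'x \<times> 'x \<Rightarrow> real \<Rightarrow> 'x set" where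
  "edge_ball V E e R = gball V E (fst e) R \<union> gball V E (snd e) R"

text \<open>Used for finite sets only; \<open>Sup {} = 0\<close> on the naturals, so the empty set has diameter 0.\<close>

definition gdiam :: "('x \<times> 'x) set \<Rightarrow> 'x set \<Rightarrow> nat" where
  "gdiam E \<Lambda> = (SUP (x, y)\<in>\<Lambda> \<times> \<Lambda>. gdist E x y)"

definition weakly_transferable :: "'x set \<Rightarrow> ('x \<times> 'x) set \<Rightarrow> bool" where
  "weakly_transferable V E \<longleftrightarrow>
     (\<forall>x\<in>V. \<forall>R>0. let \<K> = conn_components E (V - gball V E x R)
        in \<K> \<noteq> {} \<and> finite \<K> \<and> (\<forall>K\<in>\<K>. infinite K))"

definition transferable :: "'x set \<Rightarrow> ('x \<times> 'x) set \<Rightarrow> bool" where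
  "transferable V E \<longleftrightarrow>
     weakly_transferable V E \<and>
     ((\<exists>x\<in>V. \<exists>R>0. card (conn_components E (V - gball V E x R)) \<ge> 3) \<or>
      (\<forall>r::nat. \<exists>x\<in>V. \<exists>R>0. R \<ge> real r \<and> connected_in E (V - gball V E x R)))"

section \<open>Interactions and configurations\<close>

type_synonym 's interaction = "'s \<times> 's \<Rightarrow> 's \<times> 's"
type_synonym ('x, 's) transition = "('x \<Rightarrow> 's) \<times> ('x \<Rightarrow> 's)"

definition interaction :: "'s interaction \<Rightarrow> bool" where
  "interaction \<phi> \<longleftrightarrow> (\<forall>s. \<phi> s \<noteq> s \<longrightarrow> prod.swap (\<phi> (prod.swap (\<phi> s))) = s)"

definition configs :: "'x set \<Rightarrow> ('x \<Rightarrow> 's) set" where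
  "configs V = V \<rightarrow>\<^sub>E UNIV"

definition fin_configs :: "'x set \<Rightarrow> 's \<Rightarrow> ('x \<Rightarrow> 's) set" where
  "fin_configs V b = {\<eta> \<in> configs V. finite {x \<in> V. \<eta> x \<noteq> b}}"

definition base_config :: "'x set \<Rightarrow> 's \<Rightarrow> 'x \<Rightarrow> 's" where
  "base_config V b = (\<lambda>x\<in>V. b)"

definition conf_step :: "'s interaction \<Rightarrow> 'x \<times> 'x \<Rightarrow> ('x \<Rightarrow> 's) \<Rightarrow> 'x \<Rightarrow> 's" where
  "conf_step \<phi> e \<eta> =
     \<eta>(fst e := fst (\<phi> (\<eta> (fst e), \<eta> (snd e))), snd e := snd (\<phi> (\<eta> (fst e), \<eta> (snd e))))"

definition transitions ::
  "'x set \<Rightarrow> ('x \<times> 'x) set \<Rightarrow> 's interaction \<Rightarrow> ('x, 's) transition set" where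
  "transitions V E \<phi> = {(\<eta>, conf_step \<phi> e \<eta>) | \<eta> e. \<eta> \<in> configs V \<and> e \<in> E}"

definition fin_transitions ::
  "'x set \<Rightarrow> ('x \<times> 'x) set \<Rightarrow> 's \<Rightarrow> 's interaction \<Rightarrow> ('x, 's) transition set" where
  "fin_transitions V E b \<phi> = transitions V E \<phi> \<inter> (fin_configs V b \<times> fin_configs V b)"

section \<open>Conserved quantities\<close>

definition consv :: "'s \<Rightarrow> 's interaction \<Rightarrow> ('s \<Rightarrow> real) set" where
  "consv b \<phi> = {\<xi>. \<xi> b = 0 \<and>
     (\<forall>s1 s2. \<xi> s1 + \<xi> s2 = \<xi> (fst (\<phi> (s1, s2))) + \<xi> (snd (\<phi> (s1, s2))))}"

definition consv_space :: "'s \<Rightarrow> 's interaction \<Rightarrow> (real, 's \<Rightarrow> real) module" where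
  "consv_space b \<phi> = (fun_space UNIV)\<lparr>carrier := consv b \<phi>\<rparr>"

text \<open>The library's \<open>dim\<close> is 0 on infinite-dimensional spaces; only \<open>consv_dim b \<phi> = 1\<close> is used.\<close>

definition consv_dim :: "'s \<Rightarrow> 's interaction \<Rightarrow> nat" where
  "consv_dim b \<phi> = vector_space.dim (\<lambda>c (f :: 's \<Rightarrow> real) s. c * f s) (consv b \<phi>)"

text \<open>\<open>sum'\<close> is the library's sum over the support, which is finite for \<open>\<eta>\<close> in \<open>fin_configs\<close>
  because \<open>\<xi> b = 0\<close>; the set \<open>W\<close> may be infinite.\<close>

definition xi_sum :: "('s \<Rightarrow> real) \<Rightarrow> 'x set \<Rightarrow> ('x \<Rightarrow> 's) \<Rightarrow> real" where
  "xi_sum \<xi> W \<eta> = sum' (\<lambda>x. \<xi> (\<eta> x)) W"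

text \<open>Every finite graph is isomorphic to one whose vertices are natural numbers.\<close>

definition irreducibly_quantified :: "'s \<Rightarrow> 's interaction \<Rightarrow> bool" where
  "irreducibly_quantified b \<phi> \<longleftrightarrow>
     (\<forall>(Y :: nat set) F. finite Y \<and> graph_locale Y F \<longrightarrow>
        (\<forall>\<eta>\<in>configs Y. \<forall>\<eta>'\<in>configs Y.
           (\<forall>\<xi>\<in>consv b \<phi>. xi_sum \<xi> Y \<eta> = xi_sum \<xi> Y \<eta>') \<longrightarrow>
           (\<eta>, \<eta>') \<in> (transitions Y F \<phi>)\<^sup>*))"

definition real_add_monoid :: "real monoid" where
  "real_add_monoid = \<lparr>carrier = UNIV, monoid.mult = (+), one = 0\<rparr>"

definition nat_add_monoid :: "nat monoid" where
  "nat_add_monoid = \<lparr>carrier = UNIV, monoid.mult = (+), one = 0\<rparr>"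

definition generated_submonoid :: "real set \<Rightarrow> real set" where
  "generated_submonoid A = (\<lambda>H. submonoid H real_add_monoid) hull A"

definition simple_interaction :: "'s \<Rightarrow> 's interaction \<Rightarrow> bool" where
  "simple_interaction b \<phi> \<longleftrightarrow>
     consv_dim b \<phi> = 1 \<and>
     (\<forall>\<xi>\<in>consv b \<phi>. \<xi> \<noteq> (\<lambda>s. 0) \<longrightarrow>
        (let M = real_add_monoid\<lparr>carrier := generated_submonoid (range \<xi>)\<rparr>
         in M \<cong> nat_add_monoid \<or> M \<cong> integer_group))"

section \<open>Uniform functions and forms\<close>

definition local_funs :: "'x set \<Rightarrow> 's \<Rightarrow> 'x set \<Rightarrow> (('x \<Rightarrow> 's) \<Rightarrow> real) set" where
  "local_funs V b \<Lambda> = {f \<in> fin_configs V b \<rightarrow>\<^sub>E UNIV.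
     \<forall>\<eta>\<in>fin_configs V b. \<forall>\<eta>'\<in>fin_configs V b. (\<forall>x\<in>\<Lambda>. \<eta> x = \<eta>' x) \<longrightarrow> f \<eta> = f \<eta>'}"

definition exact_local_funs :: "'x set \<Rightarrow> 's \<Rightarrow> 'x set \<Rightarrow> (('x \<Rightarrow> 's) \<Rightarrow> real) set" where
  "exact_local_funs V b \<Lambda> = {f \<in> local_funs V b \<Lambda>.
     \<forall>\<eta>\<in>fin_configs V b. (\<exists>x\<in>\<Lambda>. \<eta> x = b) \<longrightarrow> f \<eta> = 0}"

text \<open>\<open>F \<Lambda> \<eta> = 0\<close> unless \<open>\<Lambda>\<close> is contained in the finite support of \<open>\<eta>\<close>, so the sum over all
  finite sets of vertices is pointwise finite.\<close>

definition is_expansion ::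
  "'x set \<Rightarrow> 's \<Rightarrow> (('x \<Rightarrow> 's) \<Rightarrow> real) \<Rightarrow> ('x set \<Rightarrow> ('x \<Rightarrow> 's) \<Rightarrow> real) \<Rightarrow> bool" where
  "is_expansion V b f F \<longleftrightarrow>
     (\<forall>\<Lambda>. \<Lambda> \<subseteq> V \<and> finite \<Lambda> \<longrightarrow> F \<Lambda> \<in> exact_local_funs V b \<Lambda>) \<and>
     (\<forall>\<eta>\<in>fin_configs V b. f \<eta> = sum' (\<lambda>\<Lambda>. F \<Lambda> \<eta>) {\<Lambda>. \<Lambda> \<subseteq> V \<and> finite \<Lambda>})"

text \<open>An expansion is unique on the finite subsets of \<open>V\<close>, hence the existential quantifier.\<close>

definition uniform_fun ::
  "'x set \<Rightarrow> ('x \<times> 'x) set \<Rightarrow> 's \<Rightarrow> (('x \<Rightarrow> 's) \<Rightarrow> real) \<Rightarrow> bool" where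
  "uniform_fun V E b f \<longleftrightarrow>
     f \<in> fin_configs V b \<rightarrow>\<^sub>E UNIV \<and>
     (\<exists>F. is_expansion V b f F \<and>
        (\<exists>R>0. \<forall>\<Lambda>. \<Lambda> \<subseteq> V \<and> finite \<Lambda> \<and> real (gdiam E \<Lambda>) > R \<longrightarrow>
           (\<forall>\<eta>\<in>fin_configs V b. F \<Lambda> \<eta> = 0)))"

definition unif_funs0 ::
  "'x set \<Rightarrow> ('x \<times> 'x) set \<Rightarrow> 's \<Rightarrow> (('x \<Rightarrow> 's) \<Rightarrow> real) set" where
  "unif_funs0 V E b = {f. uniform_fun V E b f \<and> f (base_config V b) = 0}"

definition forms ::
  "'x set \<Rightarrow> ('x \<times> 'x) set \<Rightarrow> 's \<Rightarrow> 's interaction \<Rightarrow> (('x, 's) transition \<Rightarrow> real) set" where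
  "forms V E b \<phi> = {\<omega> \<in> fin_transitions V E b \<phi> \<rightarrow>\<^sub>E UNIV.
     \<forall>t\<in>fin_transitions V E b \<phi>. \<omega> (prod.swap t) = - \<omega> t}"

text \<open>\<open>edge_path T u p v\<close>: the edges listed in \<open>p\<close> form a path from \<open>u\<close> to \<open>v\<close> in the graph with
  edge set \<open>T\<close>.\<close>

fun edge_path :: "('a \<times> 'a) set \<Rightarrow> 'a \<Rightarrow> ('a \<times> 'a) list \<Rightarrow> 'a \<Rightarrow> bool" where
  "edge_path T u [] v \<longleftrightarrow> u = v"
| "edge_path T u (t # p) v \<longleftrightarrow> t \<in> T \<and> fst t = u \<and> edge_path T (snd t) p v"

definition closed_form ::
  "'x set \<Rightarrow> ('x \<times> 'x) set \<Rightarrow> 's \<Rightarrow> 's interaction \<Rightarrow> (('x, 's) transition \<Rightarrow> real) \<Rightarrow> bool" where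
  "closed_form V E b \<phi> \<omega> \<longleftrightarrow>
     (\<forall>\<eta>\<in>fin_configs V b. \<forall>p. edge_path (fin_transitions V E b \<phi>) \<eta> p \<eta> \<longrightarrow>
        (\<Sum>t\<leftarrow>p. \<omega> t) = 0)"

definition form_at ::
  "'x set \<Rightarrow> 's \<Rightarrow> 's interaction \<Rightarrow> (('x, 's) transition \<Rightarrow> real) \<Rightarrow> 'x \<times> 'x \<Rightarrow>
     ('x \<Rightarrow> 's) \<Rightarrow> real" where
  "form_at V b \<phi> \<omega> e = (\<lambda>\<eta>\<in>fin_configs V b. \<omega> (\<eta>, conf_step \<phi> e \<eta>))"

definition uniform_form ::
  "'x set \<Rightarrow> ('x \<times> 'x) set \<Rightarrow> 's \<Rightarrow> 's interaction \<Rightarrow> (('x, 's) transition \<Rightarrow> real) \<Rightarrow> bool" where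
  "uniform_form V E b \<phi> \<omega> \<longleftrightarrow>
     (\<exists>R>0. \<forall>e\<in>E. form_at V b \<phi> \<omega> e \<in> local_funs V b (edge_ball V E e R))"

definition unif_closed_forms ::
  "'x set \<Rightarrow> ('x \<times> 'x) set \<Rightarrow> 's \<Rightarrow> 's interaction \<Rightarrow> (('x, 's) transition \<Rightarrow> real) set" where
  "unif_closed_forms V E b \<phi> =
     {\<omega> \<in> forms V E b \<phi>. closed_form V E b \<phi> \<omega> \<and> uniform_form V E b \<phi> \<omega>}"

text \<open>As \<open>\<omega>\<^sub>e \<eta> = \<omega> (\<eta>, \<eta>\<^sup>e)\<close>, the form with components \<open>f \<eta>\<^sup>e - f \<eta>\<close> is the following
  function of transitions.\<close>

definition boundary ::
  "'x set \<Rightarrow> ('x \<times> 'x) set \<Rightarrow> 's \<Rightarrow> 's interaction \<Rightarrow> (('x \<Rightarrow> 's) \<Rightarrow> real) \<Rightarrow>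
     ('x, 's) transition \<Rightarrow> real" where
  "boundary V E b \<phi> f = (\<lambda>t\<in>fin_transitions V E b \<phi>. f (snd t) - f (fst t))"

section \<open>Group actions\<close>

definition locale_action ::
  "('g, 'm) monoid_scheme \<Rightarrow> 'x set \<Rightarrow> ('x \<times> 'x) set \<Rightarrow> ('g \<Rightarrow> 'x \<Rightarrow> 'x) \<Rightarrow> bool" where
  "locale_action G V E act \<longleftrightarrow>
     group_action G V act \<and>
     (\<forall>\<sigma>\<in>carrier G. \<forall>x\<in>V. \<forall>y\<in>V. (x, y) \<in> E \<longleftrightarrow> (act \<sigma> x, act \<sigma> y) \<in> E)"

definition free_action ::
  "('g, 'm) monoid_scheme \<Rightarrow> 'x set \<Rightarrow> ('g \<Rightarrow> 'x \<Rightarrow> 'x) \<Rightarrow> bool" where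
  "free_action G V act \<longleftrightarrow>
     (\<forall>\<sigma>\<in>carrier G. \<forall>\<tau>\<in>carrier G. (\<exists>x\<in>V. act \<sigma> x = act \<tau> x) \<longrightarrow> \<sigma> = \<tau>)"

definition fundamental_domain ::
  "('g, 'm) monoid_scheme \<Rightarrow> 'x set \<Rightarrow> ('g \<Rightarrow> 'x \<Rightarrow> 'x) \<Rightarrow> 'x set \<Rightarrow> bool" where
  "fundamental_domain G V act \<Lambda>0 \<longleftrightarrow>
     \<Lambda>0 \<subseteq> V \<and> (\<forall>U\<in>orbits G V act. \<exists>!x. x \<in> \<Lambda>0 \<inter> U)"

definition shift_config :: "'x set \<Rightarrow> ('g \<Rightarrow> 'x \<Rightarrow> 'x) \<Rightarrow> 'g \<Rightarrow> ('x \<Rightarrow> 's) \<Rightarrow> 'x \<Rightarrow> 's" where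
  "shift_config V act \<sigma> \<eta> = (\<lambda>x\<in>V. \<eta> (act \<sigma> x))"

definition shift_fun ::
  "'x set \<Rightarrow> 's \<Rightarrow> ('g \<Rightarrow> 'x \<Rightarrow> 'x) \<Rightarrow> 'g \<Rightarrow> (('x \<Rightarrow> 's) \<Rightarrow> real) \<Rightarrow> ('x \<Rightarrow> 's) \<Rightarrow> real" where
  "shift_fun V b act \<sigma> f = (\<lambda>\<eta>\<in>fin_configs V b. f (shift_config V act \<sigma> \<eta>))"

definition shift_form ::
  "'x set \<Rightarrow> ('x \<times> 'x) set \<Rightarrow> 's \<Rightarrow> 's interaction \<Rightarrow> ('g \<Rightarrow> 'x \<Rightarrow> 'x) \<Rightarrow> 'g \<Rightarrow>
     (('x, 's) transition \<Rightarrow> real) \<Rightarrow> ('x, 's) transition \<Rightarrow> real" where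
  "shift_form V E b \<phi> act \<sigma> \<omega> = (\<lambda>t\<in>fin_transitions V E b \<phi>.
     \<omega> (shift_config V act \<sigma> (fst t), shift_config V act \<sigma> (snd t)))"

definition inv_unif_funs0 ::
  "'x set \<Rightarrow> ('x \<times> 'x) set \<Rightarrow> 's \<Rightarrow> ('g, 'm) monoid_scheme \<Rightarrow> ('g \<Rightarrow> 'x \<Rightarrow> 'x) \<Rightarrow>
     (('x \<Rightarrow> 's) \<Rightarrow> real) set" where
  "inv_unif_funs0 V E b G act =
     {f \<in> unif_funs0 V E b. \<forall>\<sigma>\<in>carrier G. shift_fun V b act \<sigma> f = f}"

definition inv_closed_forms ::
  "'x set \<Rightarrow> ('x \<times> 'x) set \<Rightarrow> 's \<Rightarrow> 's interaction \<Rightarrow> ('g, 'm) monoid_scheme \<Rightarrow>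
     ('g \<Rightarrow> 'x \<Rightarrow> 'x) \<Rightarrow> (('x, 's) transition \<Rightarrow> real) set" where
  "inv_closed_forms V E b \<phi> G act =
     {\<omega> \<in> unif_closed_forms V E b \<phi>. \<forall>\<sigma>\<in>carrier G. shift_form V E b \<phi> act \<sigma> \<omega> = \<omega>}"

definition inv_exact_forms ::
  "'x set \<Rightarrow> ('x \<times> 'x) set \<Rightarrow> 's \<Rightarrow> 's interaction \<Rightarrow> ('g, 'm) monoid_scheme \<Rightarrow>
     ('g \<Rightarrow> 'x \<Rightarrow> 'x) \<Rightarrow> (('x, 's) transition \<Rightarrow> real) set" where
  "inv_exact_forms V E b \<phi> G act = boundary V E b \<phi> ` inv_unif_funs0 V E b G act"

definition inv_closed_space ::
  "'x set \<Rightarrow> ('x \<times> 'x) set \<Rightarrow> 's \<Rightarrow> 's interaction \<Rightarrow> ('g, 'm) monoid_scheme \<Rightarrow>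
     ('g \<Rightarrow> 'x \<Rightarrow> 'x) \<Rightarrow> (real, ('x, 's) transition \<Rightarrow> real) module" where
  "inv_closed_space V E b \<phi> G act =
     (fun_space (fin_transitions V E b \<phi>))\<lparr>carrier := inv_closed_forms V E b \<phi> G act\<rparr>"

definition inv_exact_space ::
  "'x set \<Rightarrow> ('x \<times> 'x) set \<Rightarrow> 's \<Rightarrow> 's interaction \<Rightarrow> ('g, 'm) monoid_scheme \<Rightarrow>
     ('g \<Rightarrow> 'x \<Rightarrow> 'x) \<Rightarrow> (real, ('x, 's) transition \<Rightarrow> real) module" where
  "inv_exact_space V E b \<phi> G act =
     (fun_space (fin_transitions V E b \<phi>))\<lparr>carrier := inv_exact_forms V E b \<phi> G act\<rparr>"

section \<open>The connecting homomorphism and its sections\<close>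

definition connecting_at ::
  "'x set \<Rightarrow> 's \<Rightarrow> 's interaction \<Rightarrow> ('g \<Rightarrow> 'x \<Rightarrow> 'x) \<Rightarrow> (('x \<Rightarrow> 's) \<Rightarrow> real) \<Rightarrow> 'g \<Rightarrow>
     ('s \<Rightarrow> real) \<Rightarrow> bool" where
  "connecting_at V b \<phi> act f \<sigma> \<xi> \<longleftrightarrow>
     \<xi> \<in> consv b \<phi> \<and>
     (\<forall>\<eta>\<in>fin_configs V b. xi_sum \<xi> V \<eta> = f \<eta> - shift_fun V b act \<sigma> f \<eta>)"

definition connecting_map ::
  "'x set \<Rightarrow> ('x \<times> 'x) set \<Rightarrow> 's \<Rightarrow> 's interaction \<Rightarrow> ('g, 'm) monoid_scheme \<Rightarrow>
     ('g \<Rightarrow> 'x \<Rightarrow> 'x) \<Rightarrow> (('x, 's) transition \<Rightarrow> real) \<Rightarrow> 'g \<Rightarrow> 's \<Rightarrow> real" where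
  "connecting_map V E b \<phi> G act \<omega> =
     (let f = (SOME f. f \<in> unif_funs0 V E b \<and> boundary V E b \<phi> f = \<omega>)
      in (\<lambda>\<sigma>\<in>carrier G. THE \<xi>. connecting_at V b \<phi> act f \<sigma> \<xi>))"

text \<open>The map that \<open>h\<close> induces on cosets, provided that \<open>h\<close> is constant on each of them.\<close>

definition induced_map :: "('a \<Rightarrow> 'b) \<Rightarrow> 'a set \<Rightarrow> 'b" where
  "induced_map h A = the_elem (h ` A)"

text \<open>For \<open>\<eta>\<close> in \<open>fin_configs\<close> and a free action, only finitely many translates of \<open>\<Lambda>0\<close> meet the
  support of \<open>\<eta>\<close>, so the sum over the possibly infinite group is pointwise finite.\<close>

definition section_map ::
  "'x set \<Rightarrow> ('x \<times> 'x) set \<Rightarrow> 's \<Rightarrow> 's interaction \<Rightarrow> ('g, 'm) monoid_scheme \<Rightarrow>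
     ('g \<Rightarrow> 'x \<Rightarrow> 'x) \<Rightarrow> 'x set \<Rightarrow> ('g \<Rightarrow> 's \<Rightarrow> real) \<Rightarrow> ('x, 's) transition \<Rightarrow> real" where
  "section_map V E b \<phi> G act \<Lambda>0 \<psi> =
     boundary V E b \<phi> (\<lambda>\<eta>\<in>fin_configs V b.
       sum' (\<lambda>\<tau>. xi_sum (\<psi> \<tau>) (act \<tau> ` \<Lambda>0) \<eta>) (carrier G))"

end

theory Submission
  imports Defs "HOL-Library.Multiset"
begin

text \<open>
  The theorem is the beginning of the long exact sequence of group cohomology for
  \<open>0 \<rightarrow> Consv \<rightarrow> C\<^sup>0 \<rightarrow> Z\<^sup>1 \<rightarrow> 0\<close>, where \<open>C\<^sup>0\<close> are the uniform functions and \<open>Z\<^sup>1\<close> the closed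
  uniform forms, together with a splitting. Most of the work is the exactness of this sequence.

  A uniform function with zero boundary is constant along transitions, hence, by irreducible
  quantification, a function of the total charge; as it is additive on particles that are far from
  each other, it is the total of a conserved quantity (\<open>boundary_kernel\<close>).

  A closed uniform form has a potential \<open>f\<close>, which is unique only up to a function of the total charge
  (and need not be uniform), and the task is to choose this function such that \<open>f\<close> becomes uniform
  (\<open>uniform_closed_form_exact\<close>). Uniformity of the form says that a rearrangement of particles changes
  \<open>f\<close> by an amount that depends only on the configuration nearby (\<open>local_diff_transport\<close>). So the
  interaction \<open>f (\<eta> \<union> \<zeta>) - f \<eta> - f \<zeta>\<close> of two distant configurations does not change when one of them is
  rearranged without coming close to the other. If \<open>\<eta>\<close> is in the middle of the locale and \<open>\<zeta>\<close> at one of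
  its ends, the interaction is therefore a function of the two charges only. Three groups of particles,
  one behind the other, show that it is a 2-cocycle on the monoid of charges (\<open>cocycle_h\<close>).

  As seen from a ball that is far out at one end, the rest of the locale, with the other ends, is at
  infinity. This exchanges the roles of the two charges, so that the cocycles of different ends are
  transposes of each other (\<open>swap_separated\<close>). If there are three ends, or if there are arbitrarily
  large balls with connected complement, all ends have the same cocycle and it is symmetric
  (\<open>symmetric_if_transferable\<close>). If the interaction is simple, the monoid of charges is that of the
  natural numbers or of the integers, and all of its cocycles are symmetric (\<open>symmetric_if_simple\<close>).

  A symmetric real-valued cocycle on the charges is a coboundary, since the reals are divisible
  (\<open>symmetric_cocycle_splits\<close>). The corresponding function of the total charge, added to \<open>f\<close>, removes
  all interactions across gaps (\<open>decouple\<close>). Then the effect of removing the particle at a site depends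
  only on the configuration nearby, because all other particles can be moved far away, where they do not
  interact with it (\<open>removal_local\<close>). This is uniformity, by Moebius inversion (\<open>fin_range_uniform\<close>).

  The connecting homomorphism is then well defined, and its kernel consists of the boundaries of
  invariant functions (\<open>inv_exact_iff\<close>). A fundamental domain cuts the locale into tiles that are
  permuted simply transitively by the group. For a homomorphism \<open>\<psi>\<close>, the sum of \<open>\<psi> \<tau>\<close> over the particles
  in the tile with label \<open>\<tau>\<close>, for all \<open>\<tau>\<close>, is a uniform function that the shift by \<open>\<sigma>\<close> changes by the
  total of \<open>\<psi> \<sigma>\<close> (\<open>tile_sum_connecting\<close>), so its boundary is an invariant form that \<open>\<delta>\<close> maps to \<open>\<psi>\<close>.
\<close>

section \<open>Connected sets and balls in a locale\<close>

lemma connected_inI_center: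
  assumes "sym E" "c \<in> A" "\<And>x. x \<in> A \<Longrightarrow> (c, x) \<in> (Restr E A)\<^sup>*"
  shows "connected_in E A"
proof -
  have "sym ((Restr E A)\<^sup>*)"
    using assms(1) by (intro sym_rtrancl) (auto simp: sym_def)
  then show ?thesis
    unfolding connected_in_def using assms(3) by (meson rtrancl_trans symD)
qed

lemma connected_in_Un:
  assumes "sym E" "connected_in E A" "connected_in E B" "A \<inter> B \<noteq> {}"
  shows "connected_in E (A \<union> B)"
proof -
  obtain c where c: "c \<in> A" "c \<in> B" using assms(4) by blast
  have "(Restr E A)\<^sup>* \<subseteq> (Restr E (A \<union> B))\<^sup>*" "(Restr E B)\<^sup>* \<subseteq> (Restr E (A \<union> B))\<^sup>*"
    by (auto intro!: rtrancl_mono)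
  then have "(c, x) \<in> (Restr E (A \<union> B))\<^sup>*" if "x \<in> A \<union> B" for x
    using that assms(2,3) c unfolding connected_in_def by blast
  then show ?thesis
    using c by (intro connected_inI_center[OF assms(1), of c]) auto
qed

lemma connected_in_singleton: "connected_in E {x}"
  by (simp add: connected_in_def)

lemma connected_in_insert:
  assumes "sym E" "connected_in E A" "a \<in> A" "(a, x) \<in> E"
  shows "connected_in E (insert x A)"
proof -
  have "connected_in E {a, x}"
    using assms(1,4) by (intro connected_inI_center[of E a]) auto
  from connected_in_Un[OF assms(1,2) this] assms(3) show ?thesis
    by (simp add: insert_absorb)
qed

text \<open>Irreducible quantification speaks of finite graphs, so connectedness of an infinite set is
  used through its finite connected subsets.\<close>

lemma finite_connected_superset:
  assumes "sym E" "connected_in E K" "finite F" "F \<noteq> {}" "F \<subseteq> K"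
  obtains U where "finite U" "connected_in E U" "F \<subseteq> U" "U \<subseteq> K"
proof -
  have path: "\<exists>U. finite U \<and> connected_in E U \<and> x \<in> U \<and> y \<in> U \<and> U \<subseteq> K"
    if "x \<in> K" "(x, y) \<in> (Restr E K)\<^sup>*" for x y
    using that(2)
  proof (induction rule: rtrancl_induct)
    case base
    show ?case using that(1) connected_in_singleton[of E x] by (intro exI[of _ "{x}"]) blast
  next
    case (step y z)
    from step.IH obtain U where U: "finite U" "connected_in E U" "x \<in> U" "y \<in> U" "U \<subseteq> K"
      by (elim exE conjE)
    moreover have yz: "(y, z) \<in> E" "z \<in> K" using step.hyps(2) by simp_all
    moreover have "connected_in E (insert z U)"
      by (rule connected_in_insert[OF assms(1) U(2,4) yz(1)])
    ultimately show ?case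
      by (intro exI[of _ "insert z U"]) simp
  qed
  have "\<exists>U. finite U \<and> connected_in E U \<and> F \<subseteq> U \<and> U \<subseteq> K"
    using assms(3-5)
  proof (induction rule: finite_ne_induct)
    case (singleton x)
    then show ?case using connected_in_singleton[of E x] by (intro exI[of _ "{x}"]) blast
  next
    case (insert x F)
    have "F \<subseteq> K" using insert.prems by blast
    from insert.IH[OF this]
    obtain U where U: "finite U" "connected_in E U" "F \<subseteq> U" "U \<subseteq> K" by blast
    obtain y where y: "y \<in> F" using insert.hyps(2) by blast
    have "(x, y) \<in> (Restr E K)\<^sup>*"
      using assms(2) insert.prems y unfolding connected_in_def by blast
    moreover have "x \<in> K" using insert.prems by blast
    ultimately obtain U' where U': "finite U'" "connected_in E U'" "x \<in> U'" "y \<in> U'" "U' \<subseteq> K"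
      using path by blast
    have "connected_in E (U \<union> U')"
      using U U' y by (intro connected_in_Un[OF assms(1)]) auto
    then show ?case
      using U U' by (intro exI[of _ "U \<union> U'"]) blast
  qed
  then show thesis using that by blast
qed

locale graph =
  fixes V :: "'x set" and E :: "('x \<times> 'x) set"
  assumes locale_graph: "graph_locale V E"
begin

abbreviation d where "d \<equiv> gdist E"

definition ball where "ball x n = {y \<in> V. d x y \<le> n}"

definition comp where "comp A x = (Restr E A)\<^sup>* `` {x}"

lemma V_ne: "V \<noteq> {}" and E_sub: "E \<subseteq> V \<times> V" and sym_E: "sym E" and irrefl_E: "irrefl E"
  and loc_fin: "x \<in> V \<Longrightarrow> finite {e \<in> E. fst e = x \<or> snd e = x}" and conn_V: "connected_in E V"
  using locale_graph by (auto simp: graph_locale_def)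

lemma E_V: "(x, y) \<in> E \<Longrightarrow> x \<in> V" "(x, y) \<in> E \<Longrightarrow> y \<in> V"
  using E_sub by auto

lemma E_neq: "(x, y) \<in> E \<Longrightarrow> x \<noteq> y"
  using irrefl_E by (auto simp: irrefl_def)

lemma relpow_d:
  assumes "x \<in> V" "y \<in> V" shows "(x, y) \<in> E ^^ d x y"
proof -
  have "(x, y) \<in> (Restr E V)\<^sup>*" using conn_V assms by (simp add: connected_in_def)
  moreover have "Restr E V = E" using E_sub by auto
  ultimately obtain n where "(x, y) \<in> E ^^ n" using rtrancl_imp_relpow by fastforce
  then show ?thesis unfolding gdist_def by (rule LeastI)
qed

lemma d_le: "(x, y) \<in> E ^^ n \<Longrightarrow> d x y \<le> n"
  unfolding gdist_def by (rule Least_le)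

lemma d_self [simp]: "d x x = 0"
  using d_le[of x x 0] by simp

lemma d_eq_0: "x \<in> V \<Longrightarrow> y \<in> V \<Longrightarrow> d x y = 0 \<longleftrightarrow> x = y"
  using relpow_d[of x y] by auto

lemma d_commute: "x \<in> V \<Longrightarrow> y \<in> V \<Longrightarrow> d x y = d y x"
proof -
  have "(x, y) \<in> E ^^ n \<Longrightarrow> (y, x) \<in> E ^^ n" for n x y
  proof (induction n arbitrary: y)
    case (Suc n)
    then obtain z where "(x, z) \<in> E ^^ n" "(z, y) \<in> E" by auto
    then show ?case using Suc.IH symD[OF sym_E] by (blast intro: relpow_Suc_I2)
  qed simp
  then have "(x, y) \<in> E ^^ n \<longleftrightarrow> (y, x) \<in> E ^^ n" for n x y by blast
  then show ?thesis by (simp add: gdist_def)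
qed

lemma d_triangle: "x \<in> V \<Longrightarrow> y \<in> V \<Longrightarrow> z \<in> V \<Longrightarrow> d x z \<le> d x y + d y z"
  using relpow_d[of x y] relpow_d[of y z] by (intro d_le) (auto simp: relpow_add)

lemma d_edge: "(x, y) \<in> E \<Longrightarrow> d x y \<le> 1"
  by (rule d_le) simp

text \<open>Dropping the last edge of a shortest path; induction along such paths yields the finiteness and
  the connectedness of balls and the existence of points at every distance.\<close>

lemma geodesic_last:
  assumes "x \<in> V" "y \<in> V" "d x y = Suc n"
  obtains z where "z \<in> V" "d x z = n" "(z, y) \<in> E"
proof -
  have "(x, y) \<in> E ^^ Suc n" using relpow_d[OF assms(1,2)] assms(3) by simp
  then obtain z where z: "(x, z) \<in> E ^^ n" "(z, y) \<in> E" by auto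
  then have "z \<in> V" "d x z \<le> n" using E_V d_le by auto
  moreover have "Suc n \<le> d x z + 1"
    using d_triangle[OF assms(1) \<open>z \<in> V\<close> assms(2)] d_edge[OF z(2)] assms(3) by linarith
  ultimately show thesis using z that by auto
qed

lemma ball_V: "ball x n \<subseteq> V" by (auto simp: ball_def)

lemma center_in_ball: "x \<in> V \<Longrightarrow> x \<in> ball x n" by (simp add: ball_def)

lemma ball_mono: "m \<le> n \<Longrightarrow> ball x m \<subseteq> ball x n" by (auto simp: ball_def)

lemma ball_Suc: "x \<in> V \<Longrightarrow> ball x (Suc n) \<subseteq> ball x n \<union> (\<Union>z\<in>ball x n. snd ` {e \<in> E. fst e = z \<or> snd e = z})"
proof
  fix y assume x: "x \<in> V" and y: "y \<in> ball x (Suc n)"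
  show "y \<in> ball x n \<union> (\<Union>z\<in>ball x n. snd ` {e \<in> E. fst e = z \<or> snd e = z})"
  proof (cases "d x y = Suc n")
    case True
    moreover have "y \<in> V" using y by (simp add: ball_def)
    ultimately obtain z where z: "z \<in> V" "d x z = n" "(z, y) \<in> E"
      using geodesic_last x by blast
    then have "y \<in> snd ` {e \<in> E. fst e = z \<or> snd e = z}" by force
    moreover have "z \<in> ball x n" using z by (simp add: ball_def)
    ultimately show ?thesis by blast
  next
    case False
    then show ?thesis using y by (auto simp: ball_def)
  qed
qed

lemma finite_ball: "x \<in> V \<Longrightarrow> finite (ball x n)"
proof (induction n)
  case 0
  then have "ball x 0 \<subseteq> {x}" using d_eq_0 by (auto simp: ball_def)
  then show ?case using finite_subset by blast
next
  case (Suc n)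
  show ?case
    using Suc loc_fin ball_V by (intro finite_subset[OF ball_Suc]) blast+
qed

lemma connected_ball: "x \<in> V \<Longrightarrow> connected_in E (ball x n)"
proof (rule connected_inI_center[OF sym_E])
  fix y assume x: "x \<in> V"
  have "\<forall>y\<in>V. d x y = m \<longrightarrow> m \<le> n \<longrightarrow> (x, y) \<in> (Restr E (ball x n))\<^sup>*" for m
  proof (induction m)
    case 0
    then show ?case using d_eq_0[OF x] by (metis rtrancl.rtrancl_refl)
  next
    case (Suc m)
    show ?case
    proof (intro ballI impI)
      fix y assume y: "y \<in> V" "d x y = Suc m" "Suc m \<le> n"
      then obtain z where z: "z \<in> V" "d x z = m" "(z, y) \<in> E" using geodesic_last x by blast
      then have "(z, y) \<in> Restr E (ball x n)" using y by (auto simp: ball_def)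
      moreover have "(x, z) \<in> (Restr E (ball x n))\<^sup>*" using Suc z y by simp
      ultimately show "(x, y) \<in> (Restr E (ball x n))\<^sup>*" by (rule rtrancl_into_rtrancl[rotated])
    qed
  qed
  then show "y \<in> ball x n \<Longrightarrow> (x, y) \<in> (Restr E (ball x n))\<^sup>*" by (auto simp: ball_def)
qed (rule center_in_ball)

text \<open>Distances are natural numbers, so only the integer part of a radius matters and all later
  estimates can be made with natural radii.\<close>

lemma gball_eq_ball: "0 \<le> R \<Longrightarrow> gball V E x R = ball x (nat \<lfloor>R\<rfloor>)"
proof -
  assume "0 \<le> R"
  then have "real n \<le> R \<longleftrightarrow> n \<le> nat \<lfloor>R\<rfloor>" for n
    by (simp add: le_nat_iff le_floor_iff)
  then show ?thesis by (auto simp: gball_def ball_def)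
qed

lemma finite_in_ball:
  assumes "x \<in> V" "finite F" "F \<subseteq> V"
  obtains n where "F \<subseteq> ball x n"
proof
  show "F \<subseteq> ball x (Max (d x ` F))" using assms by (auto simp: ball_def)
qed

lemma finite_in_ball_ge:
  assumes "x \<in> V" "finite F" "F \<subseteq> V"
  obtains n where "F \<subseteq> ball x n" "m \<le> n"
proof -
  obtain n where "F \<subseteq> ball x n" using finite_in_ball assms by blast
  then have "F \<subseteq> ball x (max m n)" using ball_mono[of n "max m n" x] by auto
  then show thesis using that by auto
qed

lemma comp_sub: "x \<in> A \<Longrightarrow> comp A x \<subseteq> A"
proof
  fix y assume "x \<in> A" "y \<in> comp A x"
  then have "(x, y) \<in> (Restr E A)\<^sup>*" by (simp add: comp_def)
  then show "y \<in> A"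
  proof (cases rule: rtranclE)
    case base
    then show ?thesis using \<open>x \<in> A\<close> by simp
  next
    case (step z)
    then show ?thesis by simp
  qed
qed

lemma self_in_comp: "x \<in> comp A x" by (simp add: comp_def)

lemma comp_max:
  assumes "connected_in E U" "U \<subseteq> A" "y \<in> U" "y \<in> comp A x"
  shows "U \<subseteq> comp A x"
proof
  fix z assume "z \<in> U"
  then have "(y, z) \<in> (Restr E U)\<^sup>*" using assms(1,3) by (simp add: connected_in_def)
  moreover have "(Restr E U)\<^sup>* \<subseteq> (Restr E A)\<^sup>*" using assms(2) by (intro rtrancl_mono) auto
  ultimately have "(y, z) \<in> (Restr E A)\<^sup>*" by (rule rev_subsetD)
  moreover have "(x, y) \<in> (Restr E A)\<^sup>*" using assms(4) by (simp add: comp_def)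
  ultimately have "(x, z) \<in> (Restr E A)\<^sup>*" by (rule rtrancl_trans[rotated])
  then show "z \<in> comp A x" by (simp add: comp_def)
qed

lemma connected_comp: assumes "x \<in> A" shows "connected_in E (comp A x)"
proof (rule connected_inI_center[OF sym_E self_in_comp])
  fix y assume "y \<in> comp A x"
  then have "(x, y) \<in> (Restr E A)\<^sup>*" by (simp add: comp_def)
  then show "(x, y) \<in> (Restr E (comp A x))\<^sup>*"
  proof (induction rule: rtrancl_induct)
    case (step y z)
    have "y \<in> comp A x" "z \<in> comp A x"
      using step.hyps(1) rtrancl_into_rtrancl[OF step.hyps] by (simp_all add: comp_def)
    then have "(y, z) \<in> Restr E (comp A x)" using step.hyps(2) by blast
    then show ?case using step.IH by (rule rtrancl_into_rtrancl[rotated])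
  qed simp
qed

lemma conn_components_eq: "conn_components E A = comp A ` A"
  by (auto simp: conn_components_def quotient_def comp_def)

lemma comp_eq:
  assumes "y \<in> comp A x" "x \<in> A" shows "comp A y = comp A x"
proof (rule antisym)
  have y: "y \<in> A" using comp_sub assms by blast
  show "comp A y \<subseteq> comp A x"
    using comp_max[OF connected_comp[OF y] comp_sub[OF y] self_in_comp assms(1)] .
  have "comp A x \<subseteq> comp A y"
    using comp_max[OF connected_comp[OF assms(2)] comp_sub[OF assms(2)] assms(1) self_in_comp] .
  then have "x \<in> comp A y" using self_in_comp by blast
  then show "comp A x \<subseteq> comp A y"
    using comp_max[OF connected_comp[OF assms(2)] comp_sub[OF assms(2)] self_in_comp] by blast
qed

text \<open>A point of the component that is nearest to the centre has a predecessor on a shortest path, and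
  that predecessor cannot lie outside the ball without belonging to the component.\<close>

lemma connected_ball_Un_comp:
  assumes "x \<in> V" "z \<in> V - ball x n"
  shows "connected_in E (ball x n \<union> comp (V - ball x n) z)"
proof -
  define K where "K = comp (V - ball x n) z"
  have K: "K \<subseteq> V - ball x n" "z \<in> K" "connected_in E K"
    unfolding K_def using comp_sub[OF assms(2)] self_in_comp connected_comp[OF assms(2)] by simp_all
  have "\<exists>k\<in>K. \<exists>u\<in>ball x n. (u, k) \<in> E"
  proof -
    define m where "m = (LEAST m. \<exists>k\<in>K. d x k = m)"
    have "\<exists>m. \<exists>k\<in>K. d x k = m" using K(2) by blast
    then have "\<exists>k\<in>K. d x k = m" unfolding m_def by (rule LeastI_ex)
    then obtain k where k: "k \<in> K" "d x k = m" by blast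
    have "k \<in> V" "m > n" using k K(1) by (auto simp: ball_def)
    then obtain m' where m': "m = Suc m'" "m' \<ge> n" by (metis less_imp_Suc_add le_add1)
    then obtain u where u: "u \<in> V" "d x u = m'" "(u, k) \<in> E"
      using geodesic_last[OF assms(1) \<open>k \<in> V\<close>] k by auto
    have "u \<in> ball x n"
    proof (rule ccontr)
      assume nu: "u \<notin> ball x n"
      have "connected_in E (insert u K)"
        by (rule connected_in_insert[OF sym_E K(3) k(1) symD[OF sym_E u(3)]])
      moreover have "insert u K \<subseteq> V - ball x n" using nu u(1) K(1) by blast
      ultimately have "insert u K \<subseteq> K"
        using comp_max[of "insert u K" "V - ball x n" z z] K(2) by (simp add: K_def)
      then have "\<exists>k\<in>K. d x k = m'" using u(2) by blast
      then have "m \<le> m'" unfolding m_def by (rule Least_le)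
      then show False using m' by simp
    qed
    then show ?thesis using k u by blast
  qed
  then obtain k u where ku: "k \<in> K" "u \<in> ball x n" "(u, k) \<in> E" by blast
  have "connected_in E (insert k (ball x n) \<union> K)"
    by (rule connected_in_Un[OF sym_E connected_in_insert[OF sym_E connected_ball[OF assms(1)] ku(2,3)] K(3)])
      (use ku in blast)
  moreover have "insert k (ball x n) \<union> K = ball x n \<union> K" using ku(1) by blast
  ultimately show ?thesis by (simp add: K_def)
qed

end

section \<open>Ends of a weakly transferable locale\<close>

locale wt_graph = graph +
  assumes wt: "weakly_transferable V E"
begin

lemma complement_ball:
  assumes "x \<in> V"
  shows "V - ball x n \<noteq> {}"
    and "z \<in> V - ball x n \<Longrightarrow> infinite (comp (V - ball x n) z)"
proof -
  \<comment> \<open>Adding a half makes the radius positive also for \<open>n = 0\<close>.\<close>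
  have "gball V E x (real n + 1/2) = ball x n"
    by (auto simp: gball_def ball_def)
  moreover have "0 < real n + 1/2" by simp
  ultimately have "conn_components E (V - ball x n) \<noteq> {} \<and> (\<forall>K\<in>conn_components E (V - ball x n). infinite K)"
    using wt assms unfolding weakly_transferable_def Let_def by metis
  then show "V - ball x n \<noteq> {}" "z \<in> V - ball x n \<Longrightarrow> infinite (comp (V - ball x n) z)"
    by (auto simp: conn_components_eq)
qed

lemma sphere_ne: assumes "x \<in> V" shows "\<exists>u\<in>V. d x u = m"
proof -
  obtain z where "z \<in> V - ball x m" using complement_ball(1)[OF assms, of m] by blast
  then have z: "z \<in> V" "d x z > m" by (simp_all add: ball_def not_le)
  have "\<forall>z\<in>V. d x z = m + j \<longrightarrow> (\<exists>u\<in>V. d x u = m)" for j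
  proof (induction j)
    case (Suc j)
    show ?case
    proof (intro ballI impI)
      fix z assume "z \<in> V" "d x z = m + Suc j"
      then have "z \<in> V" "d x z = Suc (m + j)" by simp_all
      then obtain u where "u \<in> V" "d x u = m + j" by (rule geodesic_last[OF assms])
      then show "\<exists>u\<in>V. d x u = m" using Suc by blast
    qed
  qed simp
  moreover have "d x z = m + (d x z - m)" using z(2) by simp
  ultimately show ?thesis using z(1) by blast
qed

lemma card_ball: assumes "x \<in> V" shows "k \<le> card (ball x k)"
proof (induction k)
  case (Suc k)
  obtain u where "u \<in> V" "d x u = Suc k" using sphere_ne[OF assms] by blast
  then have "u \<in> ball x (Suc k) - ball x k" by (simp add: ball_def)
  moreover have "ball x k \<subseteq> ball x (Suc k)" by (rule ball_mono) simp
  ultimately have "ball x k \<subset> ball x (Suc k)" by blast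
  then have "card (ball x k) < card (ball x (Suc k))"
    using finite_ball[OF assms] by (intro psubset_card_mono)
  then show ?case using Suc by simp
qed simp

text \<open>Ends are described by their position relative to the balls around a fixed vertex.\<close>

definition origin where "origin = (SOME x. x \<in> V)"

lemma origin_V: "origin \<in> V"
  using V_ne by (simp add: origin_def some_in_eq)

text \<open>A representative of an end of the locale: a decreasing sequence of infinite connected sets that
  leave every ball. Different sequences may represent the same end; this is harmless because the
  cocycle attached to a sequence below depends only on the end.\<close>

definition is_end where
  "is_end \<epsilon> \<longleftrightarrow> (\<forall>n. connected_in E (\<epsilon> n) \<and> infinite (\<epsilon> n) \<and> \<epsilon> n \<subseteq> V - ball origin n \<and> \<epsilon> (Suc n) \<subseteq> \<epsilon> n)"

lemma end_mono: assumes "is_end \<epsilon>" "m \<le> n" shows "\<epsilon> n \<subseteq> \<epsilon> m"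
proof (rule lift_Suc_antimono_le[where f = \<epsilon>, OF _ assms(2)])
  show "\<epsilon> (Suc n) \<subseteq> \<epsilon> n" for n using assms(1) by (simp add: is_end_def)
qed

lemma end_ne: assumes "is_end \<epsilon>" shows "\<epsilon> n \<noteq> {}"
proof -
  have "infinite (\<epsilon> n)" using assms by (simp add: is_end_def)
  then show ?thesis by auto
qed

text \<open>A component of the complement of a ball contains infinite components of the complements of all
  larger balls, since it is infinite and balls are finite. Weak transferability makes every component
  of such a complement infinite, so the choice can be continued for ever.\<close>

lemma end_exists:
  assumes y: "y \<in> V" and z: "z \<in> V - ball y n"
  obtains \<epsilon> where "is_end \<epsilon>" "\<And>m. \<epsilon> m \<subseteq> comp (V - ball y n) z"
proof -
  define K where "K = comp (V - ball y n) z"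
  define A where "A m = V - ball origin m" for m
  obtain N where N: "ball y n \<subseteq> ball origin N"
    using finite_in_ball[OF origin_V finite_ball[OF y] ball_V] by blast
  have refine: "\<exists>w\<in>A m. comp (A m) w \<subseteq> L" if "infinite L" "connected_in E L" "L = comp (A l) v" "v \<in> A l" "l \<le> m" for L l v m
  proof -
    have "L \<subseteq> A l" using that comp_sub by simp
    then have LV: "L \<subseteq> V" by (auto simp: A_def)
    have "\<not> L \<subseteq> ball origin m" using that(1) finite_ball[OF origin_V] finite_subset by blast
    then obtain w where w: "w \<in> L" "w \<in> A m" using LV by (auto simp: A_def)
    have "A m \<subseteq> A l" using ball_mono[OF that(5)] by (auto simp: A_def)
    then have "comp (A m) w \<subseteq> comp (A l) v"
      using comp_sub[OF w(2)] w(1) unfolding that(3)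
      by (intro comp_max[OF connected_comp[OF w(2)] _ self_in_comp]) (rule order_trans)
    then show ?thesis using w(2) that(3) by blast
  qed
  have K: "infinite K" "connected_in E K" "K \<subseteq> V - ball y n"
    unfolding K_def using complement_ball(2)[OF y z] connected_comp[OF z] comp_sub[OF z] by simp_all
  have inf: "infinite (comp (A m) w)" "connected_in E (comp (A m) w)" if "w \<in> A m" for m w
    using complement_ball(2)[OF origin_V] connected_comp that unfolding A_def by blast+
  have "\<not> K \<subseteq> ball origin N" using K(1) finite_ball[OF origin_V] finite_subset by blast
  then obtain w where w: "w \<in> K" "w \<in> A N" using K(3) by (auto simp: A_def)
  have start: "comp (A N) w \<subseteq> K"
  proof -
    have "A N \<subseteq> V - ball y n" using N by (auto simp: A_def)
    then have "comp (A N) w \<subseteq> V - ball y n" using comp_sub[OF w(2)] by (rule order_trans[rotated])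
    then show ?thesis
      unfolding K_def using w(1)[unfolded K_def] by (rule comp_max[OF connected_comp[OF w(2)] _ self_in_comp])
  qed
  \<comment> \<open>Indices start at \<open>N\<close>, where the balls around the origin have swallowed the given ball.\<close>
  have "\<exists>\<epsilon>. \<forall>m. (\<exists>v\<in>A (N + m). \<epsilon> m = comp (A (N + m)) v \<and> \<epsilon> m \<subseteq> K) \<and> \<epsilon> (Suc m) \<subseteq> \<epsilon> m"
  proof (rule dependent_nat_choice)
    show "\<exists>L. \<exists>v\<in>A (N + 0). L = comp (A (N + 0)) v \<and> L \<subseteq> K"
      using w(2) start by (intro exI[of _ "comp (A N) w"] bexI[of _ w]) simp_all
  next
    fix L m assume "\<exists>v\<in>A (N + m). L = comp (A (N + m)) v \<and> L \<subseteq> K"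
    then obtain v where v: "v \<in> A (N + m)" "L = comp (A (N + m)) v" "L \<subseteq> K" by blast
    have "\<exists>w\<in>A (N + Suc m). comp (A (N + Suc m)) w \<subseteq> L"
      by (rule refine[OF _ _ v(2,1)]) (use inf[OF v(1)] v(2) in simp_all)
    then obtain w where "w \<in> A (N + Suc m)" "comp (A (N + Suc m)) w \<subseteq> L" by blast
    then show "\<exists>L'. (\<exists>v\<in>A (N + Suc m). L' = comp (A (N + Suc m)) v \<and> L' \<subseteq> K) \<and> L' \<subseteq> L"
      using v by blast
  qed
  then obtain \<epsilon> where \<epsilon>: "\<And>m. \<exists>v\<in>A (N + m). \<epsilon> m = comp (A (N + m)) v \<and> \<epsilon> m \<subseteq> K" "\<And>m. \<epsilon> (Suc m) \<subseteq> \<epsilon> m"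
    by blast
  have "is_end \<epsilon>"
    unfolding is_end_def
  proof (intro allI)
    fix m
    obtain v where v: "v \<in> A (N + m)" "\<epsilon> m = comp (A (N + m)) v" using \<epsilon>(1) by blast
    have "\<epsilon> m \<subseteq> A (N + m)" using v comp_sub by simp
    also have "\<dots> \<subseteq> A m" using ball_mono[of m "N + m" origin] by (auto simp: A_def)
    finally show "connected_in E (\<epsilon> m) \<and> infinite (\<epsilon> m) \<and> \<epsilon> m \<subseteq> V - ball origin m \<and> \<epsilon> (Suc m) \<subseteq> \<epsilon> m"
      using inf[OF v(1)] v(2) \<epsilon>(2)[of m] by (simp add: A_def)
  qed
  then show thesis using \<epsilon>(1) that unfolding K_def by blast
qed

lemma end_avoids_ball:
  assumes "is_end \<epsilon>" "y \<in> V" obtains m where "\<epsilon> m \<subseteq> V - ball y n"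
proof -
  obtain m where "ball y n \<subseteq> ball origin m"
    using finite_in_ball[OF origin_V finite_ball[OF assms(2)] ball_V] by blast
  then show thesis using assms(1) that[of m] by (auto simp: is_end_def)
qed

text \<open>The two sequences converge to different ends of the locale.\<close>

definition separated where
  "separated \<epsilon> \<epsilon>' \<longleftrightarrow> (\<exists>m. \<forall>K. connected_in E K \<and> K \<subseteq> V - ball origin m \<longrightarrow> \<not> (\<epsilon> m \<union> \<epsilon>' m \<subseteq> K))"

end

section \<open>Configurations, charges and transitions\<close>

locale system = graph V E for V :: "'x set" and E :: "('x \<times> 'x) set" +
  fixes b :: 's and \<phi> :: "'s interaction"
  assumes interaction: "interaction \<phi>" and irr: "irreducibly_quantified b \<phi>"
begin

abbreviation C where "C \<equiv> fin_configs V b"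

definition supp where "supp \<eta> = {x \<in> V. \<eta> x \<noteq> b}"

text \<open>Superposition. It is associative with the base configuration as unit, and commutative for disjoint
  supports.\<close>

definition join where "join \<eta> \<zeta> = (\<lambda>x\<in>V. if \<eta> x = b then \<zeta> x else \<eta> x)"

definition keep where "keep A \<eta> = (\<lambda>x\<in>V. if x \<in> A then \<eta> x else b)"

text \<open>All conserved quantities at once: the charge is the evaluation functional, so that two
  configurations agree in every conserved quantity iff their total charges are equal. Functionals
  form an abelian group, even when the space of conserved quantities is infinite-dimensional.\<close>

definition charge :: "'s \<Rightarrow> ('s \<Rightarrow> real) \<Rightarrow> real" where
  "charge s = (\<lambda>\<xi>. if \<xi> \<in> consv b \<phi> then \<xi> s else 0)"

definition Q where "Q \<eta> = (\<Sum>x\<in>supp \<eta>. charge (\<eta> x))"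

definition moves where "moves K = {(\<eta>, conf_step \<phi> e \<eta>) | \<eta> e. \<eta> \<in> C \<and> e \<in> Restr E K}"

lemma C_iff: "\<eta> \<in> C \<longleftrightarrow> \<eta> \<in> extensional V \<and> finite (supp \<eta>)"
  by (auto simp: fin_configs_def configs_def supp_def PiE_def)

lemma finite_supp: "\<eta> \<in> C \<Longrightarrow> finite (supp \<eta>)" by (simp add: C_iff)

lemma supp_V: "supp \<eta> \<subseteq> V" by (auto simp: supp_def)

lemma C_eqI: "\<eta> \<in> C \<Longrightarrow> \<eta>' \<in> C \<Longrightarrow> (\<And>x. x \<in> V \<Longrightarrow> \<eta> x = \<eta>' x) \<Longrightarrow> \<eta> = \<eta>'"
  by (rule extensionalityI[of _ V]) (auto simp: C_iff)

lemma C_I: "\<eta> \<in> extensional V \<Longrightarrow> finite F \<Longrightarrow> (\<And>x. x \<in> V \<Longrightarrow> x \<notin> F \<Longrightarrow> \<eta> x = b) \<Longrightarrow> \<eta> \<in> C"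
  by (auto simp: C_iff supp_def elim!: finite_subset[rotated])

lemma base_C: "base_config V b \<in> C"
  by (rule C_I[of _ "{}"]) (auto simp: base_config_def)

lemma join_C: "\<eta> \<in> C \<Longrightarrow> \<zeta> \<in> C \<Longrightarrow> join \<eta> \<zeta> \<in> C"
  by (rule C_I[of _ "supp \<eta> \<union> supp \<zeta>"]) (auto simp: join_def supp_def finite_supp[unfolded supp_def])

lemma keep_C: "\<eta> \<in> C \<Longrightarrow> keep A \<eta> \<in> C"
  by (rule C_I[of _ "supp \<eta>"]) (auto simp: keep_def supp_def finite_supp[unfolded supp_def])

lemma supp_join: "supp (join \<eta> \<zeta>) = supp \<eta> \<union> supp \<zeta>"
  by (auto simp: join_def supp_def)

lemma supp_keep: "supp (keep A \<eta>) = supp \<eta> \<inter> A"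
  by (auto simp: keep_def supp_def)

lemma supp_base: "supp (base_config V b) = {}"
  by (auto simp: base_config_def supp_def)

lemma join_assoc: "join (join \<eta> \<zeta>) \<theta> = join \<eta> (join \<zeta> \<theta>)"
  by (auto simp: join_def)

lemma join_commute: "supp \<eta> \<inter> supp \<zeta> = {} \<Longrightarrow> join \<eta> \<zeta> = join \<zeta> \<eta>"
  by (rule ext) (auto simp: join_def supp_def)

lemma join_base: "\<eta> \<in> C \<Longrightarrow> join \<eta> (base_config V b) = \<eta>"
  by (rule C_eqI) (auto simp: join_C base_C, auto simp: join_def base_config_def)

lemma base_join: "\<eta> \<in> C \<Longrightarrow> join (base_config V b) \<eta> = \<eta>"
  by (rule C_eqI) (auto simp: join_C base_C, auto simp: join_def base_config_def)

lemma charge_base [simp]: "charge b = 0"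
  by (auto simp: charge_def consv_def)

lemma Q_sum:
  assumes "finite W" "supp \<eta> \<subseteq> W" "W \<subseteq> V"
  shows "Q \<eta> = (\<Sum>x\<in>W. charge (\<eta> x))"
  unfolding Q_def
proof (rule sum.mono_neutral_left)
  show "\<forall>x\<in>W - supp \<eta>. charge (\<eta> x) = 0"
  proof
    fix x assume "x \<in> W - supp \<eta>"
    then have "\<eta> x = b" using assms(3) by (auto simp: supp_def)
    then show "charge (\<eta> x) = 0" by simp
  qed
qed (use assms in auto)

lemma Q_base [simp]: "Q (base_config V b) = 0"
  by (simp add: Q_def supp_base)

lemma Q_join:
  assumes "\<eta> \<in> C" "\<zeta> \<in> C" "supp \<eta> \<inter> supp \<zeta> = {}"
  shows "Q (join \<eta> \<zeta>) = Q \<eta> + Q \<zeta>"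
proof -
  let ?W = "supp \<eta> \<union> supp \<zeta>"
  have W: "finite ?W" "?W \<subseteq> V" using assms finite_supp supp_V by auto
  have "Q (join \<eta> \<zeta>) = (\<Sum>x\<in>?W. charge (\<eta> x) + charge (\<zeta> x))"
    unfolding Q_sum[OF W(1) _ W(2), of "join \<eta> \<zeta>", unfolded supp_join, OF subset_refl]
  proof (rule sum.cong)
    fix x assume "x \<in> ?W"
    then have "x \<in> V" "\<eta> x = b \<or> \<zeta> x = b" using assms(3) by (auto simp: supp_def)
    then show "charge (join \<eta> \<zeta> x) = charge (\<eta> x) + charge (\<zeta> x)"
      by (elim disjE) (simp_all add: join_def)
  qed simp
  also have "\<dots> = Q \<eta> + Q \<zeta>"
    by (simp only: sum.distrib Q_sum[OF W(1) _ W(2), of \<eta>] Q_sum[OF W(1) _ W(2), of \<zeta>] Un_upper1 Un_upper2)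
  finally show ?thesis .
qed

lemma Q_split: assumes "\<eta> \<in> C" shows "Q \<eta> = Q (keep A \<eta>) + Q (keep (- A) \<eta>)"
proof -
  have "join (keep A \<eta>) (keep (- A) \<eta>) = \<eta>"
    by (rule C_eqI) (use assms in \<open>auto simp: join_C keep_C, auto simp: join_def keep_def\<close>)
  moreover have "supp (keep A \<eta>) \<inter> supp (keep (- A) \<eta>) = {}" by (auto simp: supp_keep)
  ultimately show ?thesis using Q_join[OF keep_C[OF assms] keep_C[OF assms], of A "- A"] by simp
qed

lemma sum_fun_apply: "(\<Sum>x\<in>A. f x) \<xi> = (\<Sum>x\<in>A. f x \<xi>)" for f :: "'a \<Rightarrow> 'b \<Rightarrow> real"
  by (induction A rule: infinite_finite_induct) auto

lemma xi_sum_fin: 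
  assumes "\<xi> \<in> consv b \<phi>" "finite {x \<in> W. \<eta> x \<noteq> b}" "finite F" "{x \<in> W. \<eta> x \<noteq> b} \<subseteq> F" "F \<subseteq> W"
  shows "xi_sum \<xi> W \<eta> = (\<Sum>x\<in>F. \<xi> (\<eta> x))"
proof -
  have b: "\<xi> b = 0" using assms(1) by (simp add: consv_def)
  have "xi_sum \<xi> W \<eta> = sum' (\<lambda>x. \<xi> (\<eta> x)) F"
    unfolding xi_sum_def using assms(4,5) b by (intro sum.mono_neutral_right') auto
  then show ?thesis using assms(3) by simp
qed

lemma xi_sum_Q:
  assumes "\<xi> \<in> consv b \<phi>" "\<eta> \<in> C" shows "xi_sum \<xi> V \<eta> = Q \<eta> \<xi>"
proof -
  have "xi_sum \<xi> V \<eta> = (\<Sum>x\<in>supp \<eta>. \<xi> (\<eta> x))"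
    by (rule xi_sum_fin[OF assms(1)]) (use assms(2) finite_supp in \<open>auto simp: supp_def\<close>)
  then show ?thesis using assms(1) by (simp add: Q_def sum_fun_apply charge_def)
qed

lemma conf_step_apply:
  assumes "e \<in> E"
  shows "conf_step \<phi> e \<eta> (fst e) = fst (\<phi> (\<eta> (fst e), \<eta> (snd e)))"
    and "conf_step \<phi> e \<eta> (snd e) = snd (\<phi> (\<eta> (fst e), \<eta> (snd e)))"
    and "x \<noteq> fst e \<Longrightarrow> x \<noteq> snd e \<Longrightarrow> conf_step \<phi> e \<eta> x = \<eta> x"
  using E_neq[of "fst e" "snd e"] assms by (auto simp: conf_step_def)

lemma conf_step_C: assumes "e \<in> E" "\<eta> \<in> C" shows "conf_step \<phi> e \<eta> \<in> C"
proof (rule C_I[of _ "{fst e, snd e} \<union> supp \<eta>"])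
  have "fst e \<in> V" "snd e \<in> V" using E_V[of "fst e" "snd e"] assms(1) by auto
  then show "conf_step \<phi> e \<eta> \<in> extensional V"
    using assms(2) by (auto simp: C_iff extensional_def conf_step_def)
qed (use assms in \<open>auto simp: finite_supp conf_step_def supp_def finite_supp[unfolded supp_def]\<close>)

lemma charge_conserved:
  "charge (fst (\<phi> (s, t))) + charge (snd (\<phi> (s, t))) = charge s + charge t"
  by (rule ext) (auto simp: charge_def consv_def)

lemma Q_conf_step: assumes "e \<in> E" "\<eta> \<in> C" shows "Q (conf_step \<phi> e \<eta>) = Q \<eta>"
proof -
  obtain x y where e: "e = (x, y)" by (cases e)
  then have xy: "x \<in> V" "y \<in> V" "x \<noteq> y" using assms E_V E_neq by auto
  let ?\<eta> = "conf_step \<phi> e \<eta>" and ?W = "supp \<eta> - {x, y}"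
  have fin: "finite ?W" using assms finite_supp by auto
  have *: "Q \<theta> = charge (\<theta> x) + charge (\<theta> y) + (\<Sum>z\<in>?W. charge (\<theta> z))"
    if "supp \<theta> \<subseteq> insert x (insert y ?W)" for \<theta>
  proof -
    have "Q \<theta> = (\<Sum>z\<in>insert x (insert y ?W). charge (\<theta> z))"
      by (rule Q_sum[OF _ that]) (use fin xy supp_V in auto)
    also have "\<dots> = charge (\<theta> x) + charge (\<theta> y) + (\<Sum>z\<in>?W. charge (\<theta> z))"
      using fin xy by (simp add: add.assoc)
    finally show ?thesis .
  qed
  have "supp ?\<eta> \<subseteq> insert x (insert y ?W)" by (auto simp: supp_def conf_step_def e)
  moreover have "supp \<eta> \<subseteq> insert x (insert y ?W)" by auto
  moreover have "(\<Sum>z\<in>?W. charge (?\<eta> z)) = (\<Sum>z\<in>?W. charge (\<eta> z))"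
    by (rule sum.cong) (auto simp: conf_step_def e)
  moreover have "charge (?\<eta> x) + charge (?\<eta> y) = charge (\<eta> x) + charge (\<eta> y)"
    using xy charge_conserved[of "\<eta> x" "\<eta> y"] by (simp add: conf_step_def e)
  ultimately show ?thesis using *[of ?\<eta>] *[of \<eta>] by simp
qed

text \<open>A total charge is carried by finitely many particles, and only their number restricts where they
  can be placed.\<close>

lemma realize:
  assumes "\<alpha> \<in> Q ` C"
  obtains k where "\<And>A. A \<subseteq> V \<Longrightarrow> infinite A \<or> k \<le> card A \<Longrightarrow> \<exists>\<eta>\<in>C. supp \<eta> \<subseteq> A \<and> Q \<eta> = \<alpha>"
proof -
  obtain \<theta> where \<theta>: "\<theta> \<in> C" "Q \<theta> = \<alpha>" using assms by blast
  have "\<exists>\<eta>\<in>C. supp \<eta> \<subseteq> A \<and> Q \<eta> = \<alpha>" if A: "A \<subseteq> V" "infinite A \<or> card (supp \<theta>) \<le> card A" for A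
  proof -
    obtain B where B: "B \<subseteq> A" "finite B" "card B = card (supp \<theta>)"
      using A(2) by (metis infinite_arbitrarily_large obtain_subset_with_card_n)
    then obtain g where g: "bij_betw g B (supp \<theta>)"
      using finite_same_card_bij finite_supp[OF \<theta>(1)] by metis
    define \<eta> where "\<eta> = (\<lambda>x\<in>V. if x \<in> B then \<theta> (g x) else b)"
    have \<eta>: "\<eta> \<in> C" by (rule C_I[of _ B]) (use B in \<open>auto simp: \<eta>_def\<close>)
    have supp: "supp \<eta> \<subseteq> B" by (auto simp: supp_def \<eta>_def)
    have "Q \<eta> = (\<Sum>x\<in>B. charge (\<eta> x))" using B A(1) supp by (intro Q_sum) auto
    also have "\<dots> = (\<Sum>x\<in>B. charge (\<theta> (g x)))"
      using B A(1) by (intro sum.cong) (auto simp: \<eta>_def)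
    also have "\<dots> = Q \<theta>" unfolding Q_def by (rule sum.reindex_bij_betw[OF g])
    finally show ?thesis using \<eta> supp B(1) \<theta>(2) by blast
  qed
  then show thesis using that by blast
qed

lemma realize_infinite:
  assumes "\<alpha> \<in> Q ` C" "A \<subseteq> V" "infinite A"
  obtains \<eta> where "\<eta> \<in> C" "supp \<eta> \<subseteq> A" "Q \<eta> = \<alpha>"
  using realize[OF assms(1)] assms(2,3) by metis

lemma moves_preserve:
  assumes "(\<eta>, \<eta>') \<in> (moves K)\<^sup>*" "\<eta> \<in> C"
  shows "\<eta>' \<in> C" "\<And>x. x \<notin> K \<Longrightarrow> \<eta>' x = \<eta> x"
proof -
  have "\<eta>' \<in> C \<and> (\<forall>x. x \<notin> K \<longrightarrow> \<eta>' x = \<eta> x)"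
    using assms
  proof (induction rule: rtrancl_induct)
    case (step \<zeta> \<theta>)
    then obtain e where e: "e \<in> Restr E K" "\<theta> = conf_step \<phi> e \<zeta>" by (auto simp: moves_def)
    moreover have "\<theta> x = \<zeta> x" if "x \<notin> K" for x
      unfolding e(2) by (rule conf_step_apply(3)) (use e(1) that in auto)
    ultimately show ?case using step.IH[OF step.prems] conf_step_C[of e \<zeta>] by auto
  qed simp
  then show "\<eta>' \<in> C" "\<And>x. x \<notin> K \<Longrightarrow> \<eta>' x = \<eta> x" by auto
qed

lemma moves_mono: "K \<subseteq> L \<Longrightarrow> (moves K)\<^sup>* \<subseteq> (moves L)\<^sup>*"
  by (rule rtrancl_mono) (auto simp: moves_def)

text \<open>Irreducible quantification is a statement about graphs on natural numbers. The finite graph induced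
  on \<open>U\<close> is numbered, and paths of transitions on the numbered graph are lifted back, with the
  particles outside \<open>U\<close> standing still.\<close>

lemma moves_connect_finite:
  assumes U: "finite U" "U \<noteq> {}" "U \<subseteq> V" "connected_in E U"
    and \<eta>: "\<eta> \<in> C" "\<eta>' \<in> C" "\<And>x. x \<in> V - U \<Longrightarrow> \<eta> x = \<eta>' x" "Q \<eta> = Q \<eta>'"
  shows "(\<eta>, \<eta>') \<in> (moves U)\<^sup>*"
proof -
  obtain g where g: "bij_betw g U {0..<card U}" using ex_bij_betw_finite_nat[OF U(1)] by blast
  define Y where "Y = {0..<card U}"
  define F where "F = map_prod g g ` Restr E U"
  define k where "k = inv_into U g"
  have gY: "g x \<in> Y" if "x \<in> U" for x using g that unfolding Y_def by (auto simp: bij_betw_def)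
  have kU: "k i \<in> U" "g (k i) = i" if "i \<in> Y" for i
    using g that unfolding Y_def k_def by (auto simp: bij_betw_def inv_into_into f_inv_into_f)
  have kg: "k (g x) = x" if "x \<in> U" for x
    using g that unfolding k_def by (auto simp: bij_betw_def)
  have bk: "bij_betw k Y U" unfolding k_def Y_def by (rule bij_betw_inv_into[OF g])
  have FY: "F \<subseteq> Y \<times> Y" using gY by (auto simp: F_def)
  have finF: "finite F" by (rule finite_subset[OF FY]) (simp add: Y_def)
  have symF: "sym F"
  proof (rule symI)
    fix i j assume "(i, j) \<in> F"
    then obtain x y where "(x, y) \<in> E" "x \<in> U" "y \<in> U" "i = g x" "j = g y" by (auto simp: F_def)
    then have "(y, x) \<in> Restr E U" "i = g x" "j = g y" using symD[OF sym_E] by auto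
    then show "(j, i) \<in> F" by (force simp: F_def)
  qed
  have irrF: "irrefl F"
  proof (rule irreflI, rule notI)
    fix i assume "(i, i) \<in> F"
    then obtain x y where "(x, y) \<in> E" "x \<in> U" "y \<in> U" "i = g x" "i = g y" by (auto simp: F_def)
    then show False using kg[of x] kg[of y] E_neq[of x y] by simp
  qed
  have path: "(g x, g y) \<in> (Restr F Y)\<^sup>*" if "(x, y) \<in> (Restr E U)\<^sup>*" for x y
    using that
  proof (induction rule: rtrancl_induct)
    case (step y z)
    have "(g y, g z) \<in> F" using step.hyps(2) by (force simp: F_def)
    then have "(g y, g z) \<in> Restr F Y" using FY by blast
    then show ?case using step.IH by (rule rtrancl_into_rtrancl[rotated])
  qed simp
  have "connected_in F Y"
    unfolding connected_in_def
  proof (intro ballI)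
    fix i j assume ij: "i \<in> Y" "j \<in> Y"
    have "(k i, k j) \<in> (Restr E U)\<^sup>*" using U(4) kU(1)[OF ij(1)] kU(1)[OF ij(2)] by (simp add: connected_in_def)
    from path[OF this] show "(i, j) \<in> (Restr F Y)\<^sup>*" using kU(2) ij by simp
  qed
  moreover have "Y \<noteq> {}" using U(1,2) by (simp add: Y_def card_gt_0_iff)
  ultimately have "graph_locale Y F"
    unfolding graph_locale_def using FY symF irrF finF by simp
  then have "finite Y \<and> graph_locale Y F" by (simp add: Y_def)
  with irr have "\<forall>\<theta>\<in>configs Y. \<forall>\<theta>'\<in>configs Y.
      (\<forall>\<xi>\<in>consv b \<phi>. xi_sum \<xi> Y \<theta> = xi_sum \<xi> Y \<theta>') \<longrightarrow> (\<theta>, \<theta>') \<in> (transitions Y F \<phi>)\<^sup>*"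
    unfolding irreducibly_quantified_def by simp
  then have irrY: "(\<theta>, \<theta>') \<in> (transitions Y F \<phi>)\<^sup>*"
    if "\<theta> \<in> configs Y" "\<theta>' \<in> configs Y" "\<forall>\<xi>\<in>consv b \<phi>. xi_sum \<xi> Y \<theta> = xi_sum \<xi> Y \<theta>'" for \<theta> \<theta>'
    using that by blast
  \<comment> \<open>\<open>down\<close> reads a configuration on the numbered vertices, \<open>lift\<close> puts it back on top of \<open>\<eta>\<close>.\<close>
  define down where "down \<zeta> = (\<lambda>i\<in>Y. \<zeta> (k i))" for \<zeta> :: "'x \<Rightarrow> 's"
  define lift where "lift \<theta> = (\<lambda>x\<in>V. if x \<in> U then \<theta> (g x) else \<eta> x)" for \<theta> :: "nat \<Rightarrow> 's"
  have xi_down: "xi_sum \<xi> Y (down \<zeta>) = (\<Sum>x\<in>U. \<xi> (\<zeta> x))" if "\<xi> \<in> consv b \<phi>" for \<xi> \<zeta>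
  proof -
    have "xi_sum \<xi> Y (down \<zeta>) = (\<Sum>i\<in>Y. \<xi> (\<zeta> (k i)))"
      unfolding xi_sum_def by (simp add: Y_def) (simp add: down_def Y_def)
    also have "\<dots> = (\<Sum>x\<in>U. \<xi> (\<zeta> x))" by (rule sum.reindex_bij_betw[OF bk])
    finally show ?thesis .
  qed
  let ?W = "U \<union> supp \<eta> \<union> supp \<eta>'"
  have W: "finite ?W" "?W \<subseteq> V" using U \<eta> finite_supp supp_V by auto
  have sumW: "Q \<zeta> = (\<Sum>x\<in>U. charge (\<zeta> x)) + (\<Sum>x\<in>?W - U. charge (\<zeta> x))" if "supp \<zeta> \<subseteq> ?W" for \<zeta>
    using Q_sum[OF W(1) that W(2)] sum.subset_diff[of U ?W "\<lambda>x. charge (\<zeta> x)"] W(1)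
    by (simp add: add.commute Un_assoc)
  have "(\<Sum>x\<in>?W - U. charge (\<eta> x)) = (\<Sum>x\<in>?W - U. charge (\<eta>' x))"
  proof (rule sum.cong)
    fix x assume "x \<in> ?W - U"
    then have "x \<in> V - U" using W(2) by blast
    then show "charge (\<eta> x) = charge (\<eta>' x)" using \<eta>(3) by simp
  qed simp
  then have eqU: "(\<Sum>x\<in>U. charge (\<eta> x)) = (\<Sum>x\<in>U. charge (\<eta>' x))"
  proof -
    have sub: "supp \<eta> \<subseteq> ?W" "supp \<eta>' \<subseteq> ?W" by blast+
    show ?thesis
      using sumW[OF sub(1)] sumW[OF sub(2)] \<eta>(4) \<open>sum _ (?W - U) = _\<close> by (simp only: add_right_cancel)
  qed
  have "xi_sum \<xi> Y (down \<eta>) = xi_sum \<xi> Y (down \<eta>')" if "\<xi> \<in> consv b \<phi>" for \<xi>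
    using fun_cong[OF eqU, of \<xi>] that by (simp add: xi_down sum_fun_apply charge_def)
  then have reach: "(down \<eta>, down \<eta>') \<in> (transitions Y F \<phi>)\<^sup>*"
    by (intro irrY) (auto simp: configs_def down_def)
  have lift_step: "(lift \<theta>, lift \<theta>') \<in> moves U" if tr: "(\<theta>, \<theta>') \<in> transitions Y F \<phi>" for \<theta> \<theta>'
  proof -
    obtain e where e: "e \<in> F" "\<theta>' = conf_step \<phi> e \<theta>" using tr unfolding transitions_def by blast
    then obtain x y where xy: "(x, y) \<in> E" "x \<in> U" "y \<in> U" "e = (g x, g y)" by (auto simp: F_def)
    have inj: "g z = g w \<longleftrightarrow> z = w" if "z \<in> U" "w \<in> U" for z w
      using g that by (auto simp: bij_betw_def inj_on_eq_iff)
    have C: "lift \<theta> \<in> C"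
      using \<eta>(1) U(1) by (intro C_I[of _ "U \<union> supp \<eta>"]) (auto simp: lift_def finite_supp, auto simp: supp_def)
    have "lift \<theta>' = conf_step \<phi> (x, y) (lift \<theta>)"
    proof (rule C_eqI)
      show "lift \<theta>' \<in> C"
        using \<eta>(1) U(1) by (intro C_I[of _ "U \<union> supp \<eta>"]) (auto simp: lift_def finite_supp, auto simp: supp_def)
      show "conf_step \<phi> (x, y) (lift \<theta>) \<in> C" using conf_step_C[OF xy(1) C] .
      fix z assume "z \<in> V"
      show "lift \<theta>' z = conf_step \<phi> (x, y) (lift \<theta>) z"
      proof (cases "z \<in> U")
        case True
        have "x \<in> V" "y \<in> V" using xy U(3) by blast+
        with True show ?thesis
          using \<open>z \<in> V\<close> xy(2,3) inj[OF True xy(2)] inj[OF True xy(3)] inj[OF xy(2,3)]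
          by (simp add: lift_def e(2) xy(4) conf_step_def)
      next
        case False
        then have "z \<noteq> x" "z \<noteq> y" using xy(2,3) by blast+
        with False show ?thesis by (simp add: lift_def conf_step_def)
      qed
    qed
    then show ?thesis using C xy by (auto simp: moves_def)
  qed
  have "(lift (down \<eta>), lift \<theta>) \<in> (moves U)\<^sup>*" if "(down \<eta>, \<theta>) \<in> (transitions Y F \<phi>)\<^sup>*" for \<theta>
    using that
  proof (induction rule: rtrancl_induct)
    case (step \<theta> \<theta>')
    then show ?case using lift_step[OF step.hyps(2)] by (rule_tac rtrancl_into_rtrancl)
  qed simp
  from this[OF reach] have "(lift (down \<eta>), lift (down \<eta>')) \<in> (moves U)\<^sup>*" .
  moreover have "lift (down \<eta>) = \<eta>"
    using \<eta>(1) gY kg by (intro extensionalityI[of _ V]) (auto simp: lift_def down_def C_iff)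
  moreover have "lift (down \<eta>') = \<eta>'"
    using \<eta>(2,3) gY kg by (intro extensionalityI[of _ V]) (auto simp: lift_def down_def C_iff)
  ultimately show ?thesis by simp
qed

text \<open>Only finitely many sites change, and they lie in a finite connected part of \<open>K\<close>.\<close>

lemma moves_connect:
  assumes K: "K \<subseteq> V" "connected_in E K"
    and \<eta>: "\<eta> \<in> C" "\<eta>' \<in> C" "\<And>x. x \<in> V - K \<Longrightarrow> \<eta> x = \<eta>' x" "Q \<eta> = Q \<eta>'"
  shows "(\<eta>, \<eta>') \<in> (moves K)\<^sup>*"
proof (cases "\<eta> = \<eta>'")
  case False
  define F where "F = {x \<in> K. \<eta> x \<noteq> \<eta>' x}"
  have "F \<subseteq> supp \<eta> \<union> supp \<eta>'" using K(1) by (auto simp: F_def supp_def)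
  then have "finite F" using \<eta> finite_supp finite_subset by blast
  moreover have "F \<noteq> {}" using False C_eqI[OF \<eta>(1,2)] \<eta>(3) by (auto simp: F_def)
  moreover have "F \<subseteq> K" by (auto simp: F_def)
  ultimately obtain U where U: "finite U" "connected_in E U" "F \<subseteq> U" "U \<subseteq> K"
    using finite_connected_superset[OF sym_E K(2)] by metis
  have "U \<noteq> {}" using U(3) \<open>F \<noteq> {}\<close> by blast
  moreover have "U \<subseteq> V" using U(4) K(1) by blast
  moreover have "\<eta> x = \<eta>' x" if "x \<in> V - U" for x
    using that U(3) \<eta>(3)[of x] by (auto simp: F_def)
  ultimately have "(\<eta>, \<eta>') \<in> (moves U)\<^sup>*"
    using U(1,2) \<eta>(1,2,4) by (intro moves_connect_finite) blast+
  then show ?thesis using moves_mono[OF U(4)] by (rule rev_subsetD)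
qed simp

section \<open>Functions with local differences\<close>

text \<open>Uniformity of the form \<open>\<partial>f\<close>. It controls \<open>f\<close> along transitions only, so that \<open>f\<close> itself
  may still contain an arbitrary function of the total charge.\<close>

definition local_diff where
  "local_diff R f \<longleftrightarrow> (\<forall>e\<in>E. \<forall>\<eta>\<in>C. \<forall>\<rho>\<in>C. (\<forall>x\<in>ball (fst e) R \<union> ball (snd e) R. \<eta> x = \<rho> x) \<longrightarrow>
     f (conf_step \<phi> e \<eta>) - f \<eta> = f (conf_step \<phi> e \<rho>) - (f \<rho> :: real))"

definition nbh where "nbh K R = (\<Union>k\<in>K. ball k R)"

text \<open>Every transition inside \<open>K\<close> changes \<open>f\<close> by an amount that depends only on the configuration
  near \<open>K\<close>, and any two arrangements of the same charge inside \<open>K\<close> are connected by such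
  transitions. This is the way in which uniformity of a form enters all later arguments.\<close>

lemma local_diff_transport:
  assumes f: "local_diff R f" and K: "K \<subseteq> V" "connected_in E K"
    and C: "\<eta> \<in> C" "\<eta>' \<in> C" "\<rho> \<in> C" "\<rho>' \<in> C"
    and off: "\<And>x. x \<in> V - K \<Longrightarrow> \<eta> x = \<eta>' x" "\<And>x. x \<in> V - K \<Longrightarrow> \<rho> x = \<rho>' x"
    and near: "\<And>x. x \<in> nbh K R \<Longrightarrow> \<rho> x = \<eta> x" "\<And>x. x \<in> nbh K R \<Longrightarrow> \<rho>' x = \<eta>' x"
    and "Q \<eta> = Q \<eta>'"
  shows "f \<eta> - f \<eta>' = f \<rho> - f \<rho>'"
proof -
  \<comment> \<open>The path from \<open>\<eta>\<close> is replayed inside \<open>K\<close> with the surroundings of \<open>\<rho>\<close>.\<close>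
  define m where "m \<zeta> = (\<lambda>x\<in>V. if x \<in> K then \<zeta> x else \<rho> x)" for \<zeta>
  have mC: "m \<zeta> \<in> C" if "\<zeta> \<in> C" for \<zeta>
    using that C(3) by (intro C_I[of _ "supp \<zeta> \<union> supp \<rho>"]) (auto simp: m_def finite_supp, auto simp: supp_def)
  have KR: "K \<subseteq> nbh K R" using K(1) center_in_ball by (auto simp: nbh_def)
  have "(\<eta>, \<eta>') \<in> (moves K)\<^sup>*" by (rule moves_connect) (use assms in auto)
  then have "f \<eta>' - f \<eta> = f (m \<eta>') - f (m \<eta>)"
  proof (induction rule: rtrancl_induct)
    case (step \<zeta> \<theta>)
    obtain e where e: "e \<in> E" "fst e \<in> K" "snd e \<in> K" "\<theta> = conf_step \<phi> e \<zeta>" "\<zeta> \<in> C"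
      using step.hyps(2) by (auto simp: moves_def)
    have \<zeta>: "\<And>x. x \<notin> K \<Longrightarrow> \<zeta> x = \<eta> x" using moves_preserve[OF step.hyps(1) C(1)] by simp
    have m\<theta>: "m \<theta> = conf_step \<phi> e (m \<zeta>)"
    proof (rule C_eqI)
      show "m \<theta> \<in> C" using e mC conf_step_C by simp
      show "conf_step \<phi> e (m \<zeta>) \<in> C" using e mC conf_step_C by simp
      fix x assume "x \<in> V"
      then show "m \<theta> x = conf_step \<phi> e (m \<zeta>) x"
        using e(2,3) K(1) by (auto simp: m_def e(4) conf_step_def)
    qed
    have "f (conf_step \<phi> e \<zeta>) - f \<zeta> = f (conf_step \<phi> e (m \<zeta>)) - f (m \<zeta>)"
    proof -
      have "\<zeta> x = m \<zeta> x" if "x \<in> ball (fst e) R \<union> ball (snd e) R" for x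
      proof -
        have "x \<in> nbh K R" "x \<in> V" using that e(2,3) ball_V by (auto simp: nbh_def)
        then show ?thesis using \<zeta> near(1) by (simp add: m_def)
      qed
      then show ?thesis using f e(1,5) mC[OF e(5)] unfolding local_diff_def by blast
    qed
    then show ?case using step.IH e(4) m\<theta> by simp
  qed simp
  moreover have "m \<eta> = \<rho>"
    by (rule C_eqI) (use C mC near(1) KR in \<open>auto simp: m_def\<close>)
  moreover have "m \<eta>' = \<rho>'"
    by (rule C_eqI) (use C mC near(2) off(2) KR in \<open>auto simp: m_def\<close>)
  ultimately show ?thesis by simp
qed

end

section \<open>Symmetric cocycles on commutative monoids\<close>

text \<open>Normalised 2-cocycles with trivial action.\<close>

definition additive_cocycle :: "'a::ab_group_add set \<Rightarrow> ('a \<Rightarrow> 'a \<Rightarrow> real) \<Rightarrow> bool" where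
  "additive_cocycle M h \<longleftrightarrow> 0 \<in> M \<and> (\<forall>a\<in>M. \<forall>c\<in>M. a + c \<in> M) \<and>
     (\<forall>a\<in>M. \<forall>c\<in>M. \<forall>e\<in>M. h a c + h (a + c) e = h c e + h a (c + e)) \<and>
     (\<forall>a\<in>M. h 0 a = 0 \<and> h a 0 = 0)"

definition symmetric_on :: "'a set \<Rightarrow> ('a \<Rightarrow> 'a \<Rightarrow> real) \<Rightarrow> bool" where
  "symmetric_on M h \<longleftrightarrow> (\<forall>a\<in>M. \<forall>c\<in>M. h a c = h c a)"

text \<open>In the central extension of the monoid by the reals that the cocycle defines, the elements
  that commute with a lift of \<open>a\<close> form a submonoid. So an extension of a monoid generated by one
  element, or by an element and its inverse, is commutative.\<close>

lemma cocycle_commuting_add: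
  assumes "additive_cocycle M h" "a \<in> M" "c \<in> M" "e \<in> M" "h a c = h c a" "h a e = h e a"
  shows "h a (c + e) = h (c + e) a"
proof -
  have coc: "h x y + h (x + y) z = h y z + h x (y + z)" if "x \<in> M" "y \<in> M" "z \<in> M" for x y z
    using assms(1) that by (simp add: additive_cocycle_def)
  show ?thesis
    using coc[of a c e] coc[of c a e] coc[of c e a] assms(2-6) by (simp add: add.commute)
qed

text \<open>The monoid is generated by the image of 1, which commutes with itself.\<close>

lemma cocycle_symmetric_nat:
  fixes u :: "nat \<Rightarrow> 'a::ab_group_add"
  assumes h: "additive_cocycle M h" and u: "M = range u" "\<And>m n. u (m + n) = u m + u n"
  shows "symmetric_on M h"
proof -
  have M: "u n \<in> M" for n using u(1) by simp
  have u0: "u 0 = 0" using u(2)[of 0 0] by simp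
  have zero: "h a 0 = h 0 a" if "a \<in> M" for a using h that by (simp add: additive_cocycle_def)
  have uS: "u (Suc n) = u n + u 1" for n using u(2)[of n 1] by simp
  have step: "h (u m) (u n) = h (u n) (u m)" if "h (u m) (u 1) = h (u 1) (u m)" for m n
  proof (induction n)
    case (Suc n)
    then show ?case unfolding uS by (intro cocycle_commuting_add[OF h] M that)
  qed (simp add: u0 zero M)
  have "h (u m) (u n) = h (u n) (u m)" for m n
    by (rule step[OF step[OF refl, symmetric]])
  then show ?thesis unfolding symmetric_on_def u(1) by blast
qed

text \<open>Here the images of 1 and of -1 generate; they commute because their sum is 0, where the cocycle
  identity degenerates.\<close>

lemma cocycle_symmetric_int:
  fixes u :: "int \<Rightarrow> 'a::ab_group_add"
  assumes h: "additive_cocycle M h" and u: "M = range u" "\<And>m n. u (m + n) = u m + u n"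
  shows "symmetric_on M h"
proof -
  have M: "u n \<in> M" for n using u(1) by simp
  have u0: "u 0 = 0" using u(2)[of 0 0] by simp
  have zero: "h a 0 = h 0 a" if "a \<in> M" for a using h that by (simp add: additive_cocycle_def)
  have uneg: "h (u m) (u (- n)) = h (u (- n)) (u m)"
    if "h (u m) (u (- 1)) = h (u (- 1)) (u m)" "0 \<le> n" for m n
    using that(2)
  proof (induction n rule: int_ge_induct)
    case (step n)
    have "u (- (n + 1)) = u (- n) + u (- 1)" using u(2)[of "- n" "- 1"] by simp
    then show ?case using step.IH that(1) by (simp only:) (intro cocycle_commuting_add[OF h] M)
  qed (simp add: u0 zero M)
  have upos: "h (u m) (u n) = h (u n) (u m)"
    if "h (u m) (u 1) = h (u 1) (u m)" "0 \<le> n" for m n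
    using that(2)
  proof (induction n rule: int_ge_induct)
    case (step n)
    show ?case unfolding u(2) using step.IH that(1) by (intro cocycle_commuting_add[OF h] M)
  qed (simp add: u0 zero M)
  have both: "h (u m) (u n) = h (u n) (u m)"
    if "h (u m) (u 1) = h (u 1) (u m)" "h (u m) (u (- 1)) = h (u (- 1)) (u m)" for m n
  proof (cases "0 \<le> n")
    case True
    then show ?thesis by (rule upos[OF that(1)])
  next
    case False
    then show ?thesis using uneg[OF that(2), of "- n"] by simp
  qed
  have inv: "h (u 1) (u (- 1)) = h (u (- 1)) (u 1)"
  proof -
    have "u 1 + u (- 1) = 0" "u (- 1) + u 1 = 0" using u(2)[of 1 "- 1"] u(2)[of "- 1" 1] u0 by simp_all
    moreover have "h (u 1) (u (- 1)) + h (u 1 + u (- 1)) (u 1) = h (u (- 1)) (u 1) + h (u 1) (u (- 1) + u 1)"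
      using h M by (simp add: additive_cocycle_def)
    ultimately show ?thesis using h M by (simp add: additive_cocycle_def)
  qed
  have "h (u m) (u n) = h (u n) (u m)" for m n
    by (rule both[OF both[OF refl inv, symmetric] both[OF inv[symmetric] refl, symmetric]])
  then show ?thesis unfolding symmetric_on_def u(1) by blast
qed

text \<open>Since the reals are divisible, a rationally linear function can be prescribed on a maximal
  rationally independent subset of the subgroup. It agrees with \<open>k\<close> on the whole subgroup because
  every element has a nonzero multiple that is an integral combination of that subset, and the reals
  have no torsion.\<close>

lemma additive_extension:
  fixes K :: "('a \<Rightarrow> real) set" and k :: "('a \<Rightarrow> real) \<Rightarrow> real"
  assumes K: "0 \<in> K" "\<And>x y. x \<in> K \<Longrightarrow> y \<in> K \<Longrightarrow> x + y \<in> K" "\<And>x. x \<in> K \<Longrightarrow> - x \<in> K"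
    and k: "\<And>x y. x \<in> K \<Longrightarrow> y \<in> K \<Longrightarrow> k (x + y) = k x + k y"
  obtains l where "\<And>x y. l (x + y) = l x + l y" "\<And>x. x \<in> K \<Longrightarrow> l x = k x"
proof -
  define sc :: "rat \<Rightarrow> ('a \<Rightarrow> real) \<Rightarrow> 'a \<Rightarrow> real" where "sc q x = (\<lambda>i. of_rat q * x i)" for q x
  define sr :: "rat \<Rightarrow> real \<Rightarrow> real" where "sr q r = of_rat q * r" for q r
  interpret P: vector_space_pair sc sr
    by unfold_locales
      (auto simp: sc_def sr_def fun_eq_iff of_rat_add of_rat_mult algebra_simps)
  obtain B where B: "B \<subseteq> K" "P.vs1.independent B" "K \<subseteq> P.vs1.span B"
    by (rule P.vs1.maximal_independent_subset)
  obtain l where l: "Vector_Spaces.linear sc sr l" "\<And>x. x \<in> B \<Longrightarrow> l x = k x"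
    using P.linear_independent_extend[OF B(2), of k] by blast
  interpret l: Vector_Spaces.linear sc sr l by (rule l(1))
  have k0: "k 0 = 0" using k[OF K(1) K(1)] by simp
  have nat: "sc (of_nat n) x \<in> K \<and> k (sc (of_nat n) x) = real n * k x" if "x \<in> K" for n x
  proof (induction n)
    case 0
    have "sc (of_nat 0) x = 0" by (simp add: sc_def fun_eq_iff)
    then show ?case using K(1) k0 by (simp only: of_nat_0 mult_zero_left simp_thms)
  next
    case (Suc n)
    have *: "sc (of_nat (Suc n)) x = x + sc (of_nat n) x"
      by (simp add: sc_def fun_eq_iff of_rat_add algebra_simps)
    have "k (x + sc (of_nat n) x) = k x + k (sc (of_nat n) x)" by (rule k[OF that]) (use Suc in blast)
    also have "\<dots> = real (Suc n) * k x" using Suc by (simp add: algebra_simps)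
    finally show ?case unfolding * using K(2) Suc that by blast
  qed
  have neg: "k (- x) = - k x" if "x \<in> K" for x
    using k[OF that K(3)[OF that]] k0 by simp
  have int: "sc (of_int p) x \<in> K \<and> k (sc (of_int p) x) = real_of_int p * k x" if "x \<in> K" for p x
  proof (cases "0 \<le> p")
    case True
    then show ?thesis using nat[OF that, of "nat p"] by simp
  next
    case False
    define y where "y = sc (of_nat (nat (- p))) x"
    have y: "y \<in> K" "k y = - real_of_int p * k x"
      using nat[OF that, of "nat (- p)"] False unfolding y_def by simp_all
    have "sc (of_int p) x = - y" using False by (simp add: sc_def fun_eq_iff of_rat_minus y_def)
    then show ?thesis using K(3)[OF y(1)] neg[OF y(1)] y(2) by simp
  qed
  \<comment> \<open>A rational subspace on which \<open>k\<close> and \<open>l\<close> agree after clearing denominators.\<close>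
  define W where "W = {x. \<exists>N>0. sc (of_int N) x \<in> K \<and> k (sc (of_int N) x) = l (sc (of_int N) x)}"
  have sc_sc: "sc p (sc q x) = sc (p * q) x" for p q x by (rule P.vs1.scale_scale)
  have agree: "sc (of_int p) x \<in> K \<and> k (sc (of_int p) x) = l (sc (of_int p) x)"
    if "x \<in> K" "k x = l x" for x p
    using int[OF that(1), of p] that(2) by (simp add: l.scale sr_def)
  have "P.vs1.subspace W"
  proof (rule P.vs1.subspaceI)
    have "sc (of_int 1) 0 = 0" by (simp add: sc_def fun_eq_iff)
    then show "0 \<in> W" unfolding W_def using K(1) k0 l.zero by (intro CollectI exI[of _ 1]) simp
  next
    fix x y assume "x \<in> W" "y \<in> W"
    then obtain N N' where N: "N > 0" "sc (of_int N) x \<in> K" "k (sc (of_int N) x) = l (sc (of_int N) x)"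
      "N' > 0" "sc (of_int N') y \<in> K" "k (sc (of_int N') y) = l (sc (of_int N') y)"
      unfolding W_def by blast
    have x: "sc (of_int (N * N')) x = sc (of_int N') (sc (of_int N) x)"
      and y: "sc (of_int (N * N')) y = sc (of_int N) (sc (of_int N') y)"
      by (simp_all add: sc_sc mult.commute)
    have s: "sc (of_int (N * N')) (x + y) = sc (of_int (N * N')) x + sc (of_int (N * N')) y"
      by (rule P.vs1.scale_right_distrib)
    show "x + y \<in> W"
      unfolding W_def
    proof (intro CollectI exI[of _ "N * N'"] conjI)
      show "sc (of_int (N * N')) (x + y) \<in> K"
        unfolding s x y using K(2) agree N by blast
      show "k (sc (of_int (N * N')) (x + y)) = l (sc (of_int (N * N')) (x + y))"
        unfolding s x y using k agree N l.add by metis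
    qed (use N in simp)
  next
    fix q :: rat and x assume "x \<in> W"
    then obtain N where N: "N > 0" "sc (of_int N) x \<in> K" "k (sc (of_int N) x) = l (sc (of_int N) x)"
      unfolding W_def by blast
    obtain p r where q: "q = of_int p / of_int r" "r > 0"
      by (cases q) (simp add: Fract_of_int_quotient)
    have *: "sc (of_int (N * r)) (sc q x) = sc (of_int p) (sc (of_int N) x)"
      using q by (simp add: sc_sc mult.commute)
    show "sc q x \<in> W"
      unfolding W_def
    proof (intro CollectI exI[of _ "N * r"] conjI)
      show "0 < N * r" using N(1) q(2) by simp
      show "sc (of_int (N * r)) (sc q x) \<in> K"
        "k (sc (of_int (N * r)) (sc q x)) = l (sc (of_int (N * r)) (sc q x))"
        unfolding * using agree[OF N(2,3)] by blast+
    qed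
  qed
  moreover have "B \<subseteq> W"
  proof
    fix x assume "x \<in> B"
    moreover have "sc (of_int 1) x = x" by (simp add: sc_def)
    ultimately show "x \<in> W" unfolding W_def using B(1) l(2) by (intro CollectI exI[of _ 1]) auto
  qed
  ultimately have KW: "K \<subseteq> W" using P.vs1.span_minimal[of B W] B(3) by blast
  show thesis
  proof
    show "l (x + y) = l x + l y" for x y by (rule l.add)
    fix x assume x: "x \<in> K"
    then obtain N where N: "N > 0" "k (sc (of_int N) x) = l (sc (of_int N) x)"
      using KW unfolding W_def by blast
    then show "l x = k x" using int[OF x, of N] by (simp add: l.scale sr_def)
  qed
qed

text \<open>The sum of the interactions when particles are added one by one. The pullback of the cocycle \<open>h\<close> to
  the free monoid is its coboundary.\<close>

primrec spread :: "('a::ab_group_add \<Rightarrow> 'a \<Rightarrow> real) \<Rightarrow> 'a list \<Rightarrow> real" where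
  "spread h [] = 0"
| "spread h (a # l) = spread h l + h a (sum_list l)"

lemma sum_list_in: "additive_cocycle M h \<Longrightarrow> set l \<subseteq> M \<Longrightarrow> sum_list l \<in> M"
  by (induction l) (auto simp: additive_cocycle_def)

lemma spread_append:
  assumes "additive_cocycle M h" "set l \<subseteq> M" "set l' \<subseteq> M"
  shows "spread h (l @ l') = spread h l + spread h l' + h (sum_list l) (sum_list l')"
  using assms(2)
proof (induction l)
  case Nil
  then show ?case using assms sum_list_in[OF assms(1,3)] by (simp add: additive_cocycle_def)
next
  case (Cons a l)
  have "h a (sum_list l) + h (a + sum_list l) (sum_list l') =
      h (sum_list l) (sum_list l') + h a (sum_list l + sum_list l')"
    using assms(1) Cons.prems sum_list_in[OF assms(1)] assms(3) by (simp add: additive_cocycle_def)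
  then show ?case using Cons by simp
qed

text \<open>Moving one entry to the front costs nothing, by symmetry of the cocycle.\<close>

lemma spread_permute:
  assumes "additive_cocycle M h" "symmetric_on M h" "set l \<subseteq> M" "mset l = mset l'"
  shows "spread h l = spread h l'"
  using assms(3,4)
proof (induction l arbitrary: l')
  case (Cons a l)
  then have "a \<in> set l'" by (metis list.set_intros(1) mset_eq_setD)
  then obtain u v where uv: "l' = u @ a # v" by (meson split_list)
  have l: "mset l = mset (u @ v)" using Cons.prems(2) uv by simp
  have sub: "set u \<subseteq> M" "set v \<subseteq> M" "a \<in> M"
    using Cons.prems uv mset_eq_setD[OF Cons.prems(2)] by auto
  have h0: "h a 0 = 0" using assms(1) sub by (simp add: additive_cocycle_def)
  have sm: "h (sum_list u) a = h a (sum_list u)"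
    using assms(2) sub sum_list_in[OF assms(1) sub(1)] by (simp add: symmetric_on_def)
  have "spread h ((a # u) @ v) = spread h ((u @ [a]) @ v)"
    using sub h0 sm
      spread_append[OF assms(1), of "a # u" v] spread_append[OF assms(1), of "u @ [a]" v]
      spread_append[OF assms(1), of u "[a]"]
    by (simp add: add.commute)
  then have "spread h l' = spread h (a # u @ v)" using uv by simp
  also have "\<dots> = spread h (a # l)"
    using Cons.IH[OF _ l] Cons.prems(1) arg_cong[OF l, of sum_mset] by (simp add: sum_mset_sum_list)
  finally show ?case by simp
qed simp

text \<open>On the free abelian group over the monoid, the relations of the monoid form a subgroup, and the
  differences of \<open>spread h\<close> along relations are an additive function on it. An additive extension \<open>L\<close>
  to the whole free group takes the value \<open>h a c\<close> at the relation between the pair \<open>a, c\<close> and the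
  single element \<open>a + c\<close>, so its values at the free generators split the cocycle.\<close>

lemma symmetric_cocycle_splits:
  fixes h :: "'a::ab_group_add \<Rightarrow> 'a \<Rightarrow> real"
  assumes h: "additive_cocycle M h" "symmetric_on M h"
  obtains g where "\<And>a c. a \<in> M \<Longrightarrow> c \<in> M \<Longrightarrow> h a c = g a + g c - g (a + c)"
proof -
  define cnt where "cnt l = (\<lambda>a. real (count (mset l) a))" for l :: "'a list"
  have cnt_append: "cnt (l @ l') = cnt l + cnt l'" for l l'
    by (rule ext) (simp add: cnt_def)
  have cnt_inj: "mset l = mset l'" if "cnt l = cnt l'" for l l'
    using fun_cong[OF that] by (intro multiset_eqI) (simp add: cnt_def)
  define rel where "rel l l' \<longleftrightarrow> set l \<subseteq> M \<and> set l' \<subseteq> M \<and> sum_list l = sum_list l'" for l l'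
  \<comment> \<open>The relations, and the additive function on them.\<close>
  define K where "K = {cnt l - cnt l' | l l'. rel l l'}"
  define k where "k x = (SOME v. \<exists>l l'. rel l l' \<and> x = cnt l - cnt l' \<and> v = spread h l - spread h l')" for x
  have k_eq: "k (cnt l - cnt l') = spread h l - spread h l'" if r: "rel l l'" for l l'
  proof -
    have "\<exists>m m'. rel m m' \<and> cnt l - cnt l' = cnt m - cnt m' \<and> k (cnt l - cnt l') = spread h m - spread h m'"
      unfolding k_def by (rule someI_ex) (use r in blast)
    then obtain m m' where m: "rel m m'" "cnt l - cnt l' = cnt m - cnt m'"
      "k (cnt l - cnt l') = spread h m - spread h m'" by blast
    have "cnt (l @ m') = cnt (m @ l')" using m(2) by (simp add: cnt_append algebra_simps)
    moreover have "set (l @ m') \<subseteq> M" using r m(1) by (simp add: rel_def)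
    ultimately have "spread h (l @ m') = spread h (m @ l')"
      using spread_permute[OF h] cnt_inj by blast
    moreover have "h (sum_list l) (sum_list m') = h (sum_list m) (sum_list l')"
    proof -
      have "sum_list l \<in> M" "sum_list m \<in> M" "sum_list l' = sum_list l" "sum_list m' = sum_list m"
        using r m(1) sum_list_in[OF h(1)] by (simp_all add: rel_def)
      then show ?thesis using h(2) unfolding symmetric_on_def by metis
    qed
    ultimately show ?thesis
      using r m(1,3) spread_append[OF h(1), of l m'] spread_append[OF h(1), of m l']
      by (simp add: rel_def)
  qed
  obtain L where L: "\<And>x y. L (x + y) = L x + L y" "\<And>x. x \<in> K \<Longrightarrow> L x = k x"
  proof (rule additive_extension[of K k])
    show "0 \<in> K" unfolding K_def rel_def by (auto intro!: exI[of _ "[]"])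
  next
    fix x y assume "x \<in> K" "y \<in> K"
    then obtain l l' m m' where lm: "x = cnt l - cnt l'" "y = cnt m - cnt m'" "rel l l'" "rel m m'"
      unfolding K_def by blast
    have s: "x + y = cnt (l @ m) - cnt (l' @ m')" unfolding lm(1,2) cnt_append by (simp only: add_diff_add)
    have r: "rel (l @ m) (l' @ m')" using lm(3,4) by (simp add: rel_def)
    show "x + y \<in> K" unfolding K_def using s r by blast
    have "k (x + y) = spread h (l @ m) - spread h (l' @ m')" unfolding s by (rule k_eq[OF r])
    then show "k (x + y) = k x + k y"
      using lm k_eq[OF lm(3)] k_eq[OF lm(4)] spread_append[OF h(1), of l m] spread_append[OF h(1), of l' m']
      by (simp add: rel_def)
  next
    fix x assume "x \<in> K"
    then obtain l l' where lm: "x = cnt l - cnt l'" "rel l l'" unfolding K_def by blast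
    then have "- x = cnt l' - cnt l" "rel l' l" by (auto simp: rel_def)
    then show "- x \<in> K" unfolding K_def by blast
  qed blast
  show thesis
  proof
    fix a c assume ac: "a \<in> M" "c \<in> M"
    have M: "a + c \<in> M" using h(1) ac by (simp add: additive_cocycle_def)
    have r: "rel [a, c] [a + c]" using ac M by (simp add: rel_def)
    have "h a c = spread h [a, c] - spread h [a + c]"
      using h(1) ac M by (simp add: additive_cocycle_def)
    also have "\<dots> = L (cnt [a, c] - cnt [a + c])"
    proof -
      have "cnt [a, c] - cnt [a + c] \<in> K" unfolding K_def using r by blast
      then show ?thesis using L(2) k_eq[OF r] by simp
    qed
    also have "\<dots> = L (cnt [a, c]) - L (cnt [a + c])"
      using L(1)[of "cnt [a, c] - cnt [a + c]" "cnt [a + c]"] by simp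
    also have "L (cnt [a, c]) = L (cnt [a]) + L (cnt [c])"
      using L(1)[of "cnt [a]" "cnt [c]"] cnt_append[of "[a]" "[c]"] by simp
    finally show "h a c = L (cnt [a]) + L (cnt [c]) - L (cnt [a + c])" .
  qed
qed

section \<open>The cocycle of a potential at an end\<close>

locale wt_system = system V E b \<phi> + wt_graph V E
  for V :: "'x set" and E :: "('x \<times> 'x) set" and b :: 's and \<phi> :: "'s interaction"

locale potential = wt_system V E b \<phi>
  for V :: "'x set" and E :: "('x \<times> 'x) set" and b :: 's and \<phi> :: "'s interaction" +
  fixes f :: "('x \<Rightarrow> 's) \<Rightarrow> real" and R :: nat
  assumes loc: "local_diff R f" and f_base: "f (base_config V b) = 0"
begin

abbreviation M where "M \<equiv> Q ` C"

text \<open>The interaction of two configurations: the failure of \<open>f\<close> to be additive on their superposition.\<close>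

definition D where "D \<eta> \<zeta> = f (join \<eta> \<zeta>) - f \<eta> - f \<zeta>"

definition far where "far \<eta> K \<longleftrightarrow> (\<forall>x\<in>supp \<eta>. \<forall>k\<in>K. R < d k x)"

lemma far_disjoint: "far \<eta> K \<Longrightarrow> supp \<eta> \<inter> K = {}"
  using d_self unfolding far_def by fastforce

lemma far_ball:
  assumes "y \<in> V" "supp \<eta> \<subseteq> ball y n" "K \<subseteq> V - ball y (n + R)"
  shows "far \<eta> K"
  unfolding far_def
proof (intro ballI)
  fix x k assume x: "x \<in> supp \<eta>" and k: "k \<in> K"
  have "x \<in> V" "d y x \<le> n" "k \<in> V" "n + R < d y k"
    using x k assms(2,3) by (auto simp: ball_def)
  then show "R < d k x"
    using d_triangle[OF assms(1), of x k] d_commute[of x k] by simp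
qed

lemma D_commute: "supp \<eta> \<inter> supp \<zeta> = {} \<Longrightarrow> D \<eta> \<zeta> = D \<zeta> \<eta>"
  using join_commute[of \<eta> \<zeta>] by (simp add: D_def)

text \<open>The transitions that rearrange the second configuration take place at distance more than \<open>R\<close>
  from \<open>\<eta>\<close>, so they change \<open>f\<close> by the same amount with and without \<open>\<eta>\<close>.\<close>

lemma D_rearrange:
  assumes "\<eta> \<in> C" "far \<eta> K" "K \<subseteq> V" "connected_in E K"
    and "\<zeta> \<in> C" "\<zeta>' \<in> C" "supp \<zeta> \<subseteq> K" "supp \<zeta>' \<subseteq> K" "Q \<zeta> = Q \<zeta>'"
  shows "D \<eta> \<zeta> = D \<eta> \<zeta>'"
proof -
  have b: "\<zeta> x = b" "\<zeta>' x = b" if "x \<in> V - K" for x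
    using that assms(7,8) by (auto simp: supp_def)
  have near: "\<eta> x = b" "x \<in> V" if "x \<in> nbh K R" for x
  proof -
    obtain k where k: "k \<in> K" "x \<in> ball k R" using \<open>x \<in> nbh K R\<close> unfolding nbh_def by blast
    then show "x \<in> V" using ball_V by blast
    have "d k x \<le> R" using k(2) by (simp add: ball_def)
    then have "x \<notin> supp \<eta>" using assms(2) k(1) unfolding far_def by fastforce
    then show "\<eta> x = b" using \<open>x \<in> V\<close> by (simp add: supp_def)
  qed
  have "f \<zeta> - f \<zeta>' = f (join \<eta> \<zeta>) - f (join \<eta> \<zeta>')"
    by (rule local_diff_transport[OF loc assms(3,4,5,6) join_C[OF assms(1,5)] join_C[OF assms(1,6)]])
      (use assms(9) b near in \<open>simp_all add: join_def\<close>)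
  then show ?thesis by (simp add: D_def)
qed

text \<open>The interaction of a charge \<open>\<alpha>\<close> in the middle of the locale with a charge \<open>\<beta>\<close> at an end. By
  \<open>end_value_unique\<close> it does not depend on the configurations that carry the charges.\<close>

definition end_value where
  "end_value \<epsilon> \<alpha> \<beta> v \<longleftrightarrow> (\<exists>n \<eta> \<zeta>. \<eta> \<in> C \<and> \<zeta> \<in> C \<and> supp \<eta> \<subseteq> ball origin n \<and>
     supp \<zeta> \<subseteq> \<epsilon> (n + R) \<and> Q \<eta> = \<alpha> \<and> Q \<zeta> = \<beta> \<and> v = D \<eta> \<zeta>)"

definition h where "h \<epsilon> \<alpha> \<beta> = (SOME v. end_value \<epsilon> \<alpha> \<beta> v)"

lemma end_valueI: "\<eta> \<in> C \<Longrightarrow> \<zeta> \<in> C \<Longrightarrow> supp \<eta> \<subseteq> ball origin n \<Longrightarrow> supp \<zeta> \<subseteq> \<epsilon> (n + R) \<Longrightarrow>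
    end_value \<epsilon> (Q \<eta>) (Q \<zeta>) (D \<eta> \<zeta>)"
  unfolding end_value_def by blast

lemma end_props: assumes "is_end \<epsilon>"
  shows "\<epsilon> n \<subseteq> V" "connected_in E (\<epsilon> n)" "infinite (\<epsilon> n)" "\<epsilon> n \<subseteq> V - ball origin n"
  using assms unfolding is_end_def by blast+

lemma far_end: "is_end \<epsilon> \<Longrightarrow> supp \<eta> \<subseteq> ball origin n \<Longrightarrow> far \<eta> (\<epsilon> (n + R))"
  using far_ball[OF origin_V] end_props(4) by blast

text \<open>Both second configurations can be pushed to one and the same configuration far out at the end; the
  two first configurations then lie in one ball, in which they can be transformed into each other.\<close>

lemma end_value_unique:
  assumes \<epsilon>: "is_end \<epsilon>" and v: "end_value \<epsilon> \<alpha> \<beta> v" "end_value \<epsilon> \<alpha> \<beta> w"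
  shows "v = w"
proof -
  obtain n \<eta> \<zeta> where 1: "\<eta> \<in> C" "\<zeta> \<in> C" "supp \<eta> \<subseteq> ball origin n" "supp \<zeta> \<subseteq> \<epsilon> (n + R)"
    "Q \<eta> = \<alpha>" "Q \<zeta> = \<beta>" "v = D \<eta> \<zeta>"
    using v(1) unfolding end_value_def by blast
  obtain m \<eta>' \<zeta>' where 2: "\<eta>' \<in> C" "\<zeta>' \<in> C" "supp \<eta>' \<subseteq> ball origin m" "supp \<zeta>' \<subseteq> \<epsilon> (m + R)"
    "Q \<eta>' = \<alpha>" "Q \<zeta>' = \<beta>" "w = D \<eta>' \<zeta>'"
    using v(2) unfolding end_value_def by blast
  define N where "N = max n m"
  have "\<beta> \<in> M" using 1 by blast
  then obtain \<theta> where \<theta>: "\<theta> \<in> C" "supp \<theta> \<subseteq> \<epsilon> (N + R)" "Q \<theta> = \<beta>"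
    using realize_infinite[OF _ end_props(1,3)[OF \<epsilon>, of "N + R"]] by blast
  have sub: "supp \<eta> \<subseteq> ball origin N" "supp \<eta>' \<subseteq> ball origin N"
    using 1(3) 2(3) ball_mono[of n N origin] ball_mono[of m N origin] by (auto simp: N_def)
  have "supp \<theta> \<subseteq> \<epsilon> (n + R)" "supp \<theta> \<subseteq> \<epsilon> (m + R)"
    using \<theta>(2) end_mono[OF \<epsilon>, of "n + R" "N + R"] end_mono[OF \<epsilon>, of "m + R" "N + R"]
    by (auto simp: N_def)
  then have "v = D \<eta> \<theta>" "w = D \<eta>' \<theta>"
    using D_rearrange[OF 1(1) far_end[OF \<epsilon> 1(3)] end_props(1,2)[OF \<epsilon>] 1(2) \<theta>(1) 1(4)]
      D_rearrange[OF 2(1) far_end[OF \<epsilon> 2(3)] end_props(1,2)[OF \<epsilon>] 2(2) \<theta>(1) 2(4)]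
      1(6,7) 2(6,7) \<theta>(3) by simp_all
  moreover have "D \<eta> \<theta> = D \<eta>' \<theta>"
  proof -
    have far: "far \<theta> (ball origin N)"
      unfolding far_def
    proof (intro ballI)
      fix x k assume x: "x \<in> supp \<theta>" and k: "k \<in> ball origin N"
      have "x \<in> V - ball origin (N + R)" using x \<theta>(2) end_props(4)[OF \<epsilon>] by blast
      then have "x \<in> V" "N + R < d origin x" by (auto simp: ball_def)
      moreover have "k \<in> V" "d origin k \<le> N" using k by (auto simp: ball_def)
      ultimately show "R < d k x"
        using d_triangle[OF origin_V, of k x] by linarith
    qed
    have "D \<theta> \<eta> = D \<theta> \<eta>'"
      by (rule D_rearrange[OF \<theta>(1) far ball_V connected_ball[OF origin_V] 1(1) 2(1) sub])
        (simp add: 1(5) 2(5))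
    moreover have "supp \<theta> \<inter> ball origin N = {}" by (rule far_disjoint[OF far])
    then have "supp \<theta> \<inter> supp \<eta> = {}" "supp \<theta> \<inter> supp \<eta>' = {}" using sub by blast+
    ultimately show ?thesis using D_commute by metis
  qed
  ultimately show ?thesis by simp
qed

lemma h_eq:
  assumes "is_end \<epsilon>" "\<eta> \<in> C" "\<zeta> \<in> C" "supp \<eta> \<subseteq> ball origin n" "supp \<zeta> \<subseteq> \<epsilon> (n + R)"
  shows "D \<eta> \<zeta> = h \<epsilon> (Q \<eta>) (Q \<zeta>)"
proof -
  have v: "end_value \<epsilon> (Q \<eta>) (Q \<zeta>) (D \<eta> \<zeta>)" using assms(2-5) end_valueI[of \<eta> \<zeta> n \<epsilon>] by blast
  then have "end_value \<epsilon> (Q \<eta>) (Q \<zeta>) (h \<epsilon> (Q \<eta>) (Q \<zeta>))" unfolding h_def by (rule someI)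
  then show ?thesis using end_value_unique[OF assms(1) v] by simp
qed

text \<open>The second configuration can be pushed inside \<open>K\<close> to the end that \<open>K\<close> contains, without
  coming near \<open>\<eta>\<close>. So the cocycle of an end describes the interaction across any gap that leads to
  that end, wherever the gap is.\<close>

lemma h_val:
  assumes \<epsilon>: "is_end \<epsilon>" "\<epsilon> m \<subseteq> K" and K: "K \<subseteq> V" "connected_in E K"
    and \<eta>: "\<eta> \<in> C" "far \<eta> K" and \<zeta>: "\<zeta> \<in> C" "supp \<zeta> \<subseteq> K"
  shows "D \<eta> \<zeta> = h \<epsilon> (Q \<eta>) (Q \<zeta>)"
proof -
  obtain n where n: "supp \<eta> \<subseteq> ball origin n" "m \<le> n"
    using finite_in_ball_ge[OF origin_V finite_supp[OF \<eta>(1)] supp_V] by blast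
  obtain \<theta> where \<theta>: "\<theta> \<in> C" "supp \<theta> \<subseteq> \<epsilon> (n + R)" "Q \<theta> = Q \<zeta>"
    using realize_infinite[OF imageI[OF \<zeta>(1)] end_props(1,3)[OF \<epsilon>(1), of "n + R"]] by blast
  have "\<epsilon> (n + R) \<subseteq> \<epsilon> m" by (rule end_mono[OF \<epsilon>(1)]) (use n in simp)
  then have "supp \<theta> \<subseteq> K" using \<theta>(2) \<epsilon>(2) by blast
  then have "D \<eta> \<zeta> = D \<eta> \<theta>" using D_rearrange[OF \<eta> K \<zeta>(1) \<theta>(1) \<zeta>(2)] \<theta>(3) by simp
  also have "\<dots> = h \<epsilon> (Q \<eta>) (Q \<zeta>)" using h_eq[OF \<epsilon>(1) \<eta>(1) \<theta>(1) n(1) \<theta>(2)] \<theta>(3) by simp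
  finally show ?thesis .
qed

lemma M_zero: "0 \<in> M" using base_C Q_base by (metis imageI)

text \<open>Three groups of particles, each much further out towards the end than the previous one,
  give the cocycle identity.\<close>

lemma cocycle_h: assumes \<epsilon>: "is_end \<epsilon>" shows "additive_cocycle M (h \<epsilon>)"
  unfolding additive_cocycle_def
proof (intro conjI ballI M_zero)
  note inf = end_props(1,3)[OF \<epsilon>]
  have triple: "\<exists>n \<eta> \<zeta>. \<eta> \<in> C \<and> Q \<eta> = \<alpha> \<and> supp \<eta> \<subseteq> ball origin n \<and> \<zeta> \<in> C \<and> Q \<zeta> = \<beta> \<and> supp \<zeta> \<subseteq> \<epsilon> (n + R) \<and>
      supp \<eta> \<inter> supp \<zeta> = {}"
    if \<alpha>: "\<alpha> \<in> M" and \<beta>: "\<beta> \<in> M" for \<alpha> \<beta>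
  proof -
    obtain \<eta> where \<eta>: "\<eta> \<in> C" "Q \<eta> = \<alpha>" using \<alpha> by blast
    obtain n where n: "supp \<eta> \<subseteq> ball origin n"
      using finite_in_ball[OF origin_V finite_supp[OF \<eta>(1)] supp_V] by blast
    obtain \<zeta> where \<zeta>: "\<zeta> \<in> C" "supp \<zeta> \<subseteq> \<epsilon> (n + R)" "Q \<zeta> = \<beta>"
      using realize_infinite[OF \<beta> inf[of "n + R"]] by blast
    have "supp \<eta> \<inter> supp \<zeta> = {}" using far_disjoint[OF far_end[OF \<epsilon> n]] \<zeta>(2) by blast
    then show ?thesis using \<eta> n \<zeta> by blast
  qed
  show "\<alpha> + \<beta> \<in> M" if \<alpha>: "\<alpha> \<in> M" and \<beta>: "\<beta> \<in> M" for \<alpha> \<beta>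
  proof -
    obtain \<eta> \<zeta> where "\<eta> \<in> C" "Q \<eta> = \<alpha>" "\<zeta> \<in> C" "Q \<zeta> = \<beta>" "supp \<eta> \<inter> supp \<zeta> = {}"
      using triple[OF \<alpha> \<beta>] by blast
    then show ?thesis using Q_join join_C by (metis imageI)
  qed
  fix \<alpha> assume \<alpha>: "\<alpha> \<in> M"
  {
    fix \<beta> \<gamma> assume \<beta>: "\<beta> \<in> M" and \<gamma>: "\<gamma> \<in> M"
    obtain n \<eta> \<zeta> where \<eta>: "\<eta> \<in> C" "Q \<eta> = \<alpha>" "supp \<eta> \<subseteq> ball origin n"
      and \<zeta>: "\<zeta> \<in> C" "Q \<zeta> = \<beta>" "supp \<zeta> \<subseteq> \<epsilon> (n + R)" and disj: "supp \<eta> \<inter> supp \<zeta> = {}"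
      using triple[OF \<alpha> \<beta>] by blast
    obtain m where m: "supp \<zeta> \<subseteq> ball origin m" "n \<le> m"
      using finite_in_ball_ge[OF origin_V finite_supp[OF \<zeta>(1)] supp_V] by blast
    have \<eta>m: "supp \<eta> \<subseteq> ball origin m" using \<eta>(3) ball_mono[OF m(2)] by blast
    have jm: "supp (join \<eta> \<zeta>) \<subseteq> ball origin m" using \<eta>m m(1) by (simp add: supp_join)
    obtain \<theta> where \<theta>: "\<theta> \<in> C" "supp \<theta> \<subseteq> \<epsilon> (m + R)" "Q \<theta> = \<gamma>"
      using realize_infinite[OF \<gamma> inf[of "m + R"]] by blast
    have "supp \<theta> \<subseteq> \<epsilon> (n + R)" using \<theta>(2) end_mono[OF \<epsilon>, of "n + R" "m + R"] m(2) by auto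
    then have jn: "supp (join \<zeta> \<theta>) \<subseteq> \<epsilon> (n + R)" using \<zeta>(3) by (simp add: supp_join)
    have disj': "supp \<zeta> \<inter> supp \<theta> = {}" using far_disjoint[OF far_end[OF \<epsilon> m(1)]] \<theta>(2) by blast
    have "D \<eta> \<zeta> + D (join \<eta> \<zeta>) \<theta> = D \<zeta> \<theta> + D \<eta> (join \<zeta> \<theta>)"
      by (simp add: D_def join_assoc)
    moreover have "D \<eta> \<zeta> = h \<epsilon> \<alpha> \<beta>" using h_eq[OF \<epsilon> \<eta>(1) \<zeta>(1) \<eta>(3) \<zeta>(3)] \<eta>(2) \<zeta>(2) by simp
    moreover have "D (join \<eta> \<zeta>) \<theta> = h \<epsilon> (\<alpha> + \<beta>) \<gamma>"
      using h_eq[OF \<epsilon> join_C[OF \<eta>(1) \<zeta>(1)] \<theta>(1) jm \<theta>(2)] Q_join[OF \<eta>(1) \<zeta>(1) disj] \<eta>(2) \<zeta>(2) \<theta>(3) by simp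
    moreover have "D \<zeta> \<theta> = h \<epsilon> \<beta> \<gamma>" using h_eq[OF \<epsilon> \<zeta>(1) \<theta>(1) m(1) \<theta>(2)] \<zeta>(2) \<theta>(3) by simp
    moreover have "D \<eta> (join \<zeta> \<theta>) = h \<epsilon> \<alpha> (\<beta> + \<gamma>)"
      using h_eq[OF \<epsilon> \<eta>(1) join_C[OF \<zeta>(1) \<theta>(1)] \<eta>(3) jn] Q_join[OF \<zeta>(1) \<theta>(1) disj'] \<eta>(2) \<zeta>(2) \<theta>(3) by simp
    ultimately show "h \<epsilon> \<alpha> \<beta> + h \<epsilon> (\<alpha> + \<beta>) \<gamma> = h \<epsilon> \<beta> \<gamma> + h \<epsilon> \<alpha> (\<beta> + \<gamma>)" by simp
  }
  obtain n \<eta> \<zeta> where \<eta>: "\<eta> \<in> C" "Q \<eta> = \<alpha>" "supp \<eta> \<subseteq> ball origin n"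
    and \<zeta>: "\<zeta> \<in> C" "Q \<zeta> = \<alpha>" "supp \<zeta> \<subseteq> \<epsilon> (n + R)"
    using triple[OF \<alpha> \<alpha>] by blast
  have base: "supp (base_config V b) \<subseteq> A" for A by (simp add: supp_base)
  show "h \<epsilon> 0 \<alpha> = 0"
    using h_eq[OF \<epsilon> base_C \<zeta>(1) base \<zeta>(3)] \<zeta> by (simp add: D_def base_join f_base)
  show "h \<epsilon> \<alpha> 0 = 0"
    using h_eq[OF \<epsilon> \<eta>(1) base_C \<eta>(3) base] \<eta> by (simp add: D_def join_base f_base)
qed

text \<open>A pair of configurations whose interaction is a value of the cocycle at \<open>\<epsilon>\<close>, where the
  second one sits in a ball far out at \<open>\<epsilon>\<close>. As seen from that ball, the roles of the middle and of
  the end are exchanged.\<close>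

lemma swap_pair:
  assumes \<epsilon>: "is_end \<epsilon>" and \<alpha>: "\<alpha> \<in> M" and \<beta>: "\<beta> \<in> M"
  obtains n \<eta> y r \<zeta> where "N \<le> n" "\<eta> \<in> C" "Q \<eta> = \<alpha>" "supp \<eta> \<subseteq> ball origin n" "y \<in> \<epsilon> n" "y \<in> V"
    "ball y (r + R) \<subseteq> V - ball origin n" "\<zeta> \<in> C" "Q \<zeta> = \<beta>" "supp \<zeta> \<subseteq> ball y r" "D \<zeta> \<eta> = h \<epsilon> \<alpha> \<beta>"
proof -
  obtain \<eta> where \<eta>: "\<eta> \<in> C" "Q \<eta> = \<alpha>" using \<alpha> by blast
  obtain n where n: "supp \<eta> \<subseteq> ball origin n" "N \<le> n"
    using finite_in_ball_ge[OF origin_V finite_supp[OF \<eta>(1)] supp_V] by blast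
  obtain r where r: "\<And>A. A \<subseteq> V \<Longrightarrow> infinite A \<or> r \<le> card A \<Longrightarrow> \<exists>\<zeta>\<in>C. supp \<zeta> \<subseteq> A \<and> Q \<zeta> = \<beta>"
    using realize[OF \<beta>] by blast
  \<comment> \<open>So far out that the ball of radius \<open>r + R\<close> around \<open>y\<close> avoids the ball of radius \<open>n + R\<close> around the
    origin.\<close>
  define m where "m = n + R + (r + R)"
  obtain y where ym: "y \<in> \<epsilon> m" using end_ne[OF \<epsilon>] by blast
  have "y \<in> V - ball origin m" using ym end_props(4)[OF \<epsilon>] by blast
  then have y: "y \<in> V" "m < d origin y" by (auto simp: ball_def)
  have "\<epsilon> m \<subseteq> \<epsilon> n" "\<epsilon> m \<subseteq> \<epsilon> (n + R)" by (rule end_mono[OF \<epsilon>], simp add: m_def)+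
  then have yn: "y \<in> \<epsilon> n" "y \<in> \<epsilon> (n + R)" using ym by blast+
  obtain \<zeta> where \<zeta>: "\<zeta> \<in> C" "supp \<zeta> \<subseteq> ball y r" "Q \<zeta> = \<beta>"
    using r[OF ball_V, of y r] card_ball[OF y(1), of r] by blast
  have big: "ball y (r + R) \<subseteq> V - ball origin (n + R)"
  proof
    fix x assume "x \<in> ball y (r + R)"
    then have "x \<in> V" "d y x \<le> r + R" by (auto simp: ball_def)
    then show "x \<in> V - ball origin (n + R)"
      using d_triangle[OF origin_V, of x y] d_commute[of x y] y by (simp add: ball_def m_def)
  qed
  have big_n: "ball y (r + R) \<subseteq> V - ball origin n"
    using big ball_mono[of n "n + R" origin] by auto
  define A where "A = V - ball origin (n + R)"
  have yA: "y \<in> A" unfolding A_def using big center_in_ball[OF y(1)] by blast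
  have K: "\<epsilon> (n + R) \<subseteq> comp A y"
    by (rule comp_max[OF end_props(2)[OF \<epsilon>] _ yn(2) self_in_comp]) (use end_props(4)[OF \<epsilon>] in \<open>simp add: A_def\<close>)
  have KA: "comp A y \<subseteq> V - ball origin (n + R)" using comp_sub[OF yA] by (simp add: A_def)
  have "ball y r \<subseteq> A" unfolding A_def using big ball_mono[of r "r + R" y] by auto
  then have "ball y r \<subseteq> comp A y"
    by (rule comp_max[OF connected_ball[OF y(1)] _ center_in_ball[OF y(1)] self_in_comp])
  then have \<zeta>K: "supp \<zeta> \<subseteq> comp A y" using \<zeta>(2) by blast
  have "comp A y \<subseteq> V" using KA by blast
  then have "D \<eta> \<zeta> = h \<epsilon> \<alpha> \<beta>"
    using h_val[OF \<epsilon> K _ connected_comp[OF yA] \<eta>(1) far_ball[OF origin_V n(1) KA] \<zeta>(1) \<zeta>K] \<eta>(2) \<zeta>(3) by simp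
  moreover have "supp \<zeta> \<inter> supp \<eta> = {}" using far_disjoint[OF far_ball[OF origin_V n(1) KA]] \<zeta>K by blast
  ultimately have "D \<zeta> \<eta> = h \<epsilon> \<alpha> \<beta>" using D_commute by simp
  then show thesis using that n \<eta> \<zeta> y(1) yn(1) big_n by blast
qed

lemma far_ball_comp:
  assumes "y \<in> V" "z \<in> V - ball y (r + R)" "supp \<zeta> \<subseteq> ball y r"
  shows "far \<zeta> (comp (V - ball y (r + R)) z)"
  by (rule far_ball[OF assms(1,3) comp_sub[OF assms(2)]])

text \<open>As seen from the far ball, the origin lies in an infinite component of the complement, and any end
  of that component will do.\<close>

lemma swap_some_end:
  assumes \<epsilon>: "is_end \<epsilon>" and \<alpha>: "\<alpha> \<in> M" and \<beta>: "\<beta> \<in> M"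
  shows "\<exists>\<epsilon>'. is_end \<epsilon>' \<and> h \<epsilon> \<alpha> \<beta> = h \<epsilon>' \<beta> \<alpha>"
proof -
  obtain n \<eta> y r \<zeta> where *: "0 \<le> n" "\<eta> \<in> C" "Q \<eta> = \<alpha>" "supp \<eta> \<subseteq> ball origin n" "y \<in> \<epsilon> n" "y \<in> V"
    "ball y (r + R) \<subseteq> V - ball origin n" "\<zeta> \<in> C" "Q \<zeta> = \<beta>" "supp \<zeta> \<subseteq> ball y r" "D \<zeta> \<eta> = h \<epsilon> \<alpha> \<beta>"
    by (rule swap_pair[OF \<epsilon> \<alpha> \<beta>, of 0])
  define A where "A = V - ball y (r + R)"
  have BA: "ball origin n \<subseteq> A" using *(7) ball_V unfolding A_def by blast
  have oA: "origin \<in> A" using BA center_in_ball[OF origin_V] by blast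
  obtain \<epsilon>' where \<epsilon>': "is_end \<epsilon>'" "\<And>m. \<epsilon>' m \<subseteq> comp A origin"
    using end_exists[OF *(6), of origin "r + R"] oA unfolding A_def by blast
  have "ball origin n \<subseteq> comp A origin"
    by (rule comp_max[OF connected_ball[OF origin_V] BA center_in_ball[OF origin_V] self_in_comp])
  then have sup: "supp \<eta> \<subseteq> comp A origin" using *(4) by blast
  have sub: "comp A origin \<subseteq> V" using comp_sub[OF oA] unfolding A_def by blast
  have far: "far \<zeta> (comp A origin)"
    using far_ball_comp[OF *(6) _ *(10)] oA unfolding A_def by blast
  have "D \<zeta> \<eta> = h \<epsilon>' \<beta> \<alpha>"
    using h_val[OF \<epsilon>' sub connected_comp[OF oA] *(8) far *(2) sup] *(3,9) by simp
  then show ?thesis using \<epsilon>'(1) *(11) by auto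
qed

text \<open>A ball far out at \<open>\<epsilon>\<close> lies in another component of the complement of a ball around the origin
  than \<open>\<epsilon>'\<close>. The component of \<open>\<epsilon>'\<close> together with the ball around the origin is connected, so it can
  serve as the other side of the gap.\<close>

lemma swap_separated:
  assumes \<epsilon>: "is_end \<epsilon>" and \<epsilon>': "is_end \<epsilon>'" and sep: "separated \<epsilon> \<epsilon>'" and \<alpha>: "\<alpha> \<in> M" and \<beta>: "\<beta> \<in> M"
  shows "h \<epsilon> \<alpha> \<beta> = h \<epsilon>' \<beta> \<alpha>"
proof -
  obtain m where m: "\<And>K. connected_in E K \<Longrightarrow> K \<subseteq> V - ball origin m \<Longrightarrow> \<not> (\<epsilon> m \<union> \<epsilon>' m \<subseteq> K)"
    using sep unfolding separated_def by blast
  obtain n \<eta> y r \<zeta> where *: "m \<le> n" "\<eta> \<in> C" "Q \<eta> = \<alpha>" "supp \<eta> \<subseteq> ball origin n" "y \<in> \<epsilon> n" "y \<in> V"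
    "ball y (r + R) \<subseteq> V - ball origin n" "\<zeta> \<in> C" "Q \<zeta> = \<beta>" "supp \<zeta> \<subseteq> ball y r" "D \<zeta> \<eta> = h \<epsilon> \<alpha> \<beta>"
    by (rule swap_pair[OF \<epsilon> \<alpha> \<beta>, of m])
  obtain z where z: "z \<in> \<epsilon>' n" using end_ne[OF \<epsilon>'] by blast
  define A where "A = V - ball origin n"
  have zA: "z \<in> A" using z end_props(4)[OF \<epsilon>'] unfolding A_def by blast
  have \<epsilon>'K: "\<epsilon>' n \<subseteq> comp A z"
    by (rule comp_max[OF end_props(2)[OF \<epsilon>'] _ z self_in_comp]) (use end_props(4)[OF \<epsilon>'] in \<open>simp add: A_def\<close>)
  have disj: "comp A z \<inter> ball y (r + R) = {}"
  proof (rule ccontr)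
    assume "comp A z \<inter> ball y (r + R) \<noteq> {}"
    then obtain w where "w \<in> ball y (r + R)" "w \<in> comp A z" by blast
    then have "ball y (r + R) \<subseteq> comp A z"
      using comp_max[OF connected_ball[OF *(6)]] *(7) unfolding A_def by blast
    then have "y \<in> comp A z" using center_in_ball[OF *(6)] by blast
    then have "\<epsilon> n \<subseteq> comp A z"
      using comp_max[OF end_props(2)[OF \<epsilon>] _ *(5)] end_props(4)[OF \<epsilon>] unfolding A_def by blast
    moreover have sub: "\<epsilon> n \<subseteq> \<epsilon> m" "\<epsilon>' n \<subseteq> \<epsilon>' m" using end_mono[OF \<epsilon> *(1)] end_mono[OF \<epsilon>' *(1)] by blast+
    ultimately have ne: "comp A z \<inter> \<epsilon> m \<noteq> {}" "(comp A z \<union> \<epsilon> m) \<inter> \<epsilon>' m \<noteq> {}"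
      using *(5) z \<epsilon>'K by blast+
    have "connected_in E (comp A z \<union> \<epsilon> m \<union> \<epsilon>' m)"
      using connected_in_Un[OF sym_E connected_in_Un[OF sym_E connected_comp[OF zA] end_props(2)[OF \<epsilon>] ne(1)]
          end_props(2)[OF \<epsilon>'] ne(2)] .
    moreover have "comp A z \<subseteq> V - ball origin m"
      using comp_sub[OF zA] ball_mono[OF *(1), of origin] unfolding A_def by blast
    ultimately show False
      using m[of "comp A z \<union> \<epsilon> m \<union> \<epsilon>' m"] end_props(4)[OF \<epsilon>, of m] end_props(4)[OF \<epsilon>', of m] by blast
  qed
  define K where "K = ball origin n \<union> comp A z"
  have conn: "connected_in E K"
    using connected_ball_Un_comp[OF origin_V, of z n] zA unfolding K_def A_def by blast
  have sub: "K \<subseteq> V - ball y (r + R)"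
    using *(7) disj ball_V comp_sub[OF zA] unfolding K_def A_def by blast
  have "D \<zeta> \<eta> = h \<epsilon>' \<beta> \<alpha>"
    using h_val[OF \<epsilon>' _ _ conn *(8) far_ball[OF *(6,10) sub] *(2), of n] \<epsilon>'K *(3,4,9) sub
    unfolding K_def by blast
  then show ?thesis using *(11) by simp
qed

text \<open>Arbitrarily far out the two sequences can be joined, so both describe the same interactions.\<close>

lemma nonseparated_equal:
  assumes \<epsilon>: "is_end \<epsilon>" and \<epsilon>': "is_end \<epsilon>'" and sep: "\<not> separated \<epsilon> \<epsilon>'" and \<alpha>: "\<alpha> \<in> M" and \<beta>: "\<beta> \<in> M"
  shows "h \<epsilon> \<alpha> \<beta> = h \<epsilon>' \<alpha> \<beta>"
proof -
  obtain \<eta> where \<eta>: "\<eta> \<in> C" "Q \<eta> = \<alpha>" using \<alpha> by blast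
  obtain n where n: "supp \<eta> \<subseteq> ball origin n"
    using finite_in_ball[OF origin_V finite_supp[OF \<eta>(1)] supp_V] by blast
  obtain K where K: "connected_in E K" "K \<subseteq> V - ball origin (n + R)" "\<epsilon> (n + R) \<subseteq> K" "\<epsilon>' (n + R) \<subseteq> K"
    using sep unfolding separated_def by blast
  have KV: "K \<subseteq> V" using K(2) by blast
  obtain \<zeta> where \<zeta>: "\<zeta> \<in> C" "supp \<zeta> \<subseteq> \<epsilon> (n + R)" "Q \<zeta> = \<beta>"
    using realize_infinite[OF \<beta> end_props(1,3)[OF \<epsilon>, of "n + R"]] by blast
  have "supp \<zeta> \<subseteq> K" using \<zeta>(2) K(3) by blast
  then show ?thesis
    using h_val[OF \<epsilon> K(3) KV K(1) \<eta>(1) far_ball[OF origin_V n K(2)] \<zeta>(1)]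
      h_val[OF \<epsilon>' K(4) KV K(1) \<eta>(1) far_ball[OF origin_V n K(2)] \<zeta>(1)] \<eta>(2) \<zeta>(3) by simp
qed

text \<open>By \<open>swap_separated\<close> the cocycles of two different ends are transposes of each other.\<close>

lemma symmetric_end_determines:
  assumes \<epsilon>: "is_end \<epsilon>" "symmetric_on M (h \<epsilon>)" and \<epsilon>': "is_end \<epsilon>'" and \<alpha>: "\<alpha> \<in> M" and \<beta>: "\<beta> \<in> M"
  shows "h \<epsilon>' \<alpha> \<beta> = h \<epsilon> \<alpha> \<beta>"
proof (cases "separated \<epsilon> \<epsilon>'")
  case True
  then have "h \<epsilon>' \<alpha> \<beta> = h \<epsilon> \<beta> \<alpha>" using swap_separated[OF \<epsilon>(1) \<epsilon>' True \<beta> \<alpha>] by simp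
  then show ?thesis using \<epsilon>(2) \<alpha> \<beta> unfolding symmetric_on_def by simp
next
  case False
  then show ?thesis using nonseparated_equal[OF \<epsilon>(1) \<epsilon>' False \<alpha> \<beta>] by simp
qed

lemma ends_in_components_separated:
  assumes x: "x \<in> V" and z: "z \<in> V - ball x n" "w \<in> V - ball x n"
    and ne: "comp (V - ball x n) z \<noteq> comp (V - ball x n) w"
    and \<epsilon>: "is_end \<epsilon>" "\<And>m. \<epsilon> m \<subseteq> comp (V - ball x n) z"
    and \<epsilon>': "is_end \<epsilon>'" "\<And>m. \<epsilon>' m \<subseteq> comp (V - ball x n) w"
  shows "separated \<epsilon> \<epsilon>'"
proof -
  obtain m where m: "ball x n \<subseteq> ball origin m"
    using finite_in_ball[OF origin_V finite_ball[OF x] ball_V] by blast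
  show ?thesis
    unfolding separated_def
  proof (intro exI[of _ m] allI impI notI)
    fix K assume K: "connected_in E K \<and> K \<subseteq> V - ball origin m" "\<epsilon> m \<union> \<epsilon>' m \<subseteq> K"
    let ?A = "V - ball x n"
    have KA: "K \<subseteq> ?A" using K(1) m by blast
    obtain u v where u: "u \<in> \<epsilon> m" "v \<in> \<epsilon>' m" using end_ne[OF \<epsilon>(1)] end_ne[OF \<epsilon>'(1)] by blast
    have "u \<in> K" "v \<in> K" using u K(2) by blast+
    then have "K \<subseteq> comp ?A z" "K \<subseteq> comp ?A w"
      using comp_max[of K ?A u z] comp_max[of K ?A v w] K(1) KA u \<epsilon>(2) \<epsilon>'(2) by blast+
    then have "comp ?A u = comp ?A z" "comp ?A u = comp ?A w"
      using \<open>u \<in> K\<close> comp_eq z by blast+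
    then show False using ne by simp
  qed
qed

lemma end_in_V: "\<exists>\<epsilon>. is_end \<epsilon>"
proof -
  obtain z where "z \<in> V - ball origin 0" using complement_ball(1)[OF origin_V, of 0] by blast
  then show ?thesis using end_exists[OF origin_V] by metis
qed

text \<open>With three ends, transposing along 1-2, 2-3 and 3-1 transposes an odd number of times. With
  arbitrarily large balls of connected complement, a charge in the middle of such a ball sees all ends
  through the same gap, so all ends have the same cocycle, which is then its own transpose by
  \<open>swap_some_end\<close>.\<close>

lemma symmetric_if_transferable:
  assumes "transferable V E"
  shows "\<exists>\<epsilon>. is_end \<epsilon> \<and> symmetric_on M (h \<epsilon>)"
proof (cases "\<exists>x\<in>V. \<exists>R>0. card (conn_components E (V - gball V E x R)) \<ge> 3")
  case True
  then obtain x R0 where x: "x \<in> V" "R0 > 0" "card (conn_components E (V - gball V E x R0)) \<ge> 3" by blast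
  define n where "n = nat \<lfloor>R0\<rfloor>"
  define A where "A = V - ball x n"
  have "3 \<le> card (comp A ` A)"
    using x(2,3) gball_eq_ball[of R0 x] by (simp add: conn_components_eq A_def n_def)
  then obtain T where T: "T \<subseteq> comp A ` A" "card T = 3" by (meson obtain_subset_with_card_n)
  then obtain K1 K2 K3 where "T = {K1, K2, K3}" "K1 \<noteq> K2" "K2 \<noteq> K3" "K1 \<noteq> K3"
    unfolding card_3_iff by blast
  then obtain z1 z2 z3 where z: "z1 \<in> A" "z2 \<in> A" "z3 \<in> A"
    "comp A z1 \<noteq> comp A z2" "comp A z2 \<noteq> comp A z3" "comp A z1 \<noteq> comp A z3"
    using T(1) by auto
  obtain e1 e2 e3 where e: "is_end e1" "is_end e2" "is_end e3"
    "\<And>m. e1 m \<subseteq> comp A z1" "\<And>m. e2 m \<subseteq> comp A z2" "\<And>m. e3 m \<subseteq> comp A z3"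
    using end_exists[OF x(1)] z(1-3) unfolding A_def by metis
  have "separated e1 e2" "separated e2 e3" "separated e1 e3"
    using ends_in_components_separated[OF x(1)] z e unfolding A_def by blast+
  then have "h e1 \<alpha> \<beta> = h e1 \<beta> \<alpha>" if "\<alpha> \<in> M" "\<beta> \<in> M" for \<alpha> \<beta>
    using swap_separated e(1-3) that by metis
  then show ?thesis using e(1) unfolding symmetric_on_def by blast
next
  case False
  then have big: "\<And>r::nat. \<exists>x\<in>V. \<exists>R0>0. R0 \<ge> real r \<and> connected_in E (V - gball V E x R0)"
    using assms unfolding transferable_def by blast
  have all_equal: "h \<epsilon> \<alpha> \<beta> = h \<epsilon>' \<alpha> \<beta>" if \<epsilon>: "is_end \<epsilon>" "is_end \<epsilon>'" and \<alpha>: "\<alpha> \<in> M" and \<beta>: "\<beta> \<in> M" for \<epsilon> \<epsilon>' \<alpha> \<beta>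
  proof -
    obtain r where r: "\<And>A. A \<subseteq> V \<Longrightarrow> infinite A \<or> r \<le> card A \<Longrightarrow> \<exists>\<eta>\<in>C. supp \<eta> \<subseteq> A \<and> Q \<eta> = \<alpha>"
      using realize[OF \<alpha>] by blast
    obtain x R0 where x: "x \<in> V" "R0 > 0" "R0 \<ge> real (r + R)" "connected_in E (V - gball V E x R0)"
      using big by blast
    define n where "n = nat \<lfloor>R0\<rfloor>"
    have n: "r + R \<le> n" "connected_in E (V - ball x n)"
      using x gball_eq_ball[of R0 x] le_nat_floor[of "r + R" R0] by (simp_all add: n_def)
    define K where "K = V - ball x (r + R)"
    have L: "V - ball x n \<subseteq> K" using ball_mono[OF n(1)] unfolding K_def by blast
    have conn: "connected_in E K"
    proof -
      obtain l where l: "l \<in> V - ball x n" using complement_ball(1)[OF x(1), of n] by blast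
      then have lK: "l \<in> K" using L by blast
      have "K \<subseteq> comp K l"
      proof
        fix w assume w: "w \<in> K"
        have "infinite (comp K w)" using complement_ball(2)[OF x(1)] w unfolding K_def by blast
        then have "\<not> comp K w \<subseteq> ball x n" using finite_ball[OF x(1)] finite_subset by blast
        then obtain u where u: "u \<in> comp K w" "u \<in> V - ball x n"
          using comp_sub[OF w] unfolding K_def by blast
        then have "V - ball x n \<subseteq> comp K w" using comp_max[OF n(2) L] by blast
        then have "comp K l = comp K w" using l comp_eq[OF _ w] by blast
        then show "w \<in> comp K l" using self_in_comp by simp
      qed
      then have "comp K l = K" using comp_sub[OF lK] by blast
      then show ?thesis using connected_comp[OF lK] by simp
    qed
    obtain \<eta> where \<eta>: "\<eta> \<in> C" "supp \<eta> \<subseteq> ball x r" "Q \<eta> = \<alpha>"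
      using r[OF ball_V, of x r] card_ball[OF x(1), of r] by blast
    have far: "far \<eta> K" by (rule far_ball[OF x(1) \<eta>(2)]) (simp add: K_def)
    obtain m where m: "\<epsilon> m \<subseteq> K" using end_avoids_ball[OF \<epsilon>(1) x(1)] unfolding K_def by blast
    obtain m' where m': "\<epsilon>' m' \<subseteq> K" using end_avoids_ball[OF \<epsilon>(2) x(1)] unfolding K_def by blast
    have KV: "K \<subseteq> V" unfolding K_def by blast
    obtain \<zeta> where \<zeta>: "\<zeta> \<in> C" "supp \<zeta> \<subseteq> \<epsilon> m" "Q \<zeta> = \<beta>"
      using realize_infinite[OF \<beta> end_props(1,3)[OF \<epsilon>(1), of m]] by blast
    have "supp \<zeta> \<subseteq> K" using \<zeta>(2) m by blast
    then show ?thesis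
      using h_val[OF \<epsilon>(1) m KV conn \<eta>(1) far \<zeta>(1)] h_val[OF \<epsilon>(2) m' KV conn \<eta>(1) far \<zeta>(1)] \<eta>(3) \<zeta>(3)
      by simp
  qed
  obtain \<epsilon> where \<epsilon>: "is_end \<epsilon>" using end_in_V by blast
  have "h \<epsilon> \<alpha> \<beta> = h \<epsilon> \<beta> \<alpha>" if "\<alpha> \<in> M" "\<beta> \<in> M" for \<alpha> \<beta>
    using swap_some_end[OF \<epsilon> that] all_equal[OF \<epsilon> _ that(2,1)] by auto
  then show ?thesis using \<epsilon> unfolding symmetric_on_def by blast
qed

end

section \<open>Charges of simple interactions\<close>

context system
begin

definition single where "single x s = (\<lambda>y\<in>V. if y = x then s else b)"

lemma single_C: "single x s \<in> C"
  by (rule C_I[of _ "{x}"]) (auto simp: single_def)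

lemma Q_single: assumes "x \<in> V" shows "Q (single x s) = charge s"
proof -
  have "Q (single x s) = (\<Sum>y\<in>{x}. charge (single x s y))"
    by (rule Q_sum) (use assms in \<open>auto simp: single_def supp_def\<close>)
  then show ?thesis using assms by (simp add: single_def)
qed

text \<open>Dimension one, unfolded: the definition through the cardinality of a basis yields a basis vector.\<close>

lemma simple_basis:
  assumes "simple_interaction b \<phi>"
  obtains \<xi> where "\<xi> \<in> consv b \<phi>" "\<xi> \<noteq> (\<lambda>s. 0)" "\<And>\<xi>'. \<xi>' \<in> consv b \<phi> \<Longrightarrow> \<exists>c. \<xi>' = (\<lambda>s. c * \<xi> s)"
proof -
  define sc where "sc = (\<lambda>c (f :: 's \<Rightarrow> real) s. c * f s)"
  interpret vector_space sc
    by unfold_locales (auto simp: sc_def fun_eq_iff algebra_simps)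
  have dim: "dim (consv b \<phi>) = 1"
    using assms unfolding simple_interaction_def consv_dim_def sc_def by blast
  obtain B where B: "B \<subseteq> consv b \<phi>" "independent B" "consv b \<phi> \<subseteq> span B" "card B = dim (consv b \<phi>)"
    by (rule basis_exists)
  then obtain \<xi> where \<xi>: "B = {\<xi>}" using dim card_1_singletonE by metis
  have "\<xi> \<noteq> 0" using B(2) dependent_zero \<xi> by blast
  moreover have "(0 :: 's \<Rightarrow> real) = (\<lambda>s. 0)" by (simp add: fun_eq_iff)
  ultimately have "\<xi> \<noteq> (\<lambda>s. 0)" by simp
  moreover have "\<exists>c. \<xi>' = (\<lambda>s. c * \<xi> s)" if "\<xi>' \<in> consv b \<phi>" for \<xi>'
    using B(3) that unfolding \<xi> span_singleton by (auto simp: sc_def)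
  ultimately show thesis using that B(1) \<xi> by blast
qed

text \<open>Evaluation at a basis vector of the one-dimensional space of conserved quantities identifies
  the monoid of charges with the monoid generated by the values of that conserved quantity.\<close>

lemma simple_charges:
  assumes simple: "simple_interaction b \<phi>" and V: "V \<noteq> {}"
    and add: "\<And>\<alpha> \<beta>. \<alpha> \<in> Q ` C \<Longrightarrow> \<beta> \<in> Q ` C \<Longrightarrow> \<alpha> + \<beta> \<in> Q ` C"
  obtains \<xi> where "\<xi> \<in> consv b \<phi>" "\<xi> \<noteq> (\<lambda>s. 0)"
    "bij_betw (\<lambda>\<alpha>. \<alpha> \<xi>) (Q ` C) (generated_submonoid (range \<xi>))"
proof -
  obtain \<xi> where \<xi>: "\<xi> \<in> consv b \<phi>" "\<xi> \<noteq> (\<lambda>s. 0)"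
    and span: "\<And>\<xi>'. \<xi>' \<in> consv b \<phi> \<Longrightarrow> \<exists>c. \<xi>' = (\<lambda>s. c * \<xi> s)"
    using simple_basis[OF simple] by blast
  let ?N = "generated_submonoid (range \<xi>)"
  have sub: "submonoid ?N real_add_monoid"
    unfolding generated_submonoid_def
    by (rule hull_in) (auto simp: submonoid_def real_add_monoid_def)
  have N: "0 \<in> ?N" "\<And>x y. x \<in> ?N \<Longrightarrow> y \<in> ?N \<Longrightarrow> x + y \<in> ?N"
    using submonoid.one_closed[OF sub] submonoid.m_closed[OF sub] by (simp_all add: real_add_monoid_def)
  have rng: "\<xi> s \<in> ?N" for s
    unfolding generated_submonoid_def by (rule subsetD[OF hull_subset]) simp
  have val: "Q \<eta> \<xi> = (\<Sum>x\<in>supp \<eta>. \<xi> (\<eta> x))" for \<eta>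
    using \<xi>(1) by (simp add: Q_def sum_fun_apply charge_def)
  have "(\<Sum>x\<in>F. \<xi> (\<eta> x)) \<in> ?N" if "finite F" for F and \<eta> :: "'x \<Rightarrow> 's"
    using that by (induction F) (use N rng in auto)
  then have 1: "(\<lambda>\<alpha>. \<alpha> \<xi>) ` (Q ` C) \<subseteq> ?N" using val finite_supp by auto
  have "submonoid ((\<lambda>\<alpha>. \<alpha> \<xi>) ` (Q ` C)) real_add_monoid"
  proof
    fix x y assume "x \<in> (\<lambda>\<alpha>. \<alpha> \<xi>) ` (Q ` C)" "y \<in> (\<lambda>\<alpha>. \<alpha> \<xi>) ` (Q ` C)"
    then obtain \<alpha> \<beta> where ab: "\<alpha> \<in> Q ` C" "\<beta> \<in> Q ` C" "x = \<alpha> \<xi>" "y = \<beta> \<xi>" by blast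
    have "x + y = (\<alpha> + \<beta>) \<xi>" using ab by simp
    then show "x \<otimes>\<^bsub>real_add_monoid\<^esub> y \<in> (\<lambda>\<alpha>. \<alpha> \<xi>) ` (Q ` C)"
      using add[OF ab(1,2)] unfolding real_add_monoid_def by (intro image_eqI[of _ _ "\<alpha> + \<beta>"]) simp_all
  next
    have "Q (base_config V b) \<xi> = 0" by simp
    then show "\<one>\<^bsub>real_add_monoid\<^esub> \<in> (\<lambda>\<alpha>. \<alpha> \<xi>) ` (Q ` C)"
      using base_C unfolding real_add_monoid_def by (metis imageI monoid.select_convs(2))
  qed (simp add: real_add_monoid_def)
  moreover have "range \<xi> \<subseteq> (\<lambda>\<alpha>. \<alpha> \<xi>) ` (Q ` C)"
  proof
    fix r assume "r \<in> range \<xi>"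
    then obtain s where s: "r = \<xi> s" by blast
    obtain x where "x \<in> V" using V by blast
    then have "Q (single x s) \<xi> = r" using \<xi>(1) s by (simp add: Q_single charge_def)
    then show "r \<in> (\<lambda>\<alpha>. \<alpha> \<xi>) ` (Q ` C)" using single_C by blast
  qed
  ultimately have 2: "?N \<subseteq> (\<lambda>\<alpha>. \<alpha> \<xi>) ` (Q ` C)"
    unfolding generated_submonoid_def by (intro hull_minimal)
  have "inj_on (\<lambda>\<alpha>. \<alpha> \<xi>) (Q ` C)"
  proof (rule inj_onI)
    fix \<alpha> \<beta> assume "\<alpha> \<in> Q ` C" "\<beta> \<in> Q ` C" and eq: "\<alpha> \<xi> = \<beta> \<xi>"
    then obtain \<eta> \<zeta> where ez: "\<alpha> = Q \<eta>" "\<beta> = Q \<zeta>" by blast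
    have lin: "Q \<theta> \<xi>' = c * Q \<theta> \<xi>" if "\<xi>' \<in> consv b \<phi>" "\<xi>' = (\<lambda>s. c * \<xi> s)" for \<theta> \<xi>' c
      using that \<xi>(1) by (simp add: Q_def sum_fun_apply charge_def sum_distrib_left)
    show "\<alpha> = \<beta>"
    proof
      fix \<xi>'
      show "\<alpha> \<xi>' = \<beta> \<xi>'"
      proof (cases "\<xi>' \<in> consv b \<phi>")
        case True
        then obtain c where "\<xi>' = (\<lambda>s. c * \<xi> s)" using span by blast
        then show ?thesis using lin[OF True] eq ez by simp
      next
        case False
        then show ?thesis by (simp add: ez Q_def sum_fun_apply charge_def)
      qed
    qed
  qed
  then have "bij_betw (\<lambda>\<alpha>. \<alpha> \<xi>) (Q ` C) ?N" using 1 2 by (simp add: bij_betw_def subset_antisym)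
  then show thesis using that \<xi> by blast
qed

end

lemma additive_inverse:
  fixes w :: "'a::ab_group_add \<Rightarrow> 'b::plus"
  assumes "bij_betw w M UNIV" "\<And>a c. a \<in> M \<Longrightarrow> c \<in> M \<Longrightarrow> a + c \<in> M"
    "\<And>a c. a \<in> M \<Longrightarrow> c \<in> M \<Longrightarrow> w (a + c) = w a + w c"
  shows "M = range (inv_into M w)" "inv_into M w (m + n) = inv_into M w m + inv_into M w n"
proof -
  have bij: "bij_betw (inv_into M w) UNIV M" by (rule bij_betw_inv_into[OF assms(1)])
  then show "M = range (inv_into M w)" by (simp add: bij_betw_def)
  have M: "inv_into M w n \<in> M" for n using bij by (auto simp: bij_betw_def)
  have w: "w (inv_into M w n) = n" for n using assms(1) by (simp add: bij_betw_inv_into_right)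
  have "w (inv_into M w m + inv_into M w n) = m + n" using assms(3)[OF M M] w by simp
  then have "inv_into M w (w (inv_into M w m + inv_into M w n)) = inv_into M w (m + n)" by simp
  then show "inv_into M w (m + n) = inv_into M w m + inv_into M w n"
    using bij_betw_inv_into_left[OF assms(1) assms(2)[OF M M]] by simp
qed

text \<open>The charges form a monoid isomorphic to the natural numbers or to the integers, where cocycles are
  always symmetric.\<close>

lemma (in system) symmetric_if_simple:
  assumes simple: "simple_interaction b \<phi>" and h: "additive_cocycle (Q ` C) h"
  shows "symmetric_on (Q ` C) h"
proof -
  let ?M = "Q ` C"
  have add: "\<alpha> + \<beta> \<in> ?M" if "\<alpha> \<in> ?M" "\<beta> \<in> ?M" for \<alpha> \<beta>
    using h that unfolding additive_cocycle_def by blast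
  obtain \<xi> where \<xi>: "\<xi> \<in> consv b \<phi>" "\<xi> \<noteq> (\<lambda>s. 0)" and
    bij: "bij_betw (\<lambda>\<alpha>. \<alpha> \<xi>) ?M (generated_submonoid (range \<xi>))"
    using simple_charges[OF simple V_ne add] by blast
  let ?N = "real_add_monoid\<lparr>carrier := generated_submonoid (range \<xi>)\<rparr>"
  have mem: "\<alpha> \<xi> \<in> generated_submonoid (range \<xi>)" if "\<alpha> \<in> ?M" for \<alpha>
    using bij that unfolding bij_betw_def by blast
  have "?N \<cong> nat_add_monoid \<or> ?N \<cong> integer_group"
    using simple \<xi> unfolding simple_interaction_def Let_def by blast
  then show ?thesis
  proof
    assume "?N \<cong> nat_add_monoid"
    then obtain j where j: "j \<in> hom ?N nat_add_monoid"
      "bij_betw j (generated_submonoid (range \<xi>)) UNIV"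
      unfolding is_iso_def iso_def by (auto simp: nat_add_monoid_def)
    have jadd: "j (x + y) = j x + j y"
      if "x \<in> generated_submonoid (range \<xi>)" "y \<in> generated_submonoid (range \<xi>)" for x y
      using hom_mult[OF j(1)] that by (simp add: nat_add_monoid_def real_add_monoid_def)
    have w: "bij_betw (\<lambda>\<alpha>. j (\<alpha> \<xi>)) ?M UNIV" using bij_betw_trans[OF bij j(2)] by (simp add: o_def)
    have wadd: "j ((\<alpha> + \<beta>) \<xi>) = j (\<alpha> \<xi>) + j (\<beta> \<xi>)" if "\<alpha> \<in> ?M" "\<beta> \<in> ?M" for \<alpha> \<beta>
      using jadd[OF mem[OF that(1)] mem[OF that(2)]] by simp
    show ?thesis by (rule cocycle_symmetric_nat[OF h additive_inverse[where w = "\<lambda>\<alpha>. j (\<alpha> \<xi>)" and M = ?M, OF w add wadd]])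
  next
    assume "?N \<cong> integer_group"
    then obtain j where j: "j \<in> hom ?N integer_group"
      "bij_betw j (generated_submonoid (range \<xi>)) UNIV"
      unfolding is_iso_def iso_def by (auto simp: integer_group_def)
    have jadd: "j (x + y) = j x + j y"
      if "x \<in> generated_submonoid (range \<xi>)" "y \<in> generated_submonoid (range \<xi>)" for x y
      using hom_mult[OF j(1)] that by (simp add: integer_group_def real_add_monoid_def)
    have w: "bij_betw (\<lambda>\<alpha>. j (\<alpha> \<xi>)) ?M UNIV" using bij_betw_trans[OF bij j(2)] by (simp add: o_def)
    have wadd: "j ((\<alpha> + \<beta>) \<xi>) = j (\<alpha> \<xi>) + j (\<beta> \<xi>)" if "\<alpha> \<in> ?M" "\<beta> \<in> ?M" for \<alpha> \<beta>
      using jadd[OF mem[OF that(1)] mem[OF that(2)]] by simp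
    show ?thesis by (rule cocycle_symmetric_int[OF h additive_inverse[where w = "\<lambda>\<alpha>. j (\<alpha> \<xi>)" and M = ?M, OF w add wadd]])
  qed
qed

section \<open>Decoupled potentials are uniform\<close>

context system
begin

text \<open>Configurations on the two sides of a gap of width \<open>R\<close> around a ball do not interact.\<close>

definition decoupled where
  "decoupled R f \<longleftrightarrow> (\<forall>y\<in>V. \<forall>r. \<forall>z\<in>V - ball y (r + R). \<forall>\<eta>\<in>C. \<forall>\<zeta>\<in>C.
     supp \<eta> \<subseteq> ball y r \<longrightarrow> supp \<zeta> \<subseteq> comp (V - ball y (r + R)) z \<longrightarrow>
     f (join \<eta> \<zeta>) = f \<eta> + (f \<zeta> :: real))"

text \<open>Sites at distance more than \<open>R\<close> do not interact. This is uniformity of a function, expressed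
  without its expansion into exactly local parts.\<close>

definition fin_range where
  "fin_range R f \<longleftrightarrow> (\<forall>\<eta>\<in>C. \<forall>x\<in>V. \<forall>y\<in>V. R < d x y \<longrightarrow>
     f \<eta> - f (keep (- {x}) \<eta>) = f (keep (- {y}) \<eta>) - (f (keep (- {x, y}) \<eta>) :: real))"

lemma keep_keep: "keep A (keep B \<eta>) = keep (A \<inter> B) \<eta>"
  by (auto simp: keep_def)

lemma keep_eq_self: "\<eta> \<in> C \<Longrightarrow> supp \<eta> \<subseteq> A \<Longrightarrow> keep A \<eta> = \<eta>"
  by (rule C_eqI) (auto simp: keep_C, auto simp: keep_def supp_def)

lemma keep_cong: "(\<And>x. x \<in> V \<Longrightarrow> x \<in> A \<Longrightarrow> \<eta> x = \<eta>' x) \<Longrightarrow> keep A \<eta> = keep A \<eta>'"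
  by (auto simp: keep_def)

end

text \<open>Subtracting the coboundary of \<open>g\<close> from the symmetric cocycle of all ends. A function of the
  total charge is constant along transitions, so the boundary of \<open>f\<close> stays the same.\<close>

lemma (in potential) decouple:
  assumes "\<exists>\<epsilon>. is_end \<epsilon> \<and> symmetric_on M (h \<epsilon>)"
  obtains g where "local_diff R (\<lambda>\<eta>. f \<eta> + g (Q \<eta>))" "f (base_config V b) + g (Q (base_config V b)) = 0"
    "decoupled R (\<lambda>\<eta>. f \<eta> + g (Q \<eta>))"
proof -
  obtain \<epsilon> where \<epsilon>: "is_end \<epsilon>" "symmetric_on M (h \<epsilon>)" using assms by blast
  note coc = cocycle_h[OF \<epsilon>(1)]
  have "\<exists>g. \<forall>\<alpha>\<in>M. \<forall>\<beta>\<in>M. h \<epsilon> \<alpha> \<beta> = g \<alpha> + g \<beta> - g (\<alpha> + \<beta>)"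
    by (rule symmetric_cocycle_splits[OF coc \<epsilon>(2)]) blast
  then obtain g where g: "\<And>\<alpha> \<beta>. \<alpha> \<in> M \<Longrightarrow> \<beta> \<in> M \<Longrightarrow> h \<epsilon> \<alpha> \<beta> = g \<alpha> + g \<beta> - g (\<alpha> + \<beta>)"
    by blast
  have "local_diff R (\<lambda>\<eta>. f \<eta> + g (Q \<eta>))"
    unfolding local_diff_def
  proof (intro ballI impI)
    fix e \<eta> \<rho> assume *: "e \<in> E" "\<eta> \<in> C" "\<rho> \<in> C" "\<forall>x\<in>ball (fst e) R \<union> ball (snd e) R. \<eta> x = \<rho> x"
    then have "f (conf_step \<phi> e \<eta>) - f \<eta> = f (conf_step \<phi> e \<rho>) - f \<rho>"
      using loc unfolding local_diff_def by blast
    then show "f (conf_step \<phi> e \<eta>) + g (Q (conf_step \<phi> e \<eta>)) - (f \<eta> + g (Q \<eta>)) =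
        f (conf_step \<phi> e \<rho>) + g (Q (conf_step \<phi> e \<rho>)) - (f \<rho> + g (Q \<rho>))"
      using Q_conf_step[OF *(1,2)] Q_conf_step[OF *(1,3)] by simp
  qed
  moreover have "f (base_config V b) + g (Q (base_config V b)) = 0"
    using g[OF M_zero M_zero] coc M_zero unfolding additive_cocycle_def by (simp add: f_base)
  moreover have "decoupled R (\<lambda>\<eta>. f \<eta> + g (Q \<eta>))"
    unfolding decoupled_def
  proof (intro ballI allI impI)
    fix y r z \<eta> \<zeta> assume y: "y \<in> V" and z: "z \<in> V - ball y (r + R)" and \<eta>: "\<eta> \<in> C" "supp \<eta> \<subseteq> ball y r"
      and \<zeta>: "\<zeta> \<in> C" "supp \<zeta> \<subseteq> comp (V - ball y (r + R)) z"
    obtain \<epsilon>' where \<epsilon>': "is_end \<epsilon>'" "\<And>m. \<epsilon>' m \<subseteq> comp (V - ball y (r + R)) z"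
      using end_exists[OF y z] by blast
    have far: "far \<eta> (comp (V - ball y (r + R)) z)" by (rule far_ball_comp[OF y z \<eta>(2)])
    have sub: "comp (V - ball y (r + R)) z \<subseteq> V" using comp_sub[OF z] by blast
    have "D \<eta> \<zeta> = h \<epsilon>' (Q \<eta>) (Q \<zeta>)"
      by (rule h_val[OF \<epsilon>' sub connected_comp[OF z] \<eta>(1) far \<zeta>])
    also have "\<dots> = h \<epsilon> (Q \<eta>) (Q \<zeta>)"
      by (rule symmetric_end_determines[OF \<epsilon> \<epsilon>'(1)]) (use \<eta>(1) \<zeta>(1) in blast)+
    also have "\<dots> = g (Q \<eta>) + g (Q \<zeta>) - g (Q \<eta> + Q \<zeta>)" by (rule g) (use \<eta>(1) \<zeta>(1) in blast)+
    also have "Q \<eta> + Q \<zeta> = Q (join \<eta> \<zeta>)"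
      using Q_join[OF \<eta>(1) \<zeta>(1)] far_disjoint[OF far] \<zeta>(2) by fastforce
    finally show "f (join \<eta> \<zeta>) + g (Q (join \<eta> \<zeta>)) = f \<eta> + g (Q \<eta>) + (f \<zeta> + g (Q \<zeta>))"
      by (simp add: D_def)
  qed
  ultimately show thesis using that by blast
qed

context wt_system
begin

text \<open>The effect of removing the particle at \<open>y\<close> is not changed when a whole component of the
  complement of the ball around \<open>y\<close> is emptied: the particles in it can first be moved
  far away, inside the component, and there they are decoupled.\<close>

lemma removal_empty_component:
  assumes f: "local_diff R f" "decoupled R f" and y: "y \<in> V" and z: "z \<in> V - ball y R"
    and \<eta>: "\<eta> \<in> C" and K: "K = comp (V - ball y R) z"
  shows "f \<eta> - f (keep (- {y}) \<eta>) = f (keep (- K) \<eta>) - f (keep (- {y}) (keep (- K) \<eta>))"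
proof -
  have KA: "K \<subseteq> V - ball y R" "connected_in E K" "infinite K"
    unfolding K using comp_sub[OF z] connected_comp[OF z] complement_ball(2)[OF y z] by blast+
  obtain r where r: "supp \<eta> \<subseteq> ball y r" using finite_in_ball[OF y finite_supp[OF \<eta>] supp_V] by blast
  define A where "A = V - ball y (r + R)"
  have "\<not> K \<subseteq> ball y (r + R)" using KA(3) finite_ball[OF y] finite_subset by blast
  then obtain w where w: "w \<in> K" "w \<in> A" using KA(1) unfolding A_def by blast
  have "A \<subseteq> V - ball y R" using ball_mono[of R "r + R" y] unfolding A_def by auto
  then have sub: "comp A w \<subseteq> K"
    unfolding K using w(1) comp_sub[OF w(2)] K
    by (intro comp_max[OF connected_comp[OF w(2)] _ self_in_comp]) blast+
  have inf: "infinite (comp A w)" using complement_ball(2)[OF y] w(2) unfolding A_def by blast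
  have subV: "comp A w \<subseteq> V" using sub KA(1) by blast
  \<comment> \<open>The content of \<open>K\<close>, rearranged beyond a gap around the whole support of \<open>\<eta>\<close>.\<close>
  obtain \<zeta> where \<zeta>: "\<zeta> \<in> C" "supp \<zeta> \<subseteq> comp A w" "Q \<zeta> = Q (keep K \<eta>)"
    using realize_infinite[OF imageI[OF keep_C[OF \<eta>]] subV inf, of K] by blast
  define \<eta>1 where "\<eta>1 = keep (- K) \<eta>"
  have \<eta>1: "\<eta>1 \<in> C" "supp \<eta>1 \<subseteq> ball y r" "supp \<eta>1 \<inter> K = {}"
    using keep_C[OF \<eta>] r unfolding \<eta>1_def by (auto simp: supp_keep)
  have \<zeta>K: "supp \<zeta> \<subseteq> K" using \<zeta>(2) sub by blast
  have yK: "y \<notin> K" using KA(1) center_in_ball[OF y] by blast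
  define \<eta>2 where "\<eta>2 = join \<eta>1 \<zeta>"
  have \<eta>2: "\<eta>2 \<in> C" unfolding \<eta>2_def by (rule join_C[OF \<eta>1(1) \<zeta>(1)])
  have off: "\<eta> x = \<eta>2 x" if "x \<in> V - K" for x
  proof -
    have "\<zeta> x = b" using that \<zeta>K by (auto simp: supp_def)
    then show ?thesis using that by (simp add: \<eta>2_def join_def \<eta>1_def keep_def)
  qed
  have near: "x \<noteq> y" "x \<in> V" if x: "x \<in> nbh K R" for x
  proof -
    obtain k where k: "k \<in> K" "x \<in> ball k R" using x unfolding nbh_def by blast
    then have "k \<in> V" "R < d y k" "d k x \<le> R" using KA(1) by (auto simp: ball_def)
    then show "x \<noteq> y" using d_commute[OF y, of k] by auto
    show "x \<in> V" using k(2) ball_V by blast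
  qed
  have "Q \<eta> = Q \<eta>2"
  proof -
    have "supp \<eta>1 \<inter> supp \<zeta> = {}" using \<eta>1(3) \<zeta>K by blast
    then show ?thesis
      using Q_split[OF \<eta>, of K] Q_join[OF \<eta>1(1) \<zeta>(1)] \<zeta>(3) by (simp add: \<eta>2_def \<eta>1_def add.commute)
  qed
  then have "f \<eta> - f \<eta>2 = f (keep (- {y}) \<eta>) - f (keep (- {y}) \<eta>2)"
    using off near KA(1)
    by (intro local_diff_transport[OF f(1) _ KA(2) \<eta> \<eta>2 keep_C[OF \<eta>] keep_C[OF \<eta>2]]) (auto simp: keep_def)
  moreover have "f \<eta>2 = f \<eta>1 + f \<zeta>"
    using f(2) y w(2) \<eta>1 \<zeta>(1,2) unfolding decoupled_def \<eta>2_def A_def by blast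
  moreover have "keep (- {y}) \<eta>2 = join (keep (- {y}) \<eta>1) \<zeta>"
  proof -
    have "\<zeta> y = b" using \<zeta>K yK y by (auto simp: supp_def)
    then show ?thesis by (auto simp: \<eta>2_def keep_def join_def)
  qed
  moreover have "f (join (keep (- {y}) \<eta>1) \<zeta>) = f (keep (- {y}) \<eta>1) + f \<zeta>"
  proof -
    have "supp (keep (- {y}) \<eta>1) \<subseteq> ball y r" using \<eta>1(2) by (auto simp: supp_keep)
    then show ?thesis
      using f(2) y w(2) keep_C[OF \<eta>1(1)] \<zeta>(1,2) unfolding decoupled_def A_def by blast
  qed
  ultimately show ?thesis by (simp add: \<eta>1_def)
qed

text \<open>The components outside the ball are emptied one after the other.\<close>

lemma removal_local:
  assumes f: "local_diff R f" "decoupled R f" and y: "y \<in> V" and \<eta>: "\<eta> \<in> C"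
  shows "f \<eta> - f (keep (- {y}) \<eta>) = f (keep (ball y R) \<eta>) - f (keep (- {y}) (keep (ball y R) \<eta>))"
  using \<eta>
proof (induction "card (supp \<eta> - ball y R)" arbitrary: \<eta> rule: less_induct)
  case less
  show ?case
  proof (cases "supp \<eta> \<subseteq> ball y R")
    case True
    then show ?thesis using keep_eq_self[OF less.prems] by simp
  next
    case False
    then obtain z where z: "z \<in> supp \<eta>" "z \<in> V - ball y R" using supp_V by blast
    define K where "K = comp (V - ball y R) z"
    have "z \<in> K" unfolding K_def by (rule self_in_comp)
    then have "supp (keep (- K) \<eta>) - ball y R \<subset> supp \<eta> - ball y R" using z by (auto simp: supp_keep)
    then have "card (supp (keep (- K) \<eta>) - ball y R) < card (supp \<eta> - ball y R)"
      using finite_supp[OF less.prems] by (intro psubset_card_mono) auto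
    from less.hyps[OF this keep_C[OF less.prems]]
    have IH: "f (keep (- K) \<eta>) - f (keep (- {y}) (keep (- K) \<eta>)) =
        f (keep (ball y R) (keep (- K) \<eta>)) - f (keep (- {y}) (keep (ball y R) (keep (- K) \<eta>)))" .
    have "K \<inter> ball y R = {}" using comp_sub[OF z(2)] unfolding K_def by blast
    then have "ball y R \<inter> - K = ball y R" by blast
    then have "keep (ball y R) (keep (- K) \<eta>) = keep (ball y R) \<eta>" by (simp add: keep_keep)
    then show ?thesis
      using IH removal_empty_component[OF f y z(2) less.prems K_def] by simp
  qed
qed

text \<open>Removing a particle far from \<open>x\<close> does not change the configuration near \<open>x\<close>.\<close>

lemma decoupled_fin_range:
  assumes f: "local_diff R f" "decoupled R f"
  shows "fin_range R f"
  unfolding fin_range_def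
proof (intro ballI impI)
  fix \<eta> x y assume \<eta>: "\<eta> \<in> C" and xy: "x \<in> V" "y \<in> V" "R < d x y"
  have "ball x R \<inter> - {y} = ball x R" using xy by (auto simp: ball_def)
  then have "keep (ball x R) (keep (- {y}) \<eta>) = keep (ball x R) \<eta>" by (simp add: keep_keep)
  then have "f \<eta> - f (keep (- {x}) \<eta>) = f (keep (- {y}) \<eta>) - f (keep (- {x}) (keep (- {y}) \<eta>))"
    using removal_local[OF f xy(1) \<eta>] removal_local[OF f xy(1) keep_C[OF \<eta>], of "- {y}"] by simp
  moreover have "- {x} \<inter> - {y} = - {x, y}" by blast
  ultimately show "f \<eta> - f (keep (- {x}) \<eta>) = f (keep (- {y}) \<eta>) - f (keep (- {x, y}) \<eta>)"
    by (simp add: keep_keep)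
qed

end

section \<open>Uniform functions are the functions of finite range\<close>

text \<open>Pairing each set with its extension by \<open>x\<close>; applied once it shows that the parts of an expansion
  vanish on configurations with a vacant site, applied twice that they vanish on sets of large
  diameter.\<close>

lemma alternating_sum_insert:
  fixes u :: "'a set \<Rightarrow> real"
  assumes "finite L" "x \<notin> L"
  shows "(\<Sum>A\<in>Pow (insert x L). (-1) ^ card A * u A) = (\<Sum>A\<in>Pow L. (-1) ^ card A * (u A - u (insert x A)))"
proof -
  have inj: "inj_on (insert x) (Pow L)" using assms(2) by (intro inj_onI) (metis Diff_insert_absorb PowD subsetD)
  have disj: "Pow L \<inter> insert x ` Pow L = {}" using assms(2) by blast
  have card: "card (insert x A) = Suc (card A)" if "A \<in> Pow L" for A
    using that assms finite_subset[of A L] by (subst card_insert_disjoint) auto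
  have "(\<Sum>A\<in>Pow (insert x L). (-1) ^ card A * u A) =
      (\<Sum>A\<in>Pow L. (-1) ^ card A * u A) + (\<Sum>A\<in>Pow L. (-1) ^ card (insert x A) * u (insert x A))"
    unfolding Pow_insert using assms(1) disj by (simp add: sum.union_disjoint sum.reindex[OF inj])
  also have "(\<Sum>A\<in>Pow L. (-1) ^ card (insert x A) * u (insert x A)) = (\<Sum>A\<in>Pow L. - ((-1) ^ card A * u (insert x A)))"
    by (rule sum.cong) (simp_all add: card)
  finally show ?thesis by (simp add: sum_negf sum_subtractf right_diff_distrib)
qed

context system
begin

lemma gdiam_ge: assumes "finite \<Lambda>" "x \<in> \<Lambda>" "y \<in> \<Lambda>" shows "d x y \<le> gdiam E \<Lambda>"
  unfolding gdiam_def
  by (rule cSUP_upper2[of _ _ "(x, y)"]) (use assms in auto)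

lemma gdiam_gt:
  assumes "gdiam E \<Lambda> > R" obtains x y where "x \<in> \<Lambda>" "y \<in> \<Lambda>" "d x y > R"
proof -
  have "\<Lambda> \<noteq> {}" using assms by (auto simp: gdiam_def Sup_nat_def)
  have "\<not> (\<forall>x\<in>\<Lambda>. \<forall>y\<in>\<Lambda>. d x y \<le> R)"
  proof
    assume "\<forall>x\<in>\<Lambda>. \<forall>y\<in>\<Lambda>. d x y \<le> R"
    then have "gdiam E \<Lambda> \<le> R" unfolding gdiam_def
      by (intro cSUP_least) (use \<open>\<Lambda> \<noteq> {}\<close> in auto)
    then show False using assms by simp
  qed
  then show thesis using that by (meson not_le)
qed

text \<open>The expansion into exactly local parts is given by Moebius inversion over the subsets of the
  support. On a set with two sites at distance more than \<open>R\<close>, the part is an alternating sum of second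
  differences at these sites, which all vanish.\<close>

lemma fin_range_uniform:
  assumes ext: "f \<in> C \<rightarrow>\<^sub>E UNIV" and fr: "fin_range R f"
  shows "uniform_fun V E b f"
proof -
  define F where "F \<Lambda> = (\<lambda>\<eta>\<in>C. (-1) ^ card \<Lambda> * (\<Sum>A\<in>Pow \<Lambda>. (-1) ^ card A * f (keep A \<eta>)))" for \<Lambda>
  have zero: "F \<Lambda> \<eta> = 0" if \<Lambda>: "finite \<Lambda>" "x \<in> \<Lambda>" and \<eta>: "\<eta> \<in> C" "\<eta> x = b" for \<Lambda> \<eta> x
  proof -
    define L where "L = \<Lambda> - {x}"
    have L: "\<Lambda> = insert x L" "finite L" "x \<notin> L" using \<Lambda> by (auto simp: L_def)
    have "keep (insert x A) \<eta> = keep A \<eta>" for A using \<eta>(2) by (auto simp: keep_def)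
    then show ?thesis using \<eta>(1) by (simp add: F_def L(1) alternating_sum_insert[OF L(2,3)])
  qed
  have "is_expansion V b f F"
    unfolding is_expansion_def
  proof (intro conjI allI impI ballI)
    fix \<Lambda> assume \<Lambda>: "\<Lambda> \<subseteq> V \<and> finite \<Lambda>"
    have "F \<Lambda> \<eta> = F \<Lambda> \<eta>'" if "\<eta> \<in> C" "\<eta>' \<in> C" "\<forall>x\<in>\<Lambda>. \<eta> x = \<eta>' x" for \<eta> \<eta>'
    proof -
      have "keep A \<eta> = keep A \<eta>'" if "A \<in> Pow \<Lambda>" for A
        using \<open>\<forall>x\<in>\<Lambda>. \<eta> x = \<eta>' x\<close> that by (intro keep_cong) auto
      then show ?thesis using that(1,2) by (simp add: F_def)
    qed
    moreover have "F \<Lambda> \<in> C \<rightarrow>\<^sub>E UNIV" by (simp add: F_def)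
    ultimately show "F \<Lambda> \<in> exact_local_funs V b \<Lambda>"
      using zero \<Lambda> unfolding exact_local_funs_def local_funs_def by blast
  next
    fix \<eta> assume \<eta>: "\<eta> \<in> C"
    let ?S = "supp \<eta>"
    have "f (keep ?S \<eta>) = (\<Sum>T\<in>Pow ?S. (-1) ^ card T * (\<Sum>A\<in>Pow T. (-1) ^ card A * f (keep A \<eta>)))"
      by (rule inclusion_exclusion_symmetric) (use finite_supp[OF \<eta>] in auto)
    also have "\<dots> = (\<Sum>T\<in>Pow ?S. F T \<eta>)" using \<eta> by (simp add: F_def)
    also have "\<dots> = sum' (\<lambda>\<Lambda>. F \<Lambda> \<eta>) (Pow ?S)" using finite_supp[OF \<eta>] by simp
    also have "\<dots> = sum' (\<lambda>\<Lambda>. F \<Lambda> \<eta>) {\<Lambda>. \<Lambda> \<subseteq> V \<and> finite \<Lambda>}"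
    proof (rule sum.mono_neutral_left')
      show "Pow ?S \<subseteq> {\<Lambda>. \<Lambda> \<subseteq> V \<and> finite \<Lambda>}"
        using supp_V[of \<eta>] finite_subset[OF _ finite_supp[OF \<eta>]] by auto
      show "\<forall>\<Lambda>\<in>{\<Lambda>. \<Lambda> \<subseteq> V \<and> finite \<Lambda>} - Pow ?S. F \<Lambda> \<eta> = 0"
      proof
        fix \<Lambda> assume "\<Lambda> \<in> {\<Lambda>. \<Lambda> \<subseteq> V \<and> finite \<Lambda>} - Pow ?S"
        then obtain x where "x \<in> \<Lambda>" "x \<in> V" "x \<notin> ?S" "finite \<Lambda>" by blast
        then show "F \<Lambda> \<eta> = 0" using \<eta> by (intro zero[of \<Lambda> x]) (auto simp: supp_def)
      qed
    qed
    finally show "f \<eta> = sum' (\<lambda>\<Lambda>. F \<Lambda> \<eta>) {\<Lambda>. \<Lambda> \<subseteq> V \<and> finite \<Lambda>}"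
      using keep_eq_self[OF \<eta>, of ?S] by simp
  qed
  moreover have "F \<Lambda> \<eta> = 0" if \<Lambda>: "\<Lambda> \<subseteq> V" "finite \<Lambda>" "real (gdiam E \<Lambda>) > real R + 1" and \<eta>: "\<eta> \<in> C" for \<Lambda> \<eta>
  proof -
    have "gdiam E \<Lambda> > R" using \<Lambda>(3) by linarith
    then obtain x y where xy: "x \<in> \<Lambda>" "y \<in> \<Lambda>" "d x y > R" by (rule gdiam_gt)
    define L where "L = \<Lambda> - {x, y}"
    have ne: "x \<noteq> y" using xy(3) by auto
    have L: "\<Lambda> = insert x (insert y L)" "finite L" "x \<notin> insert y L" "y \<notin> L" "finite (insert y L)"
      using \<Lambda>(2) xy ne by (auto simp: L_def)
    \<comment> \<open>The second difference at \<open>x\<close> and \<open>y\<close>, of the configuration that \<open>\<eta>\<close> induces on \<open>A\<close>, \<open>x\<close> and \<open>y\<close>.\<close>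
    have four: "f (keep A \<eta>) - f (keep (insert x A) \<eta>) -
        (f (keep (insert y A) \<eta>) - f (keep (insert x (insert y A)) \<eta>)) = 0" if "A \<in> Pow L" for A
    proof -
      define \<theta> where "\<theta> = keep (insert x (insert y A)) \<eta>"
      have "x \<notin> A" "y \<notin> A" using that L(3,4) by auto
      then have "- {x} \<inter> insert x (insert y A) = insert y A" "- {y} \<inter> insert x (insert y A) = insert x A"
        "- {x, y} \<inter> insert x (insert y A) = A" using ne by auto
      then have "keep (- {x}) \<theta> = keep (insert y A) \<eta>" "keep (- {y}) \<theta> = keep (insert x A) \<eta>"
        "keep (- {x, y}) \<theta> = keep A \<eta>"
        unfolding \<theta>_def keep_keep by simp_all
      moreover have "f \<theta> - f (keep (- {x}) \<theta>) = f (keep (- {y}) \<theta>) - f (keep (- {x, y}) \<theta>)"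
        using fr keep_C[OF \<eta>] xy \<Lambda>(1) unfolding fin_range_def \<theta>_def by blast
      ultimately show ?thesis by (simp add: \<theta>_def)
    qed
    have "(\<Sum>A\<in>Pow \<Lambda>. (-1) ^ card A * f (keep A \<eta>)) = 0"
      unfolding L(1) alternating_sum_insert[OF L(5,3)] alternating_sum_insert[OF L(2,4)]
      using four by (intro sum.neutral) simp
    then show ?thesis using \<eta> by (simp add: F_def)
  qed
  ultimately show ?thesis
    unfolding uniform_fun_def using ext by (intro conjI exI[of _ F] exI[of _ "real R + 1"]) auto
qed

lemma expansion_sum:
  assumes F: "is_expansion V b f F" and \<theta>: "\<theta> \<in> C" and W: "finite W" "W \<subseteq> V" "supp \<theta> \<subseteq> W"
  shows "f \<theta> = (\<Sum>\<Lambda>\<in>Pow W. F \<Lambda> \<theta>)"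
proof -
  have "(\<Sum>\<Lambda>\<in>Pow W. F \<Lambda> \<theta>) = sum' (\<lambda>\<Lambda>. F \<Lambda> \<theta>) (Pow W)" using W(1) by simp
  also have "\<dots> = sum' (\<lambda>\<Lambda>. F \<Lambda> \<theta>) {\<Lambda>. \<Lambda> \<subseteq> V \<and> finite \<Lambda>}"
  proof (rule sum.mono_neutral_left')
    show "Pow W \<subseteq> {\<Lambda>. \<Lambda> \<subseteq> V \<and> finite \<Lambda>}" using W finite_subset by auto
    show "\<forall>\<Lambda>\<in>{\<Lambda>. \<Lambda> \<subseteq> V \<and> finite \<Lambda>} - Pow W. F \<Lambda> \<theta> = 0"
    proof
      fix \<Lambda> assume \<Lambda>: "\<Lambda> \<in> {\<Lambda>. \<Lambda> \<subseteq> V \<and> finite \<Lambda>} - Pow W"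
      then obtain x where "x \<in> \<Lambda>" "x \<in> V" "x \<notin> supp \<theta>" using W(3) by blast
      then have "\<exists>x\<in>\<Lambda>. \<theta> x = b" by (auto simp: supp_def)
      moreover have "F \<Lambda> \<in> exact_local_funs V b \<Lambda>" using F \<Lambda> unfolding is_expansion_def by blast
      ultimately show "F \<Lambda> \<theta> = 0" using \<theta> unfolding exact_local_funs_def by blast
    qed
  qed
  finally show ?thesis using F \<theta> unfolding is_expansion_def by simp
qed

text \<open>In the second difference at \<open>x\<close> and \<open>y\<close>, the parts on sets that omit \<open>x\<close> or \<open>y\<close> cancel, and those on
  sets that contain both are zero.\<close>

lemma uniform_fin_range:
  assumes "uniform_fun V E b f"
  shows "\<exists>R. fin_range R f"
proof -
  obtain F R0 where F: "is_expansion V b f F" and R0: "R0 > 0"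
    and far: "\<forall>\<Lambda>. \<Lambda> \<subseteq> V \<and> finite \<Lambda> \<and> real (gdiam E \<Lambda>) > R0 \<longrightarrow> (\<forall>\<eta>\<in>C. F \<Lambda> \<eta> = 0)"
    using assms unfolding uniform_fun_def by (elim conjE exE)
  define R where "R = nat \<lceil>R0\<rceil>"
  have "fin_range R f"
    unfolding fin_range_def
  proof (intro ballI impI)
    fix \<eta> x y assume \<eta>: "\<eta> \<in> C" and xy: "x \<in> V" "y \<in> V" "R < d x y"
    let ?W = "supp \<eta>"
    note C4 = \<eta> keep_C[OF \<eta>, of "- {x}"] keep_C[OF \<eta>, of "- {y}"] keep_C[OF \<eta>, of "- {x, y}"]
    have sum: "f \<theta> = (\<Sum>\<Lambda>\<in>Pow ?W. F \<Lambda> \<theta>)" if "\<theta> \<in> C" "supp \<theta> \<subseteq> ?W" for \<theta>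
      using expansion_sum[OF F that(1) finite_supp[OF \<eta>] supp_V that(2)] .
    have "F \<Lambda> \<eta> - F \<Lambda> (keep (- {x}) \<eta>) = F \<Lambda> (keep (- {y}) \<eta>) - F \<Lambda> (keep (- {x, y}) \<eta>)" if "\<Lambda> \<in> Pow ?W" for \<Lambda>
    proof -
      have \<Lambda>: "\<Lambda> \<subseteq> V" "finite \<Lambda>" using that supp_V[of \<eta>] finite_subset[OF _ finite_supp[OF \<eta>]] by auto
      then have "F \<Lambda> \<in> exact_local_funs V b \<Lambda>" using F unfolding is_expansion_def by blast
      then have "F \<Lambda> \<in> local_funs V b \<Lambda>" unfolding exact_local_funs_def by simp
      then have loc: "\<forall>\<theta>\<in>C. \<forall>\<theta>'\<in>C. (\<forall>x\<in>\<Lambda>. \<theta> x = \<theta>' x) \<longrightarrow> F \<Lambda> \<theta> = F \<Lambda> \<theta>'"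
        unfolding local_funs_def by (elim CollectE conjE)
      have cong: "F \<Lambda> \<theta> = F \<Lambda> \<theta>'" if "\<theta> \<in> C" "\<theta>' \<in> C" "\<And>x. x \<in> \<Lambda> \<Longrightarrow> \<theta> x = \<theta>' x" for \<theta> \<theta>'
        by (rule loc[rule_format, OF that])
      have val: "keep A \<eta> z = (if z \<in> A then \<eta> z else b)" if "z \<in> \<Lambda>" for A z
        using that \<Lambda>(1) by (auto simp: keep_def)
      consider "x \<notin> \<Lambda>" | "y \<notin> \<Lambda>" | "x \<in> \<Lambda>" "y \<in> \<Lambda>" by blast
      then show ?thesis
      proof cases
        case 1
        then have ne: "z \<noteq> x" if "z \<in> \<Lambda>" for z using that by blast
        have "F \<Lambda> \<eta> = F \<Lambda> (keep (- {x}) \<eta>)"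
          by (rule cong[OF C4(1,2)]) (simp add: val ne)
        moreover have "F \<Lambda> (keep (- {y}) \<eta>) = F \<Lambda> (keep (- {x, y}) \<eta>)"
          by (rule cong[OF C4(3,4)]) (simp add: val ne)
        ultimately show ?thesis by simp
      next
        case 2
        then have ne: "z \<noteq> y" if "z \<in> \<Lambda>" for z using that by blast
        have "F \<Lambda> \<eta> = F \<Lambda> (keep (- {y}) \<eta>)"
          by (rule cong[OF C4(1,3)]) (simp add: val ne)
        moreover have "F \<Lambda> (keep (- {x}) \<eta>) = F \<Lambda> (keep (- {x, y}) \<eta>)"
          by (rule cong[OF C4(2,4)]) (simp add: val ne)
        ultimately show ?thesis by simp
      next
        case 3
        have "R0 \<le> real R" unfolding R_def by (rule real_nat_ceiling_ge)
        moreover have "real R < real (gdiam E \<Lambda>)" using gdiam_ge[OF \<Lambda>(2) 3] xy(3) by simp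
        ultimately have "R0 < real (gdiam E \<Lambda>)" by linarith
        then have "\<forall>\<eta>\<in>C. F \<Lambda> \<eta> = 0" using far \<Lambda> by simp
        then show ?thesis using C4 by simp
      qed
    qed
    then have "(\<Sum>\<Lambda>\<in>Pow ?W. F \<Lambda> \<eta> - F \<Lambda> (keep (- {x}) \<eta>)) =
        (\<Sum>\<Lambda>\<in>Pow ?W. F \<Lambda> (keep (- {y}) \<eta>) - F \<Lambda> (keep (- {x, y}) \<eta>))" by (rule sum.cong[OF refl])
    then show "f \<eta> - f (keep (- {x}) \<eta>) = f (keep (- {y}) \<eta>) - f (keep (- {x, y}) \<eta>)"
      using sum C4 by (simp add: sum_subtractf supp_keep)
  qed
  then show ?thesis ..
qed

text \<open>The particles at distance more than \<open>R\<close> from \<open>x\<close> can be removed one by one without changing the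
  difference at \<open>x\<close>.\<close>

lemma fin_range_removal:
  assumes fr: "fin_range R f" and x: "x \<in> V" and \<eta>: "\<eta> \<in> C"
  shows "f \<eta> - f (keep (- {x}) \<eta>) = f (keep (ball x R) \<eta>) - f (keep (- {x}) (keep (ball x R) \<eta>))"
  using \<eta>
proof (induction "card (supp \<eta> - ball x R)" arbitrary: \<eta> rule: less_induct)
  case less
  show ?case
  proof (cases "supp \<eta> \<subseteq> ball x R")
    case True
    then show ?thesis using keep_eq_self[OF less.prems] by simp
  next
    case False
    then obtain y where y: "y \<in> supp \<eta>" "y \<in> V" "y \<notin> ball x R" using supp_V by blast
    then have yR: "R < d x y" by (simp add: ball_def)
    have "supp (keep (- {y}) \<eta>) - ball x R \<subset> supp \<eta> - ball x R" using y by (auto simp: supp_keep)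
    then have "card (supp (keep (- {y}) \<eta>) - ball x R) < card (supp \<eta> - ball x R)"
      using finite_supp[OF less.prems] by (intro psubset_card_mono) auto
    note IH = less.hyps[OF this keep_C[OF less.prems]]
    have "f \<eta> - f (keep (- {x}) \<eta>) = f (keep (- {y}) \<eta>) - f (keep (- {x, y}) \<eta>)"
      using fr less.prems x y(2) yR unfolding fin_range_def by blast
    moreover have "- {x} \<inter> - {y} = - {x, y}" "ball x R \<inter> - {y} = ball x R" using y(3) by auto
    ultimately show ?thesis using IH by (simp add: keep_keep)
  qed
qed

lemma fin_range_removal_cong:
  assumes fr: "fin_range R f" and x: "x \<in> V" and C: "\<eta> \<in> C" "\<rho> \<in> C"
    and eq: "\<And>z. z \<in> ball x R \<Longrightarrow> \<eta> z = \<rho> z"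
  shows "f \<eta> - f (keep (- {x}) \<eta>) = f \<rho> - f (keep (- {x}) \<rho>)"
proof -
  have "keep (ball x R) \<eta> = keep (ball x R) \<rho>" using eq by (intro keep_cong) auto
  then show ?thesis using fin_range_removal[OF fr x C(1)] fin_range_removal[OF fr x C(2)] by simp
qed

text \<open>A transition empties the two ends of an edge and fills them again.\<close>

lemma fin_range_local_diff:
  assumes fr: "fin_range R f" shows "local_diff R f"
  unfolding local_diff_def
proof (intro ballI impI)
  fix e \<eta> \<rho> assume e: "e \<in> E" and C: "\<eta> \<in> C" "\<rho> \<in> C" and eq: "\<forall>x\<in>ball (fst e) R \<union> ball (snd e) R. \<eta> x = \<rho> x"
  obtain x y where xy: "e = (x, y)" "x \<in> V" "y \<in> V" using e E_sub by (cases e) auto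
  have two: "f \<theta> - f (keep (- {x, y}) \<theta>) = f \<theta>' - f (keep (- {x, y}) \<theta>')"
    if "\<theta> \<in> C" "\<theta>' \<in> C" "\<forall>z\<in>ball x R \<union> ball y R. \<theta> z = \<theta>' z" for \<theta> \<theta>'
  proof -
    have "f \<theta> - f (keep (- {x}) \<theta>) = f \<theta>' - f (keep (- {x}) \<theta>')"
      by (rule fin_range_removal_cong[OF fr xy(2)]) (use that in auto)
    moreover have "f (keep (- {x}) \<theta>) - f (keep (- {y}) (keep (- {x}) \<theta>)) =
        f (keep (- {x}) \<theta>') - f (keep (- {y}) (keep (- {x}) \<theta>'))"
      by (rule fin_range_removal_cong[OF fr xy(3)]) (use that in \<open>auto simp: keep_C\<close>, auto simp: keep_def)
    moreover have "- {y} \<inter> - {x} = - {x, y}" by blast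
    ultimately show ?thesis by (simp add: keep_keep)
  qed
  have step: "keep (- {x, y}) (conf_step \<phi> e \<theta>) = keep (- {x, y}) \<theta>" for \<theta>
    by (auto simp: keep_def conf_step_def xy(1))
  have "conf_step \<phi> e \<eta> z = conf_step \<phi> e \<rho> z" if "z \<in> ball x R \<union> ball y R" for z
    using eq that center_in_ball[OF xy(2)] center_in_ball[OF xy(3)] by (simp add: conf_step_def xy(1))
  then have "f (conf_step \<phi> e \<eta>) - f (keep (- {x, y}) (conf_step \<phi> e \<eta>)) =
      f (conf_step \<phi> e \<rho>) - f (keep (- {x, y}) (conf_step \<phi> e \<rho>))"
    using conf_step_C[OF e] C by (intro two) auto
  moreover have "f \<eta> - f (keep (- {x, y}) \<eta>) = f \<rho> - f (keep (- {x, y}) \<rho>)"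
    using eq C by (intro two) (auto simp: xy(1))
  ultimately show "f (conf_step \<phi> e \<eta>) - f \<eta> = f (conf_step \<phi> e \<rho>) - f \<rho>" by (simp add: step)
qed

text \<open>The particles of \<open>\<eta>\<close> are removed one by one, each with the same effect with and without \<open>\<zeta>\<close>.\<close>

lemma fin_range_additive:
  assumes fr: "fin_range R f" and f0: "f (base_config V b) = 0" and \<zeta>: "\<zeta> \<in> C"
    and \<eta>: "\<eta> \<in> C" "\<And>x y. x \<in> supp \<eta> \<Longrightarrow> y \<in> supp \<zeta> \<Longrightarrow> R < d x y"
  shows "f (join \<eta> \<zeta>) = f \<eta> + f \<zeta>"
  using \<eta>
proof (induction "card (supp \<eta>)" arbitrary: \<eta>)
  case 0
  then have "supp \<eta> = {}" using finite_supp by simp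
  then have "\<eta> = base_config V b"
    using 0 by (intro C_eqI base_C) (auto simp: supp_def base_config_def)
  then show ?case using f0 \<zeta> by (simp add: base_join)
next
  case (Suc n)
  then obtain x where x: "x \<in> supp \<eta>" by (metis card.empty ex_in_conv nat.distinct(1))
  then have xV: "x \<in> V" using supp_V by blast
  have b\<zeta>: "\<zeta> z = b" if "z \<in> ball x R" for z
  proof (rule ccontr)
    assume "\<zeta> z \<noteq> b"
    then have "z \<in> supp \<zeta>" using that by (auto simp: supp_def ball_def)
    then show False using Suc.prems(2)[OF x] that by (fastforce simp: ball_def)
  qed
  have "supp (keep (- {x}) \<eta>) = supp \<eta> - {x}" by (auto simp: supp_keep)
  then have "n = card (supp (keep (- {x}) \<eta>))"
    using Suc.hyps(2) x finite_supp[OF Suc.prems(1)] by simp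
  from Suc.hyps(1)[OF this keep_C[OF Suc.prems(1)]] Suc.prems(2)
  have IH: "f (join (keep (- {x}) \<eta>) \<zeta>) = f (keep (- {x}) \<eta>) + f \<zeta>" by (simp add: supp_keep)
  have "f (join \<eta> \<zeta>) - f (keep (- {x}) (join \<eta> \<zeta>)) = f \<eta> - f (keep (- {x}) \<eta>)"
    by (rule fin_range_removal_cong[OF fr xV join_C[OF Suc.prems(1) \<zeta>] Suc.prems(1)])
      (use b\<zeta> ball_V[of x R] in \<open>auto simp: join_def\<close>)
  moreover have "keep (- {x}) (join \<eta> \<zeta>) = join (keep (- {x}) \<eta>) \<zeta>"
    using b\<zeta>[OF center_in_ball[OF xV]] by (auto simp: keep_def join_def)
  ultimately show ?case using IH by simp
qed

end

section \<open>Invariant uniform functions are conserved quantities\<close>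

text \<open>A function that is constant along transitions depends on the total charge only, since any two
  configurations of the same charge are connected. Hence a particle may be replaced by one of the same
  state far away from all others, where uniformity makes \<open>f\<close> additive; so \<open>f\<close> is the sum over the
  particles of its values at single particles. Applied to two distant particles in the states before
  and after an interaction, this shows that these values are conserved.\<close>

lemma (in wt_system) invariant_uniform_function:
  assumes fr: "fin_range R f" and f0: "f (base_config V b) = 0"
    and inv: "\<And>\<eta> e. \<eta> \<in> C \<Longrightarrow> e \<in> E \<Longrightarrow> f (conf_step \<phi> e \<eta>) = f \<eta>"
  shows "\<exists>\<xi>\<in>consv b \<phi>. \<forall>\<eta>\<in>C. xi_sum \<xi> V \<eta> = f \<eta>"
proof -
  have f_Q: "f \<eta> = f \<eta>'" if "\<eta> \<in> C" "\<eta>' \<in> C" "Q \<eta> = Q \<eta>'" for \<eta> \<eta>'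
  proof -
    have "(\<eta>, \<eta>') \<in> (moves V)\<^sup>*" by (rule moves_connect) (use conn_V that in auto)
    then show ?thesis
    proof (induction rule: rtrancl_induct)
      case (step \<zeta> \<theta>)
      from step.hyps(2) obtain e where "\<zeta> \<in> C" "e \<in> E" "\<theta> = conf_step \<phi> e \<zeta>" unfolding moves_def by blast
      then show ?case using inv step.IH by simp
    qed simp
  qed
  define \<xi> where "\<xi> s = f (single origin s)" for s
  have f_single: "f (single y s) = \<xi> s" if "y \<in> V" for y s
    unfolding \<xi>_def by (rule f_Q) (simp_all add: single_C Q_single that origin_V)
  have supp_single: "supp (single y s) \<subseteq> {y}" for y s by (auto simp: supp_def single_def)
  \<comment> \<open>Adding a particle in state \<open>s\<close>, far from all others.\<close>
  have put: "\<exists>y\<in>V. f (join \<eta> (single y s)) = f \<eta> + \<xi> s \<and> Q (join \<eta> (single y s)) = Q \<eta> + charge s"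
    if \<eta>: "\<eta> \<in> C" for \<eta> s
  proof -
    obtain n where n: "supp \<eta> \<subseteq> ball origin n" using finite_in_ball[OF origin_V finite_supp[OF \<eta>] supp_V] by blast
    obtain y where y: "y \<in> V - ball origin (n + R)" using complement_ball(1)[OF origin_V] by blast
    have far: "R < d x y" if "x \<in> supp \<eta>" for x
    proof -
      have "x \<in> V" "d origin x \<le> n" using that n by (auto simp: ball_def)
      moreover have "y \<in> V" "n + R < d origin y" using y by (auto simp: ball_def)
      ultimately show ?thesis using d_triangle[OF origin_V, of x y] by linarith
    qed
    then have "f (join \<eta> (single y s)) = f \<eta> + f (single y s)"
      using supp_single by (intro fin_range_additive[OF fr f0 single_C \<eta>]) blast
    moreover have "y \<notin> supp \<eta>" using far[of y] by auto
    then have "supp \<eta> \<inter> supp (single y s) = {}" using supp_single by blast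
    ultimately show ?thesis
      using y Q_join[OF \<eta> single_C] f_single Q_single by (intro bexI[of _ y]) auto
  qed
  have main: "f \<eta> = (\<Sum>x\<in>supp \<eta>. \<xi> (\<eta> x))" if "\<eta> \<in> C" for \<eta>
    using that
  proof (induction "card (supp \<eta>)" arbitrary: \<eta>)
    case 0
    then have "supp \<eta> = {}" using finite_supp by simp
    moreover from this have "\<eta> = base_config V b"
      using 0 by (intro C_eqI base_C) (auto simp: supp_def base_config_def)
    ultimately show ?case using f0 by simp
  next
    case (Suc n)
    then obtain x where x: "x \<in> supp \<eta>" by (metis card.empty ex_in_conv nat.distinct(1))
    then have xV: "x \<in> V" using supp_V by blast
    let ?\<eta> = "keep (- {x}) \<eta>"
    have supp: "supp ?\<eta> = supp \<eta> - {x}" by (auto simp: supp_keep)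
    then have "n = card (supp ?\<eta>)"
      using Suc.hyps(2) x finite_supp[OF Suc.prems] by simp
    from Suc.hyps(1)[OF this keep_C[OF Suc.prems]]
    have "f ?\<eta> = (\<Sum>z\<in>supp \<eta> - {x}. \<xi> (?\<eta> z))" by (simp add: supp)
    also have "\<dots> = (\<Sum>z\<in>supp \<eta> - {x}. \<xi> (\<eta> z))"
      by (rule sum.cong) (auto simp: keep_def supp_def)
    finally have IH: "f ?\<eta> = (\<Sum>z\<in>supp \<eta> - {x}. \<xi> (\<eta> z))" .
    obtain y where y: "y \<in> V" "f (join ?\<eta> (single y (\<eta> x))) = f ?\<eta> + \<xi> (\<eta> x)"
      "Q (join ?\<eta> (single y (\<eta> x))) = Q ?\<eta> + charge (\<eta> x)"
      using put[OF keep_C[OF Suc.prems]] by blast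
    have "keep {x} \<eta> = single x (\<eta> x)" by (auto simp: keep_def single_def)
    then have "Q \<eta> = charge (\<eta> x) + Q ?\<eta>" using Q_split[OF Suc.prems, of "{x}"] Q_single[OF xV] by simp
    then have "f \<eta> = f (join ?\<eta> (single y (\<eta> x)))"
      using y(3) Suc.prems by (intro f_Q join_C keep_C single_C) (simp_all add: add.commute)
    then show ?case
      using y(2) IH sum.remove[OF finite_supp[OF Suc.prems] x, of "\<lambda>z. \<xi> (\<eta> z)"] by simp
  qed
  have \<xi>b: "\<xi> b = 0"
  proof -
    have "single origin b = base_config V b" by (auto simp: single_def base_config_def)
    then show ?thesis by (simp add: \<xi>_def f0)
  qed
  have pair: "\<exists>\<theta>\<in>C. f \<theta> = \<xi> s + \<xi> t \<and> Q \<theta> = charge s + charge t" for s t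
    using put[OF single_C, of origin s t] join_C[OF single_C single_C]
      f_single[OF origin_V] Q_single[OF origin_V] by metis
  have "\<xi> s + \<xi> t = \<xi> (fst (\<phi> (s, t))) + \<xi> (snd (\<phi> (s, t)))" for s t
  proof -
    obtain \<theta> where \<theta>: "\<theta> \<in> C" "f \<theta> = \<xi> s + \<xi> t" "Q \<theta> = charge s + charge t" using pair by blast
    obtain \<theta>' where \<theta>': "\<theta>' \<in> C" "f \<theta>' = \<xi> (fst (\<phi> (s, t))) + \<xi> (snd (\<phi> (s, t)))"
      "Q \<theta>' = charge (fst (\<phi> (s, t))) + charge (snd (\<phi> (s, t)))" using pair by blast
    have "f \<theta> = f \<theta>'" by (rule f_Q[OF \<theta>(1) \<theta>'(1)]) (simp only: \<theta>(3) \<theta>'(3) charge_conserved)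
    then show ?thesis using \<theta>(2) \<theta>'(2) by simp
  qed
  then have "\<xi> \<in> consv b \<phi>" using \<xi>b by (simp add: consv_def)
  moreover have "xi_sum \<xi> V \<eta> = f \<eta>" if "\<eta> \<in> C" for \<eta>
  proof -
    have "xi_sum \<xi> V \<eta> = (\<Sum>x\<in>supp \<eta>. \<xi> (\<eta> x))"
      by (rule xi_sum_fin[OF \<open>\<xi> \<in> consv b \<phi>\<close>]) (use finite_supp[OF that] in \<open>auto simp: supp_def\<close>)
    then show ?thesis using main[OF that] by simp
  qed
  ultimately show ?thesis by blast
qed

section \<open>Closed uniform forms are exact\<close>

lemma edge_path_append:
  "edge_path T u (p @ q) v \<longleftrightarrow> (\<exists>w. edge_path T u p w \<and> edge_path T w q v)"
  by (induction p arbitrary: u) auto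

lemma edge_path_rev:
  assumes "\<And>t. t \<in> T \<Longrightarrow> prod.swap t \<in> T" "edge_path T u p v"
  shows "edge_path T v (rev (map prod.swap p)) u"
  using assms(2)
proof (induction p arbitrary: u)
  case (Cons t p)
  then show ?case using assms(1)[of t] by (auto simp: edge_path_append)
qed simp

text \<open>Integration from a root of each connected component, along any path.\<close>

lemma closed_has_potential:
  fixes \<omega> :: "'a \<times> 'a \<Rightarrow> real"
  assumes T: "\<And>t. t \<in> T \<Longrightarrow> prod.swap t \<in> T"
    and \<omega>: "\<And>t. t \<in> T \<Longrightarrow> \<omega> (prod.swap t) = - \<omega> t"
    and closed: "\<And>u p. edge_path T u p u \<Longrightarrow> (\<Sum>t\<leftarrow>p. \<omega> t) = 0"
  obtains f where "\<And>t. t \<in> T \<Longrightarrow> f (snd t) - f (fst t) = \<omega> t"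
proof -
  have rev: "(\<Sum>t\<leftarrow>rev (map prod.swap p). \<omega> t) = - (\<Sum>t\<leftarrow>p. \<omega> t)" if "edge_path T u p v" for u p v
    using that by (induction p arbitrary: u) (auto simp: \<omega>)
  define conn where "conn u v \<longleftrightarrow> (\<exists>p. edge_path T u p v)" for u v
  have conn_refl: "conn u u" for u unfolding conn_def by (rule exI[of _ "[]"]) simp
  have conn_sym: "conn v u" if "conn u v" for u v
    using that edge_path_rev[OF T] unfolding conn_def by blast
  have conn_trans: "conn u w" if "conn u v" "conn v w" for u v w
    using that edge_path_append unfolding conn_def by metis
  define root where "root u = (SOME v. conn v u)" for u
  have root: "conn (root u) u" for u unfolding root_def by (rule someI[of _ u]) (rule conn_refl)
  have root_eq: "root u = root v" if "conn u v" for u v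
  proof -
    have "(\<lambda>w. conn w u) = (\<lambda>w. conn w v)" using that conn_sym conn_trans by blast
    then show ?thesis by (simp add: root_def)
  qed
  define path where "path u = (SOME p. edge_path T (root u) p u)" for u
  have path: "edge_path T (root u) (path u) u" for u
    using root[of u] unfolding conn_def path_def by (rule someI_ex)
  define f where "f u = (\<Sum>t\<leftarrow>path u. \<omega> t)" for u
  have "f (snd t) - f (fst t) = \<omega> t" if t: "t \<in> T" for t
  proof -
    let ?u = "fst t" and ?v = "snd t"
    have step: "edge_path T ?u [t] ?v" using t by simp
    then have "conn ?u ?v" unfolding conn_def by blast
    then have r: "root ?u = root ?v" by (rule root_eq)
    have homeward: "edge_path T ?v (rev (map prod.swap (path ?v))) (root ?u)"
      unfolding r by (rule edge_path_rev[OF T path])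
    have "edge_path T (root ?u) (path ?u @ ([t] @ rev (map prod.swap (path ?v)))) (root ?u)"
      unfolding edge_path_append using path[of ?u] step homeward by blast
    then have "(\<Sum>t\<leftarrow>path ?u @ ([t] @ rev (map prod.swap (path ?v))). \<omega> t) = 0" by (rule closed)
    then show ?thesis using rev[OF path[of ?v]] by (simp add: f_def)
  qed
  then show thesis by (rule that)
qed

context system
begin

abbreviation T where "T \<equiv> fin_transitions V E b \<phi>"

lemma T_iff: "t \<in> T \<longleftrightarrow> (\<exists>\<eta>\<in>C. \<exists>e\<in>E. t = (\<eta>, conf_step \<phi> e \<eta>))"
proof
  assume "t \<in> T"
  then obtain \<eta> e where "t = (\<eta>, conf_step \<phi> e \<eta>)" "e \<in> E" "\<eta> \<in> C"
    unfolding fin_transitions_def transitions_def by blast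
  then show "\<exists>\<eta>\<in>C. \<exists>e\<in>E. t = (\<eta>, conf_step \<phi> e \<eta>)" by blast
next
  assume "\<exists>\<eta>\<in>C. \<exists>e\<in>E. t = (\<eta>, conf_step \<phi> e \<eta>)"
  then obtain \<eta> e where *: "t = (\<eta>, conf_step \<phi> e \<eta>)" "e \<in> E" "\<eta> \<in> C" by blast
  moreover have "\<eta> \<in> configs V" using *(3) by (simp add: fin_configs_def)
  ultimately show "t \<in> T"
    unfolding fin_transitions_def transitions_def using conf_step_C[OF *(2,3)] by blast
qed

lemma T_C: "t \<in> T \<Longrightarrow> fst t \<in> C" "t \<in> T \<Longrightarrow> snd t \<in> C"
  unfolding fin_transitions_def by auto

text \<open>The reverse of a transition along an edge is the transition along the opposite edge, if something
  changes at all.\<close>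

lemma T_swap:
  assumes "t \<in> T" shows "prod.swap t \<in> T"
proof -
  obtain \<eta> x y where \<eta>: "\<eta> \<in> C" and e: "(x, y) \<in> E" and t: "t = (\<eta>, conf_step \<phi> (x, y) \<eta>)"
    using assms unfolding T_iff by auto
  have ne: "x \<noteq> y" using E_neq[OF e] .
  have xy: "x \<in> V" "y \<in> V" using E_V[OF e] by auto
  let ?s = "(\<eta> x, \<eta> y)" and ?\<zeta> = "conf_step \<phi> (x, y) \<eta>"
  have \<zeta>: "?\<zeta> \<in> C" using conf_step_C[OF e \<eta>] .
  show ?thesis
  proof (cases "\<phi> ?s = ?s")
    case True
    then have "?\<zeta> = \<eta>" by (simp add: conf_step_def)
    then have "prod.swap t = t" using t by simp
    then show ?thesis using assms by simp
  next
    case False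
    then have *: "prod.swap (\<phi> (prod.swap (\<phi> ?s))) = ?s"
      using interaction unfolding interaction_def by blast
    have pair: "(?\<zeta> y, ?\<zeta> x) = prod.swap (\<phi> ?s)"
      using ne by (simp add: conf_step_def prod.swap_def)
    have "conf_step \<phi> (y, x) ?\<zeta> z = \<eta> z" for z
    proof -
      have "fst (\<phi> (?\<zeta> y, ?\<zeta> x)) = \<eta> y" "snd (\<phi> (?\<zeta> y, ?\<zeta> x)) = \<eta> x"
        unfolding pair using * by (simp_all add: prod.swap_def)
      then show ?thesis using ne by (auto simp: conf_step_def)
    qed
    then have "conf_step \<phi> (y, x) ?\<zeta> = \<eta>" by (rule ext)
    moreover have "(y, x) \<in> E" using symD[OF sym_E e] .
    ultimately show ?thesis unfolding T_iff using \<zeta> t by (intro bexI[of _ ?\<zeta>] bexI[of _ "(y, x)"]) auto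
  qed
qed

lemma fin_range_mono: "fin_range R f \<Longrightarrow> R \<le> R' \<Longrightarrow> fin_range R' f"
  unfolding fin_range_def by (meson le_less_trans)

text \<open>From here on uniformity is used in its form without expansions, which is visibly closed under linear
  combinations and under the action.\<close>

lemma unif_funs0_iff:
  "f \<in> unif_funs0 V E b \<longleftrightarrow> f \<in> C \<rightarrow>\<^sub>E UNIV \<and> (\<exists>R. fin_range R f) \<and> f (base_config V b) = 0"
proof
  assume f: "f \<in> unif_funs0 V E b"
  then show "f \<in> C \<rightarrow>\<^sub>E UNIV \<and> (\<exists>R. fin_range R f) \<and> f (base_config V b) = 0"
    using uniform_fin_range unfolding unif_funs0_def uniform_fun_def by auto
next
  assume "f \<in> C \<rightarrow>\<^sub>E UNIV \<and> (\<exists>R. fin_range R f) \<and> f (base_config V b) = 0"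
  then show "f \<in> unif_funs0 V E b" using fin_range_uniform unfolding unif_funs0_def by auto
qed

lemma fin_range_cong: "(\<And>\<eta>. \<eta> \<in> C \<Longrightarrow> f \<eta> = g \<eta>) \<Longrightarrow> fin_range R f = fin_range R g"
  unfolding fin_range_def by (simp add: keep_C)

lemma unif_funs0_lincomb:
  assumes "f \<in> unif_funs0 V E b" "g \<in> unif_funs0 V E b"
  shows "(\<lambda>\<eta>\<in>C. p * f \<eta> + q * g \<eta>) \<in> unif_funs0 V E b"
proof -
  obtain R R' where R: "fin_range R f" "fin_range R' g" using assms unif_funs0_iff by blast
  have fr: "fin_range (max R R') f" "fin_range (max R R') g"
    using fin_range_mono[OF R(1)] fin_range_mono[OF R(2)] by simp_all
  have "fin_range (max R R') (\<lambda>\<eta>. p * f \<eta> + q * g \<eta>)"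
    unfolding fin_range_def
  proof (intro ballI impI)
    fix \<eta> x y assume *: "\<eta> \<in> C" "x \<in> V" "y \<in> V" "max R R' < d x y"
    have "f \<eta> - f (keep (- {x}) \<eta>) = f (keep (- {y}) \<eta>) - f (keep (- {x, y}) \<eta>)"
      "g \<eta> - g (keep (- {x}) \<eta>) = g (keep (- {y}) \<eta>) - g (keep (- {x, y}) \<eta>)"
      using fr * unfolding fin_range_def by blast+
    then show "p * f \<eta> + q * g \<eta> - (p * f (keep (- {x}) \<eta>) + q * g (keep (- {x}) \<eta>)) =
        p * f (keep (- {y}) \<eta>) + q * g (keep (- {y}) \<eta>) - (p * f (keep (- {x, y}) \<eta>) + q * g (keep (- {x, y}) \<eta>))"
      by (metis add_diff_add right_diff_distrib)
  qed
  then have "fin_range (max R R') (\<lambda>\<eta>\<in>C. p * f \<eta> + q * g \<eta>)"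
    by (subst fin_range_cong[of _ "\<lambda>\<eta>. p * f \<eta> + q * g \<eta>"]) simp_all
  then show ?thesis using assms base_C unfolding unif_funs0_iff by auto
qed

lemma boundary_apply: "t \<in> T \<Longrightarrow> boundary V E b \<phi> f t = f (snd t) - f (fst t)"
  by (simp add: boundary_def)

lemma boundary_ext: "boundary V E b \<phi> f \<in> extensional T"
  by (simp add: boundary_def)

lemma boundary_unif_closed:
  assumes "f \<in> unif_funs0 V E b" shows "boundary V E b \<phi> f \<in> unif_closed_forms V E b \<phi>"
proof -
  obtain R where R: "local_diff R f" using assms fin_range_local_diff unif_funs0_iff by blast
  have "boundary V E b \<phi> f \<in> forms V E b \<phi>"
    unfolding forms_def using T_swap by (auto simp: boundary_def)
  moreover have "(\<Sum>t\<leftarrow>p. boundary V E b \<phi> f t) = f v - f u" if "edge_path T u p v" for u p v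
    using that by (induction p arbitrary: u) (auto simp: boundary_apply)
  then have "closed_form V E b \<phi> (boundary V E b \<phi> f)" unfolding closed_form_def by auto
  moreover have "uniform_form V E b \<phi> (boundary V E b \<phi> f)"
    unfolding uniform_form_def
  \<comment> \<open>The radius has to be positive, also for \<open>R = 0\<close>.\<close>
  proof (intro exI[of _ "real R + 1"] conjI ballI)
    fix e assume e: "e \<in> E"
    have sub: "ball (fst e) R \<union> ball (snd e) R \<subseteq> edge_ball V E e (real R + 1)"
      by (auto simp: edge_ball_def gball_def ball_def)
    have val: "form_at V b \<phi> (boundary V E b \<phi> f) e \<eta> = f (conf_step \<phi> e \<eta>) - f \<eta>" if "\<eta> \<in> C" for \<eta>
    proof -
      have "(\<eta>, conf_step \<phi> e \<eta>) \<in> T" unfolding T_iff using that e by blast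
      then show ?thesis using that by (simp add: form_at_def boundary_apply)
    qed
    have "form_at V b \<phi> (boundary V E b \<phi> f) e \<eta> = form_at V b \<phi> (boundary V E b \<phi> f) e \<rho>"
      if "\<eta> \<in> C" "\<rho> \<in> C" "\<forall>x\<in>edge_ball V E e (real R + 1). \<eta> x = \<rho> x" for \<eta> \<rho>
    proof -
      have "\<forall>x\<in>ball (fst e) R \<union> ball (snd e) R. \<eta> x = \<rho> x" using that(3) sub by blast
      then have "f (conf_step \<phi> e \<eta>) - f \<eta> = f (conf_step \<phi> e \<rho>) - f \<rho>"
        using R e that(1,2) unfolding local_diff_def by blast
      then show ?thesis using val that(1,2) by simp
    qed
    moreover have "form_at V b \<phi> (boundary V E b \<phi> f) e \<in> C \<rightarrow>\<^sub>E UNIV" by (simp add: form_at_def)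
    ultimately show "form_at V b \<phi> (boundary V E b \<phi> f) e \<in> local_funs V b (edge_ball V E e (real R + 1))"
      unfolding local_funs_def by blast
  qed simp
  ultimately show ?thesis unfolding unif_closed_forms_def by blast
qed

lemma uniform_form_potential:
  assumes "\<omega> \<in> unif_closed_forms V E b \<phi>"
  obtains f R where "local_diff R f" "f (base_config V b) = 0" "\<And>t. t \<in> T \<Longrightarrow> f (snd t) - f (fst t) = \<omega> t"
proof -
  have \<omega>: "\<omega> \<in> forms V E b \<phi>" "closed_form V E b \<phi> \<omega>" "uniform_form V E b \<phi> \<omega>"
    using assms unfolding unif_closed_forms_def by auto
  have anti: "\<omega> (prod.swap t) = - \<omega> t" if "t \<in> T" for t using \<omega>(1) that unfolding forms_def by blast
  have closed: "(\<Sum>t\<leftarrow>p. \<omega> t) = 0" if p: "edge_path T u p u" for u p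
  proof (cases p)
    case (Cons t q)
    then have "t \<in> T" "fst t = u" using p by auto
    then have "u \<in> C" using T_C(1) by blast
    then show ?thesis using \<omega>(2) p unfolding closed_form_def by blast
  qed simp
  obtain f where f: "\<And>t. t \<in> T \<Longrightarrow> f (snd t) - f (fst t) = \<omega> t"
    using closed_has_potential[of T \<omega>] T_swap anti closed by metis
  obtain R0 where R0: "R0 > 0" "\<And>e. e \<in> E \<Longrightarrow> form_at V b \<phi> \<omega> e \<in> local_funs V b (edge_ball V E e R0)"
    using \<omega>(3) unfolding uniform_form_def by blast
  define R where "R = nat \<lfloor>R0\<rfloor>"
  let ?f = "\<lambda>\<eta>. f \<eta> - f (base_config V b)"
  have "local_diff R ?f"
    unfolding local_diff_def
  proof (intro ballI impI)
    fix e \<eta> \<rho> assume *: "e \<in> E" "\<eta> \<in> C" "\<rho> \<in> C" "\<forall>x\<in>ball (fst e) R \<union> ball (snd e) R. \<eta> x = \<rho> x"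
    have "edge_ball V E e R0 = ball (fst e) R \<union> ball (snd e) R"
      using R0(1) by (simp add: edge_ball_def gball_eq_ball R_def)
    then have "\<forall>x\<in>edge_ball V E e R0. \<eta> x = \<rho> x" using *(4) by simp
    then have "form_at V b \<phi> \<omega> e \<eta> = form_at V b \<phi> \<omega> e \<rho>"
      using R0(2)[OF *(1)] *(2,3) unfolding local_funs_def by blast
    then have "\<omega> (\<eta>, conf_step \<phi> e \<eta>) = \<omega> (\<rho>, conf_step \<phi> e \<rho>)"
      using *(2,3) by (simp add: form_at_def)
    moreover have "(\<eta>, conf_step \<phi> e \<eta>) \<in> T" "(\<rho>, conf_step \<phi> e \<rho>) \<in> T" unfolding T_iff using * by blast+
    ultimately show "?f (conf_step \<phi> e \<eta>) - ?f \<eta> = ?f (conf_step \<phi> e \<rho>) - ?f \<rho>"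
      using f[of "(\<eta>, conf_step \<phi> e \<eta>)"] f[of "(\<rho>, conf_step \<phi> e \<rho>)"] by simp
  qed
  then show thesis by (rule that) (use f in auto)
qed

end

context wt_system
begin

text \<open>A potential with vanishing interaction across gaps is uniform, and the cocycles at the ends are the
  obstruction to correcting a given potential by a function of the total charge.\<close>

theorem uniform_closed_form_exact:
  assumes hyp: "transferable V E \<or> simple_interaction b \<phi>" and \<omega>: "\<omega> \<in> unif_closed_forms V E b \<phi>"
  shows "\<exists>f\<in>unif_funs0 V E b. boundary V E b \<phi> f = \<omega>"
proof -
  obtain f R where f: "local_diff R f" "f (base_config V b) = 0" "\<And>t. t \<in> T \<Longrightarrow> f (snd t) - f (fst t) = \<omega> t"
    using uniform_form_potential[OF \<omega>] by metis
  interpret potential V E b \<phi> f R by unfold_locales (rule f(1,2))+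
  have "\<exists>\<epsilon>. is_end \<epsilon> \<and> symmetric_on M (h \<epsilon>)"
    using hyp
  proof
    assume "transferable V E"
    then show ?thesis by (rule symmetric_if_transferable)
  next
    assume simple: "simple_interaction b \<phi>"
    obtain \<epsilon> where "is_end \<epsilon>" using end_in_V by blast
    then show ?thesis using symmetric_if_simple[OF simple cocycle_h] by blast
  qed
  then obtain g where g: "local_diff R (\<lambda>\<eta>. f \<eta> + g (Q \<eta>))" "f (base_config V b) + g (Q (base_config V b)) = 0"
    "decoupled R (\<lambda>\<eta>. f \<eta> + g (Q \<eta>))"
    by (rule decouple)
  define F where "F = (\<lambda>\<eta>\<in>C. f \<eta> + g (Q \<eta>))"
  have "fin_range R F"
    unfolding F_def using decoupled_fin_range[OF g(1,3)]
    by (subst fin_range_cong[of _ "\<lambda>\<eta>. f \<eta> + g (Q \<eta>)"]) simp_all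
  then have "F \<in> unif_funs0 V E b" using g(2) base_C unfolding unif_funs0_iff F_def by auto
  moreover have "boundary V E b \<phi> F = \<omega>"
  proof (rule extensionalityI[of _ T])
    show "\<omega> \<in> extensional T" using \<omega> unfolding unif_closed_forms_def forms_def by (auto simp: PiE_def)
    fix t assume t: "t \<in> T"
    then obtain \<eta> e where e: "\<eta> \<in> C" "e \<in> E" "t = (\<eta>, conf_step \<phi> e \<eta>)" unfolding T_iff by blast
    then have "Q (snd t) = Q (fst t)" using Q_conf_step by simp
    then show "boundary V E b \<phi> F t = \<omega> t" using f(3)[OF t] T_C[OF t] t by (simp add: boundary_apply F_def)
  qed (rule boundary_ext)
  ultimately show ?thesis by blast
qed

theorem boundary_kernel:
  assumes f: "f \<in> unif_funs0 V E b" and zero: "\<And>t. t \<in> T \<Longrightarrow> f (snd t) = f (fst t)"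
  shows "\<exists>\<xi>\<in>consv b \<phi>. \<forall>\<eta>\<in>C. xi_sum \<xi> V \<eta> = f \<eta>"
proof -
  obtain R where R: "fin_range R f" "f (base_config V b) = 0" using f unif_funs0_iff by blast
  show ?thesis
  proof (rule invariant_uniform_function[OF R])
    fix \<eta> e assume "\<eta> \<in> C" "e \<in> E"
    then have "(\<eta>, conf_step \<phi> e \<eta>) \<in> T" unfolding T_iff by blast
    from zero[OF this] show "f (conf_step \<phi> e \<eta>) = f \<eta>" by simp
  qed
qed

end

section \<open>The group action and the connecting homomorphism\<close>

locale action_system = wt_system V E b \<phi>
  for V :: "'x set" and E :: "('x \<times> 'x) set" and b :: 's and \<phi> :: "'s interaction" +
  fixes G :: "('g, 'm) monoid_scheme" and act :: "'g \<Rightarrow> 'x \<Rightarrow> 'x"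
  assumes action: "locale_action G V E act" and free: "free_action G V act"
    and hyp: "transferable V E \<or> simple_interaction b \<phi>"
begin

sublocale A: group_action G V act
  using action by (simp add: locale_action_def)

sublocale G: group G
  by (rule group_hom.axioms(1)[OF A.group_hom])

abbreviation "sh \<equiv> shift_config V act"

lemma act_V: "\<sigma> \<in> carrier G \<Longrightarrow> x \<in> V \<Longrightarrow> act \<sigma> x \<in> V"
  by (rule A.element_image[OF _ _ refl])

lemma act_inj: "\<sigma> \<in> carrier G \<Longrightarrow> x \<in> V \<Longrightarrow> y \<in> V \<Longrightarrow> act \<sigma> x = act \<sigma> y \<longleftrightarrow> x = y"
  using A.inj_prop[of \<sigma>] inj_on_eq_iff[of "act \<sigma>" V x y] by simp

lemma act_surj: assumes "\<sigma> \<in> carrier G" "y \<in> V" obtains x where "x \<in> V" "act \<sigma> x = y"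
proof -
  have "y \<in> act \<sigma> ` V" by (simp only: A.surj_prop[OF assms(1)] assms(2))
  then show thesis using that by blast
qed

lemma act_E: "\<sigma> \<in> carrier G \<Longrightarrow> x \<in> V \<Longrightarrow> y \<in> V \<Longrightarrow> (act \<sigma> x, act \<sigma> y) \<in> E \<longleftrightarrow> (x, y) \<in> E"
  using action unfolding locale_action_def by blast

lemma act_mult: "\<sigma> \<in> carrier G \<Longrightarrow> \<tau> \<in> carrier G \<Longrightarrow> x \<in> V \<Longrightarrow> act (\<sigma> \<otimes>\<^bsub>G\<^esub> \<tau>) x = act \<sigma> (act \<tau> x)"
  by (rule A.composition_rule)

lemma act_relpow:
  assumes "\<sigma> \<in> carrier G" "x \<in> V" "(x, y) \<in> E ^^ n"
  shows "y \<in> V \<and> (act \<sigma> x, act \<sigma> y) \<in> E ^^ n"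
  using assms(3)
proof (induction n arbitrary: y)
  case (Suc n)
  then obtain z where z: "(x, z) \<in> E ^^ n" "(z, y) \<in> E" by auto
  then have "z \<in> V" "y \<in> V" using E_V by blast+
  then have "(act \<sigma> z, act \<sigma> y) \<in> E" using act_E[OF assms(1)] z(2) by blast
  then show ?case using Suc.IH[OF z(1)] \<open>y \<in> V\<close> by auto
next
  case 0
  then show ?case using assms(2) by simp
qed

lemma act_d:
  assumes \<sigma>: "\<sigma> \<in> carrier G" and xy: "x \<in> V" "y \<in> V"
  shows "d (act \<sigma> x) (act \<sigma> y) = d x y"
proof (rule antisym)
  show "d (act \<sigma> x) (act \<sigma> y) \<le> d x y"
    by (rule d_le[OF conjunct2[OF act_relpow[OF \<sigma> xy(1) relpow_d[OF xy]]]])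
  have inv: "act (inv\<^bsub>G\<^esub> \<sigma>) (act \<sigma> x) = x" "act (inv\<^bsub>G\<^esub> \<sigma>) (act \<sigma> y) = y"
    using A.orbit_sym_aux[OF \<sigma> xy(1) refl] A.orbit_sym_aux[OF \<sigma> xy(2) refl] by simp_all
  note V = act_V[OF \<sigma> xy(1)] act_V[OF \<sigma> xy(2)]
  show "d x y \<le> d (act \<sigma> x) (act \<sigma> y)"
    using d_le[OF conjunct2[OF act_relpow[OF G.inv_closed[OF \<sigma>] V(1) relpow_d[OF V]]]] by (simp only: inv)
qed

lemma supp_sh: "\<sigma> \<in> carrier G \<Longrightarrow> supp (sh \<sigma> \<eta>) = {x \<in> V. act \<sigma> x \<in> supp \<eta>}"
  using act_V by (auto simp: supp_def shift_config_def)

lemma bij_supp_sh: assumes "\<sigma> \<in> carrier G" shows "bij_betw (act \<sigma>) (supp (sh \<sigma> \<eta>)) (supp \<eta>)"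
  unfolding bij_betw_def
proof
  show "inj_on (act \<sigma>) (supp (sh \<sigma> \<eta>))"
    using A.inj_prop[OF assms] supp_V inj_on_subset by blast
  show "act \<sigma> ` supp (sh \<sigma> \<eta>) = supp \<eta>"
  proof
    show "supp \<eta> \<subseteq> act \<sigma> ` supp (sh \<sigma> \<eta>)"
    proof
      fix y assume y: "y \<in> supp \<eta>"
      then have "y \<in> V" using supp_V by blast
      then obtain x where "x \<in> V" "act \<sigma> x = y" by (rule act_surj[OF assms])
      then show "y \<in> act \<sigma> ` supp (sh \<sigma> \<eta>)" using y unfolding supp_sh[OF assms] by blast
    qed
  qed (auto simp: supp_sh[OF assms])
qed

lemma sh_C: assumes "\<sigma> \<in> carrier G" "\<eta> \<in> C" shows "sh \<sigma> \<eta> \<in> C"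
proof -
  have "finite (supp (sh \<sigma> \<eta>))"
    using bij_betw_finite[OF bij_supp_sh[OF assms(1)]] finite_supp[OF assms(2)] by blast
  then show ?thesis unfolding C_iff by (simp add: shift_config_def)
qed

lemma sh_base: "\<sigma> \<in> carrier G \<Longrightarrow> sh \<sigma> (base_config V b) = base_config V b"
  using act_V by (auto simp: shift_config_def base_config_def)

lemma sh_mult: "\<sigma> \<in> carrier G \<Longrightarrow> \<tau> \<in> carrier G \<Longrightarrow> sh (\<sigma> \<otimes>\<^bsub>G\<^esub> \<tau>) \<eta> = sh \<tau> (sh \<sigma> \<eta>)"
  using act_V act_mult by (auto simp: shift_config_def)

lemma sh_T: assumes \<sigma>: "\<sigma> \<in> carrier G" and t: "t \<in> T" shows "(sh \<sigma> (fst t), sh \<sigma> (snd t)) \<in> T"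
proof -
  obtain \<eta> x y where \<eta>: "\<eta> \<in> C" and e: "(x, y) \<in> E" and t: "t = (\<eta>, conf_step \<phi> (x, y) \<eta>)"
    using t unfolding T_iff by auto
  have xy: "x \<in> V" "y \<in> V" using E_V[OF e] by auto
  obtain u where u: "u \<in> V" "act \<sigma> u = x" by (rule act_surj[OF \<sigma> xy(1)])
  obtain v where v: "v \<in> V" "act \<sigma> v = y" by (rule act_surj[OF \<sigma> xy(2)])
  have uv: "(u, v) \<in> E" using act_E[OF \<sigma> u(1) v(1)] e u(2) v(2) by simp
  have "sh \<sigma> (conf_step \<phi> (x, y) \<eta>) = conf_step \<phi> (u, v) (sh \<sigma> \<eta>)"
  proof (rule C_eqI)
    show "sh \<sigma> (conf_step \<phi> (x, y) \<eta>) \<in> C" by (rule sh_C[OF \<sigma> conf_step_C[OF e \<eta>]])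
    show "conf_step \<phi> (u, v) (sh \<sigma> \<eta>) \<in> C" by (rule conf_step_C[OF uv sh_C[OF \<sigma> \<eta>]])
    fix z assume z: "z \<in> V"
    have "act \<sigma> z = x \<longleftrightarrow> z = u" "act \<sigma> z = y \<longleftrightarrow> z = v"
      using act_inj[OF \<sigma> z u(1)] act_inj[OF \<sigma> z v(1)] u(2) v(2) by simp_all
    then show "sh \<sigma> (conf_step \<phi> (x, y) \<eta>) z = conf_step \<phi> (u, v) (sh \<sigma> \<eta>) z"
      using z u v by (simp add: shift_config_def conf_step_def)
  qed
  then have "(sh \<sigma> (fst t), sh \<sigma> (snd t)) = (sh \<sigma> \<eta>, conf_step \<phi> (u, v) (sh \<sigma> \<eta>))" by (simp add: t)
  then show ?thesis unfolding T_iff using uv sh_C[OF \<sigma> \<eta>] by blast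
qed

lemma xi_sum_sh:
  assumes \<sigma>: "\<sigma> \<in> carrier G" and \<xi>: "\<xi> \<in> consv b \<phi>" and \<eta>: "\<eta> \<in> C"
  shows "xi_sum \<xi> V (sh \<sigma> \<eta>) = xi_sum \<xi> V \<eta>"
proof -
  have supp: "xi_sum \<xi> V \<theta> = (\<Sum>x\<in>supp \<theta>. \<xi> (\<theta> x))" if "\<theta> \<in> C" for \<theta>
    by (rule xi_sum_fin[OF \<xi>]) (use finite_supp[OF that] in \<open>auto simp: supp_def\<close>)
  have "xi_sum \<xi> V (sh \<sigma> \<eta>) = (\<Sum>x\<in>supp (sh \<sigma> \<eta>). \<xi> (\<eta> (act \<sigma> x)))"
    unfolding supp[OF sh_C[OF \<sigma> \<eta>]] by (rule sum.cong) (auto simp: shift_config_def supp_def)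
  also have "\<dots> = (\<Sum>y\<in>supp \<eta>. \<xi> (\<eta> y))" by (rule sum.reindex_bij_betw[OF bij_supp_sh[OF \<sigma>]])
  finally show ?thesis using supp[OF \<eta>] by simp
qed

lemma xi_sum_single:
  assumes "x \<in> V" "\<xi> \<in> consv b \<phi>" shows "xi_sum \<xi> V (single x s) = \<xi> s"
  using xi_sum_Q[OF assms(2) single_C] Q_single[OF assms(1)] assms(2) by (simp add: charge_def)

lemma consv_eqI:
  assumes "\<xi> \<in> consv b \<phi>" "\<xi>' \<in> consv b \<phi>" "\<And>\<eta>. \<eta> \<in> C \<Longrightarrow> xi_sum \<xi> V \<eta> = xi_sum \<xi>' V \<eta>"
  shows "\<xi> = \<xi>'"
proof
  fix s
  show "\<xi> s = \<xi>' s"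
    using assms(3)[OF single_C, of origin s] xi_sum_single[OF origin_V assms(1)] xi_sum_single[OF origin_V assms(2)] by simp
qed

lemma shift_fun_unif:
  assumes \<sigma>: "\<sigma> \<in> carrier G" and f: "f \<in> unif_funs0 V E b"
  shows "shift_fun V b act \<sigma> f \<in> unif_funs0 V E b"
proof -
  obtain R where R: "fin_range R f" using f unif_funs0_iff by blast
  have val: "shift_fun V b act \<sigma> f \<eta> = f (sh \<sigma> \<eta>)" if "\<eta> \<in> C" for \<eta>
    using that by (simp add: shift_fun_def)
  have keep_sh: "sh \<sigma> (keep (- act \<sigma> ` B) \<eta>) = keep (- B) (sh \<sigma> \<eta>)" if "B \<subseteq> V" for B \<eta>
  proof
    fix x
    show "sh \<sigma> (keep (- act \<sigma> ` B) \<eta>) x = keep (- B) (sh \<sigma> \<eta>) x"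
    proof (cases "x \<in> V")
      case True
      have "act \<sigma> x \<in> act \<sigma> ` B \<longleftrightarrow> x \<in> B" using act_inj[OF \<sigma> True] that by blast
      then show ?thesis using True act_V[OF \<sigma>] by (simp add: shift_config_def keep_def)
    qed (simp add: shift_config_def keep_def)
  qed
  have "fin_range R (\<lambda>\<eta>. f (sh \<sigma> \<eta>))"
    unfolding fin_range_def
  proof (intro ballI impI)
    fix \<eta> x y assume \<eta>: "\<eta> \<in> C" and xy: "x \<in> V" "y \<in> V" and far: "R < d x y"
    obtain u where u: "u \<in> V" "act \<sigma> u = x" by (rule act_surj[OF \<sigma> xy(1)])
    obtain v where v: "v \<in> V" "act \<sigma> v = y" by (rule act_surj[OF \<sigma> xy(2)])
    have "R < d u v" using far act_d[OF \<sigma> u(1) v(1)] u(2) v(2) by simp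
    then have "f (sh \<sigma> \<eta>) - f (keep (- {u}) (sh \<sigma> \<eta>)) = f (keep (- {v}) (sh \<sigma> \<eta>)) - f (keep (- {u, v}) (sh \<sigma> \<eta>))"
      using R sh_C[OF \<sigma> \<eta>] u(1) v(1) unfolding fin_range_def by blast
    then show "f (sh \<sigma> \<eta>) - f (sh \<sigma> (keep (- {x}) \<eta>)) = f (sh \<sigma> (keep (- {y}) \<eta>)) - f (sh \<sigma> (keep (- {x, y}) \<eta>))"
      using keep_sh[of "{u}" \<eta>] keep_sh[of "{v}" \<eta>] keep_sh[of "{u, v}" \<eta>] u v by simp
  qed
  then have "fin_range R (shift_fun V b act \<sigma> f)" using fin_range_cong[OF val] by simp
  moreover have "shift_fun V b act \<sigma> f (base_config V b) = 0"
    using val[OF base_C] sh_base[OF \<sigma>] f unfolding unif_funs0_iff by simp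
  ultimately show ?thesis unfolding unif_funs0_iff by (auto simp: shift_fun_def)
qed

lemma boundary_shift:
  assumes \<sigma>: "\<sigma> \<in> carrier G"
  shows "boundary V E b \<phi> (shift_fun V b act \<sigma> f) = shift_form V E b \<phi> act \<sigma> (boundary V E b \<phi> f)"
proof (rule extensionalityI[OF boundary_ext])
  show "shift_form V E b \<phi> act \<sigma> (boundary V E b \<phi> f) \<in> extensional T" by (simp add: shift_form_def)
  fix t assume t: "t \<in> T"
  show "boundary V E b \<phi> (shift_fun V b act \<sigma> f) t = shift_form V E b \<phi> act \<sigma> (boundary V E b \<phi> f) t"
    using t T_C[OF t] sh_T[OF \<sigma> t] by (simp add: boundary_apply shift_fun_def shift_form_def)
qed

lemma xi_boundary_zero:
  assumes "\<xi> \<in> consv b \<phi>" "t \<in> T" shows "xi_sum \<xi> V (snd t) = xi_sum \<xi> V (fst t)"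
proof -
  obtain \<eta> e where e: "\<eta> \<in> C" "e \<in> E" "t = (\<eta>, conf_step \<phi> e \<eta>)" using assms(2) unfolding T_iff by blast
  then show ?thesis
    using xi_sum_Q[OF assms(1)] conf_step_C[OF e(2,1)] Q_conf_step[OF e(2,1)] by simp
qed

lemma connecting_unique:
  assumes "connecting_at V b \<phi> act f \<sigma> \<xi>" "connecting_at V b \<phi> act f \<sigma> \<xi>'" shows "\<xi> = \<xi>'"
  by (rule consv_eqI) (use assms in \<open>auto simp: connecting_at_def\<close>)

text \<open>The difference between \<open>f\<close> and its shift has boundary zero.\<close>

lemma connecting_exists:
  assumes f: "f \<in> unif_funs0 V E b" and inv: "shift_form V E b \<phi> act \<sigma> (boundary V E b \<phi> f) = boundary V E b \<phi> f"
    and \<sigma>: "\<sigma> \<in> carrier G"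
  shows "\<exists>\<xi>. connecting_at V b \<phi> act f \<sigma> \<xi>"
proof -
  define g where "g = (\<lambda>\<eta>\<in>C. 1 * f \<eta> + (- 1) * shift_fun V b act \<sigma> f \<eta>)"
  have g: "g \<in> unif_funs0 V E b" unfolding g_def by (rule unif_funs0_lincomb[OF f shift_fun_unif[OF \<sigma> f]])
  have "g (snd t) = g (fst t)" if t: "t \<in> T" for t
  proof -
    have "boundary V E b \<phi> (shift_fun V b act \<sigma> f) t = boundary V E b \<phi> f t" using boundary_shift[OF \<sigma>] inv by simp
    then show ?thesis using t T_C[OF t] by (simp add: boundary_apply g_def)
  qed
  then obtain \<xi> where \<xi>: "\<xi> \<in> consv b \<phi>" "\<forall>\<eta>\<in>C. xi_sum \<xi> V \<eta> = g \<eta>" using boundary_kernel[OF g] by blast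
  have "connecting_at V b \<phi> act f \<sigma> \<xi>"
    unfolding connecting_at_def using \<xi> by (simp add: g_def)
  then show ?thesis by (rule exI[of _ \<xi>])
qed

text \<open>Two uniform functions with the same boundary differ by a conserved quantity, whose total is
  invariant under the action.\<close>

lemma connecting_independent:
  assumes f: "f \<in> unif_funs0 V E b" "f' \<in> unif_funs0 V E b" "boundary V E b \<phi> f = boundary V E b \<phi> f'"
    and \<sigma>: "\<sigma> \<in> carrier G" and \<xi>: "connecting_at V b \<phi> act f \<sigma> \<xi>"
  shows "connecting_at V b \<phi> act f' \<sigma> \<xi>"
proof -
  define g where "g = (\<lambda>\<eta>\<in>C. 1 * f \<eta> + (- 1) * f' \<eta>)"
  have g: "g \<in> unif_funs0 V E b" unfolding g_def by (rule unif_funs0_lincomb[OF f(1,2)])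
  have "g (snd t) = g (fst t)" if t: "t \<in> T" for t
    using fun_cong[OF f(3), of t] t T_C[OF t] by (simp add: boundary_apply g_def)
  then obtain \<zeta> where \<zeta>: "\<zeta> \<in> consv b \<phi>" "\<forall>\<eta>\<in>C. xi_sum \<zeta> V \<eta> = g \<eta>" using boundary_kernel[OF g] by blast
  have "f' \<eta> - shift_fun V b act \<sigma> f' \<eta> = f \<eta> - shift_fun V b act \<sigma> f \<eta>" if \<eta>: "\<eta> \<in> C" for \<eta>
  proof -
    have "g (sh \<sigma> \<eta>) = g \<eta>" using \<zeta> xi_sum_sh[OF \<sigma> \<zeta>(1) \<eta>] sh_C[OF \<sigma> \<eta>] \<eta> by simp
    then show ?thesis using \<eta> sh_C[OF \<sigma> \<eta>] by (simp add: g_def shift_fun_def)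
  qed
  then show ?thesis using \<xi> unfolding connecting_at_def by simp
qed

abbreviation \<delta> where "\<delta> \<equiv> connecting_map V E b \<phi> G act"

abbreviation \<Omega> where "\<Omega> \<equiv> inv_closed_forms V E b \<phi> G act"

lemma inv_form_exact: assumes "\<omega> \<in> \<Omega>" shows "\<exists>f\<in>unif_funs0 V E b. boundary V E b \<phi> f = \<omega>"
  using uniform_closed_form_exact[OF hyp] assms unfolding inv_closed_forms_def by blast

lemma \<delta>_connecting:
  assumes \<omega>: "\<omega> \<in> \<Omega>" and f: "f \<in> unif_funs0 V E b" "boundary V E b \<phi> f = \<omega>" and \<sigma>: "\<sigma> \<in> carrier G"
  shows "connecting_at V b \<phi> act f \<sigma> (\<delta> \<omega> \<sigma>)"
proof -
  define f' where "f' = (SOME f. f \<in> unif_funs0 V E b \<and> boundary V E b \<phi> f = \<omega>)"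
  have f': "f' \<in> unif_funs0 V E b \<and> boundary V E b \<phi> f' = \<omega>"
    unfolding f'_def by (rule someI[of _ f]) (use f in simp)
  have "shift_form V E b \<phi> act \<sigma> \<omega> = \<omega>" using \<omega> \<sigma> unfolding inv_closed_forms_def by blast
  then have "shift_form V E b \<phi> act \<sigma> (boundary V E b \<phi> f') = boundary V E b \<phi> f'" using f' by simp
  from connecting_exists[OF conjunct1[OF f'] this \<sigma>]
  obtain \<xi> where \<xi>: "connecting_at V b \<phi> act f' \<sigma> \<xi>" by (rule exE)
  have "\<delta> \<omega> \<sigma> = (THE \<xi>. connecting_at V b \<phi> act f' \<sigma> \<xi>)"
    using \<sigma> by (simp add: connecting_map_def f'_def)
  also have "\<dots> = \<xi>"
    by (rule the_equality[where P = "connecting_at V b \<phi> act f' \<sigma>", OF \<xi>]) (rule connecting_unique[OF _ \<xi>])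
  finally have "connecting_at V b \<phi> act f' \<sigma> (\<delta> \<omega> \<sigma>)" using \<xi> by simp
  then show ?thesis
    using f' f by (intro connecting_independent[OF _ f(1) _ \<sigma>]) simp_all
qed

lemma \<delta>_eqI:
  assumes "\<omega> \<in> \<Omega>" "f \<in> unif_funs0 V E b" "boundary V E b \<phi> f = \<omega>" "\<sigma> \<in> carrier G"
    and "connecting_at V b \<phi> act f \<sigma> \<xi>"
  shows "\<delta> \<omega> \<sigma> = \<xi>"
  using connecting_unique[OF \<delta>_connecting[OF assms(1-4)] assms(5)] .

lemma \<delta>_ext: "\<delta> \<omega> \<in> extensional (carrier G)"
  by (simp add: connecting_map_def Let_def)

lemma \<delta>_consv: "\<omega> \<in> \<Omega> \<Longrightarrow> \<sigma> \<in> carrier G \<Longrightarrow> \<delta> \<omega> \<sigma> \<in> consv b \<phi>"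
  using \<delta>_connecting inv_form_exact unfolding connecting_at_def by blast

lemma consv_lincomb: "\<xi> \<in> consv b \<phi> \<Longrightarrow> \<xi>' \<in> consv b \<phi> \<Longrightarrow> (\<lambda>s. p * \<xi> s + q * \<xi>' s) \<in> consv b \<phi>"
proof -
  assume *: "\<xi> \<in> consv b \<phi>" "\<xi>' \<in> consv b \<phi>"
  have "p * \<xi> s + q * \<xi>' s + (p * \<xi> t + q * \<xi>' t) =
      p * \<xi> (fst (\<phi> (s, t))) + q * \<xi>' (fst (\<phi> (s, t))) + (p * \<xi> (snd (\<phi> (s, t))) + q * \<xi>' (snd (\<phi> (s, t))))" for s t
  proof -
    have "\<xi> s + \<xi> t = \<xi> (fst (\<phi> (s, t))) + \<xi> (snd (\<phi> (s, t)))"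
      "\<xi>' s + \<xi>' t = \<xi>' (fst (\<phi> (s, t))) + \<xi>' (snd (\<phi> (s, t)))"
      using * unfolding consv_def by blast+
    then have "p * (\<xi> s + \<xi> t) + q * (\<xi>' s + \<xi>' t) =
        p * (\<xi> (fst (\<phi> (s, t))) + \<xi> (snd (\<phi> (s, t)))) + q * (\<xi>' (fst (\<phi> (s, t))) + \<xi>' (snd (\<phi> (s, t))))" by simp
    then show ?thesis by (simp add: distrib_left)
  qed
  then show ?thesis using * unfolding consv_def by simp
qed

lemma xi_sum_lincomb:
  assumes "\<xi> \<in> consv b \<phi>" "\<xi>' \<in> consv b \<phi>" "\<eta> \<in> C"
  shows "xi_sum (\<lambda>s. p * \<xi> s + q * \<xi>' s) V \<eta> = p * xi_sum \<xi> V \<eta> + q * xi_sum \<xi>' V \<eta>"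
proof -
  have supp: "xi_sum \<zeta> V \<eta> = (\<Sum>x\<in>supp \<eta>. \<zeta> (\<eta> x))" if "\<zeta> \<in> consv b \<phi>" for \<zeta>
    by (rule xi_sum_fin[OF that]) (use finite_supp[OF assms(3)] in \<open>auto simp: supp_def\<close>)
  show ?thesis
    using supp[OF consv_lincomb[OF assms(1,2)]] supp[OF assms(1)] supp[OF assms(2)]
    by (simp add: sum.distrib sum_distrib_left)
qed

lemma boundary_lincomb:
  "boundary V E b \<phi> (\<lambda>\<eta>\<in>C. p * f \<eta> + q * g \<eta>) = (\<lambda>t\<in>T. p * boundary V E b \<phi> f t + q * boundary V E b \<phi> g t)"
  unfolding boundary_def using T_C by (intro restrict_ext) (simp add: algebra_simps)

lemma inv_closed_lincomb:
  assumes "\<omega> \<in> \<Omega>" "\<omega>' \<in> \<Omega>" shows "(\<lambda>t\<in>T. p * \<omega> t + q * \<omega>' t) \<in> \<Omega>"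
proof -
  obtain f where f: "f \<in> unif_funs0 V E b" "boundary V E b \<phi> f = \<omega>" using inv_form_exact[OF assms(1)] by blast
  obtain f' where f': "f' \<in> unif_funs0 V E b" "boundary V E b \<phi> f' = \<omega>'" using inv_form_exact[OF assms(2)] by blast
  have "(\<lambda>t\<in>T. p * \<omega> t + q * \<omega>' t) \<in> unif_closed_forms V E b \<phi>"
    using boundary_unif_closed[OF unif_funs0_lincomb[OF f(1) f'(1)], of p q] f(2) f'(2) by (simp add: boundary_lincomb)
  moreover have "shift_form V E b \<phi> act \<sigma> (\<lambda>t\<in>T. p * \<omega> t + q * \<omega>' t) = (\<lambda>t\<in>T. p * \<omega> t + q * \<omega>' t)"
    if \<sigma>: "\<sigma> \<in> carrier G" for \<sigma>
  proof (rule extensionalityI[of _ T])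
    fix t assume t: "t \<in> T"
    have "shift_form V E b \<phi> act \<sigma> \<omega> = \<omega>" "shift_form V E b \<phi> act \<sigma> \<omega>' = \<omega>'"
      using assms \<sigma> unfolding inv_closed_forms_def by blast+
    from fun_cong[OF this(1), of t] fun_cong[OF this(2), of t]
    have "\<omega> (sh \<sigma> (fst t), sh \<sigma> (snd t)) = \<omega> t" "\<omega>' (sh \<sigma> (fst t), sh \<sigma> (snd t)) = \<omega>' t"
      using t by (simp_all add: shift_form_def)
    then show "shift_form V E b \<phi> act \<sigma> (\<lambda>t\<in>T. p * \<omega> t + q * \<omega>' t) t = (\<lambda>t\<in>T. p * \<omega> t + q * \<omega>' t) t"
      using t sh_T[OF \<sigma> t] by (simp add: shift_form_def)
  qed (simp_all add: shift_form_def)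
  ultimately show ?thesis unfolding inv_closed_forms_def by blast
qed

lemma \<delta>_lincomb:
  assumes "\<omega> \<in> \<Omega>" "\<omega>' \<in> \<Omega>" "\<sigma> \<in> carrier G"
  shows "\<delta> (\<lambda>t\<in>T. p * \<omega> t + q * \<omega>' t) \<sigma> = (\<lambda>s. p * \<delta> \<omega> \<sigma> s + q * \<delta> \<omega>' \<sigma> s)"
proof -
  obtain f where f: "f \<in> unif_funs0 V E b" "boundary V E b \<phi> f = \<omega>" using inv_form_exact[OF assms(1)] by blast
  obtain f' where f': "f' \<in> unif_funs0 V E b" "boundary V E b \<phi> f' = \<omega>'" using inv_form_exact[OF assms(2)] by blast
  note c = \<delta>_connecting[OF assms(1) f assms(3)] \<delta>_connecting[OF assms(2) f' assms(3)]
  note \<xi> = \<delta>_consv[OF assms(1,3)] \<delta>_consv[OF assms(2,3)]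
  show ?thesis
  proof (rule \<delta>_eqI[OF inv_closed_lincomb[OF assms(1,2)] unif_funs0_lincomb[OF f(1) f'(1)] _ assms(3)])
    show "boundary V E b \<phi> (\<lambda>\<eta>\<in>C. p * f \<eta> + q * f' \<eta>) = (\<lambda>t\<in>T. p * \<omega> t + q * \<omega>' t)"
      unfolding boundary_lincomb f(2) f'(2) ..
    show "connecting_at V b \<phi> act (\<lambda>\<eta>\<in>C. p * f \<eta> + q * f' \<eta>) \<sigma> (\<lambda>s. p * \<delta> \<omega> \<sigma> s + q * \<delta> \<omega>' \<sigma> s)"
      unfolding connecting_at_def
    proof (intro conjI ballI consv_lincomb \<xi>)
      fix \<eta> assume \<eta>: "\<eta> \<in> C"
      have val: "xi_sum (\<delta> \<omega> \<sigma>) V \<eta> = f \<eta> - f (sh \<sigma> \<eta>)" "xi_sum (\<delta> \<omega>' \<sigma>) V \<eta> = f' \<eta> - f' (sh \<sigma> \<eta>)"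
        using c \<eta> unfolding connecting_at_def shift_fun_def by simp_all
      show "xi_sum (\<lambda>s. p * \<delta> \<omega> \<sigma> s + q * \<delta> \<omega>' \<sigma> s) V \<eta> =
          (\<lambda>\<eta>\<in>C. p * f \<eta> + q * f' \<eta>) \<eta> - shift_fun V b act \<sigma> (\<lambda>\<eta>\<in>C. p * f \<eta> + q * f' \<eta>) \<eta>"
        unfolding xi_sum_lincomb[OF \<xi> \<eta>] val
        using \<eta> sh_C[OF assms(3) \<eta>] by (simp add: shift_fun_def right_diff_distrib)
    qed
  qed
qed

text \<open>With \<open>\<eta>\<close> shifted by \<open>\<sigma>\<close> first, the difference for the product telescopes, and the total of a
  conserved quantity does not see the shift.\<close>

lemma \<delta>_mult:
  assumes \<omega>: "\<omega> \<in> \<Omega>" and \<sigma>: "\<sigma> \<in> carrier G" and \<tau>: "\<tau> \<in> carrier G"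
  shows "\<delta> \<omega> (\<sigma> \<otimes>\<^bsub>G\<^esub> \<tau>) = (\<lambda>s. \<delta> \<omega> \<sigma> s + \<delta> \<omega> \<tau> s)"
proof -
  obtain f where f: "f \<in> unif_funs0 V E b" "boundary V E b \<phi> f = \<omega>" using inv_form_exact[OF \<omega>] by blast
  note \<xi> = \<delta>_consv[OF \<omega> \<sigma>] \<delta>_consv[OF \<omega> \<tau>]
  have val: "xi_sum (\<delta> \<omega> \<rho>) V \<eta> = f \<eta> - f (sh \<rho> \<eta>)" if "\<rho> \<in> carrier G" "\<eta> \<in> C" for \<rho> \<eta>
    using \<delta>_connecting[OF \<omega> f that(1)] that(2) by (simp add: connecting_at_def shift_fun_def)
  show ?thesis
  proof (rule \<delta>_eqI[OF \<omega> f])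
    show "\<sigma> \<otimes>\<^bsub>G\<^esub> \<tau> \<in> carrier G" using \<sigma> \<tau> by simp
    show "connecting_at V b \<phi> act f (\<sigma> \<otimes>\<^bsub>G\<^esub> \<tau>) (\<lambda>s. \<delta> \<omega> \<sigma> s + \<delta> \<omega> \<tau> s)"
      unfolding connecting_at_def
    proof (intro conjI ballI)
      show "(\<lambda>s. \<delta> \<omega> \<sigma> s + \<delta> \<omega> \<tau> s) \<in> consv b \<phi>" using consv_lincomb[OF \<xi>, of 1 1] by simp
      fix \<eta> assume \<eta>: "\<eta> \<in> C"
      note C = sh_C[OF \<sigma> \<eta>]
      have "xi_sum (\<lambda>s. \<delta> \<omega> \<sigma> s + \<delta> \<omega> \<tau> s) V \<eta> = xi_sum (\<delta> \<omega> \<sigma>) V \<eta> + xi_sum (\<delta> \<omega> \<tau>) V (sh \<sigma> \<eta>)"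
        using xi_sum_lincomb[OF \<xi> \<eta>, of 1 1] xi_sum_sh[OF \<sigma> \<xi>(2) \<eta>] by simp
      also have "\<dots> = f \<eta> - f (sh \<tau> (sh \<sigma> \<eta>))" using val[OF \<sigma> \<eta>] val[OF \<tau> C] by simp
      finally show "xi_sum (\<lambda>s. \<delta> \<omega> \<sigma> s + \<delta> \<omega> \<tau> s) V \<eta> = f \<eta> - shift_fun V b act (\<sigma> \<otimes>\<^bsub>G\<^esub> \<tau>) f \<eta>"
        using \<eta> by (simp add: shift_fun_def sh_mult[OF \<sigma> \<tau>])
    qed
  qed
qed

lemma consv_zero: "(\<lambda>s. 0) \<in> consv b \<phi>" by (simp add: consv_def)

lemma xi_sum_zero: "xi_sum (\<lambda>s. 0) V \<eta> = 0" by (simp add: xi_sum_def sum.G_def)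

lemma connecting_zero_iff:
  assumes "f \<in> unif_funs0 V E b" "\<sigma> \<in> carrier G"
  shows "connecting_at V b \<phi> act f \<sigma> (\<lambda>s. 0) \<longleftrightarrow> shift_fun V b act \<sigma> f = f"
proof
  assume c: "connecting_at V b \<phi> act f \<sigma> (\<lambda>s. 0)"
  show "shift_fun V b act \<sigma> f = f"
  proof (rule extensionalityI[of _ C])
    show "f \<in> extensional C" using assms(1) unfolding unif_funs0_iff by (auto simp: PiE_def)
    show "shift_fun V b act \<sigma> f \<in> extensional C" by (simp add: shift_fun_def)
    show "shift_fun V b act \<sigma> f \<eta> = f \<eta>" if "\<eta> \<in> C" for \<eta>
      using c that by (simp add: connecting_at_def xi_sum_zero)
  qed
qed (simp add: connecting_at_def consv_zero xi_sum_zero)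

text \<open>A function that the shifts change only by conserved quantities has an invariant boundary.\<close>

lemma boundary_invariant:
  assumes f: "f \<in> unif_funs0 V E b" and c: "\<And>\<sigma>. \<sigma> \<in> carrier G \<Longrightarrow> connecting_at V b \<phi> act f \<sigma> (\<psi> \<sigma>)"
  shows "boundary V E b \<phi> f \<in> \<Omega>"
proof -
  have "shift_form V E b \<phi> act \<sigma> (boundary V E b \<phi> f) = boundary V E b \<phi> f" if \<sigma>: "\<sigma> \<in> carrier G" for \<sigma>
  proof -
    have "boundary V E b \<phi> (shift_fun V b act \<sigma> f) = boundary V E b \<phi> f"
    proof (rule extensionalityI[OF boundary_ext boundary_ext])
      fix t assume t: "t \<in> T"
      have "xi_sum (\<psi> \<sigma>) V (snd t) = xi_sum (\<psi> \<sigma>) V (fst t)"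
        using xi_boundary_zero[OF _ t] c[OF \<sigma>] unfolding connecting_at_def by blast
      then show "boundary V E b \<phi> (shift_fun V b act \<sigma> f) t = boundary V E b \<phi> f t"
        using c[OF \<sigma>] t T_C[OF t] unfolding connecting_at_def by (simp add: boundary_apply)
    qed
    then show ?thesis using boundary_shift[OF \<sigma>] by simp
  qed
  then show ?thesis using boundary_unif_closed[OF f] unfolding inv_closed_forms_def by blast
qed

text \<open>A potential of an invariant form is itself invariant iff the connecting homomorphism vanishes.\<close>

lemma inv_exact_iff: "\<omega> \<in> inv_exact_forms V E b \<phi> G act \<longleftrightarrow> \<omega> \<in> \<Omega> \<and> (\<forall>\<sigma>\<in>carrier G. \<delta> \<omega> \<sigma> = (\<lambda>s. 0))"
proof
  assume "\<omega> \<in> inv_exact_forms V E b \<phi> G act"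
  then obtain f where f: "f \<in> unif_funs0 V E b" "\<And>\<sigma>. \<sigma> \<in> carrier G \<Longrightarrow> shift_fun V b act \<sigma> f = f" "boundary V E b \<phi> f = \<omega>"
    unfolding inv_exact_forms_def inv_unif_funs0_def by blast
  then have c: "connecting_at V b \<phi> act f \<sigma> (\<lambda>s. 0)" if "\<sigma> \<in> carrier G" for \<sigma>
    using connecting_zero_iff[OF f(1) that] that by simp
  then have "\<omega> \<in> \<Omega>" using boundary_invariant[OF f(1), of "\<lambda>_ _. 0"] f(3) by simp
  then show "\<omega> \<in> \<Omega> \<and> (\<forall>\<sigma>\<in>carrier G. \<delta> \<omega> \<sigma> = (\<lambda>s. 0))" using \<delta>_eqI[OF _ f(1,3)] c by blast
next
  assume \<omega>: "\<omega> \<in> \<Omega> \<and> (\<forall>\<sigma>\<in>carrier G. \<delta> \<omega> \<sigma> = (\<lambda>s. 0))"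
  then obtain f where f: "f \<in> unif_funs0 V E b" "boundary V E b \<phi> f = \<omega>" using inv_form_exact by blast
  have "shift_fun V b act \<sigma> f = f" if "\<sigma> \<in> carrier G" for \<sigma>
    using \<delta>_connecting[OF _ f that] \<omega> that connecting_zero_iff[OF f(1) that] by simp
  then show "\<omega> \<in> inv_exact_forms V E b \<phi> G act"
    unfolding inv_exact_forms_def inv_unif_funs0_def using f by blast
qed

section \<open>The section given by a fundamental domain\<close>

text \<open>A sum over single sites has range 0.\<close>

lemma site_sum_unif:
  assumes "\<And>x. c x b = 0"
  shows "(\<lambda>\<eta>\<in>C. \<Sum>x\<in>supp \<eta>. c x (\<eta> x)) \<in> unif_funs0 V E b"
proof -
  define f where "f \<eta> = (\<Sum>x\<in>supp \<eta>. c x (\<eta> x))" for \<eta>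
  have rem: "f \<eta> - f (keep (- {x}) \<eta>) = c x (\<eta> x)" if "\<eta> \<in> C" "x \<in> V" for \<eta> x
  proof -
    have s: "supp (keep (- {x}) \<eta>) = supp \<eta> - {x}" by (auto simp: supp_keep)
    have "f (keep (- {x}) \<eta>) = (\<Sum>z\<in>supp \<eta> - {x}. c z (\<eta> z))"
      unfolding f_def s by (rule sum.cong) (auto simp: keep_def supp_def)
    moreover have "f \<eta> = (\<Sum>z\<in>supp \<eta> - {x}. c z (\<eta> z)) + c x (\<eta> x)"
    proof (cases "x \<in> supp \<eta>")
      case True
      then show ?thesis
        unfolding f_def using sum.remove[OF finite_supp[OF that(1)], of x "\<lambda>z. c z (\<eta> z)"] by simp
    next
      case False
      then have "\<eta> x = b" using that(2) by (simp add: supp_def)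
      then show ?thesis using False assms by (simp add: f_def)
    qed
    ultimately show ?thesis by simp
  qed
  have "fin_range 0 f"
    unfolding fin_range_def
  proof (intro ballI impI)
    fix \<eta> x y assume *: "\<eta> \<in> C" "x \<in> V" "y \<in> V" "0 < d x y"
    then have ne: "x \<noteq> y" by auto
    have "- {x} \<inter> - {y} = - {x, y}" by blast
    then have "f (keep (- {y}) \<eta>) - f (keep (- {x, y}) \<eta>) = c x (keep (- {y}) \<eta> x)"
      using rem[OF keep_C[OF *(1)] *(2), of "- {y}"] by (simp add: keep_keep)
    also have "\<dots> = c x (\<eta> x)" using ne *(2) by (simp add: keep_def)
    finally show "f \<eta> - f (keep (- {x}) \<eta>) = f (keep (- {y}) \<eta>) - f (keep (- {x, y}) \<eta>)"
      using rem[OF *(1,2)] by simp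
  qed
  then have "fin_range 0 (\<lambda>\<eta>\<in>C. f \<eta>)" by (subst fin_range_cong[of _ f]) simp_all
  then show ?thesis unfolding unif_funs0_iff f_def by (auto simp: base_C supp_base)
qed

context
  fixes \<Lambda>0 assumes fd: "fundamental_domain G V act \<Lambda>0"
begin

text \<open>Existence comes from the orbits being met, uniqueness from their being met once and from freeness.\<close>

lemma translate_unique:
  assumes x: "x \<in> V" shows "\<exists>!\<tau>. \<tau> \<in> carrier G \<and> x \<in> act \<tau> ` \<Lambda>0"
proof -
  have sub: "\<Lambda>0 \<subseteq> V" using fd unfolding fundamental_domain_def by blast
  have uniq: "\<exists>!y. y \<in> \<Lambda>0 \<inter> orbit G act x"
    using fd x unfolding fundamental_domain_def orbits_def by blast
  then obtain y where y: "y \<in> \<Lambda>0" "y \<in> orbit G act x" by blast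
  then obtain g where g: "g \<in> carrier G" "act g x = y" unfolding orbit_def by blast
  have "act (inv\<^bsub>G\<^esub> g) y = x" by (rule A.orbit_sym_aux[OF g(1) x g(2)])
  then have ex: "inv\<^bsub>G\<^esub> g \<in> carrier G" "x \<in> act (inv\<^bsub>G\<^esub> g) ` \<Lambda>0" using g(1) y(1) by auto
  have orb: "z \<in> orbit G act x" if "\<tau> \<in> carrier G" "z \<in> \<Lambda>0" "x = act \<tau> z" for \<tau> z
    using A.orbit_sym_aux[OF that(1) _ that(3)[symmetric]] sub that(1,2) unfolding orbit_def by force
  show ?thesis
  proof (rule ex1I[of _ "inv\<^bsub>G\<^esub> g"])
    fix \<tau> assume \<tau>: "\<tau> \<in> carrier G \<and> x \<in> act \<tau> ` \<Lambda>0"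
    then obtain z where z: "z \<in> \<Lambda>0" "x = act \<tau> z" by blast
    obtain w where w: "w \<in> \<Lambda>0" "x = act (inv\<^bsub>G\<^esub> g) w" using ex(2) by blast
    have "z = w" using uniq orb[of \<tau> z] orb[of "inv\<^bsub>G\<^esub> g" w] \<tau> z w ex(1) by blast
    then show "\<tau> = inv\<^bsub>G\<^esub> g"
      using free z w \<tau> ex(1) sub unfolding free_action_def by blast
  qed (use ex in blast)
qed

definition tile where "tile x = (THE \<tau>. \<tau> \<in> carrier G \<and> x \<in> act \<tau> ` \<Lambda>0)"

lemma tile: "x \<in> V \<Longrightarrow> tile x \<in> carrier G" "x \<in> V \<Longrightarrow> x \<in> act (tile x) ` \<Lambda>0"
  using theI'[OF translate_unique] unfolding tile_def by blast+

lemma tile_eqI: "x \<in> V \<Longrightarrow> \<tau> \<in> carrier G \<Longrightarrow> x \<in> act \<tau> ` \<Lambda>0 \<Longrightarrow> tile x = \<tau>"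
  using translate_unique[of x] tile by blast

lemma tile_act:
  assumes \<sigma>: "\<sigma> \<in> carrier G" and x: "x \<in> V" shows "tile (act \<sigma> x) = \<sigma> \<otimes>\<^bsub>G\<^esub> tile x"
proof (rule tile_eqI[OF act_V[OF \<sigma> x]])
  show "\<sigma> \<otimes>\<^bsub>G\<^esub> tile x \<in> carrier G" using \<sigma> tile(1)[OF x] by simp
  obtain z where z: "z \<in> \<Lambda>0" "x = act (tile x) z" using tile(2)[OF x] by blast
  have "z \<in> V" using z(1) fd unfolding fundamental_domain_def by blast
  then have "act \<sigma> x = act (\<sigma> \<otimes>\<^bsub>G\<^esub> tile x) z" using act_mult[OF \<sigma> tile(1)[OF x]] z(2) by simp
  then show "act \<sigma> x \<in> act (\<sigma> \<otimes>\<^bsub>G\<^esub> tile x) ` \<Lambda>0" using z(1) by blast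
qed

definition tile_sum where "tile_sum \<psi> = (\<lambda>\<eta>\<in>C. \<Sum>x\<in>supp \<eta>. \<psi> (tile x) (\<eta> x))"

lemma tile_sum_eq:
  assumes \<psi>: "\<And>\<tau>. \<tau> \<in> carrier G \<Longrightarrow> \<psi> \<tau> \<in> consv b \<phi>"
  shows "(\<lambda>\<eta>\<in>C. sum' (\<lambda>\<tau>. xi_sum (\<psi> \<tau>) (act \<tau> ` \<Lambda>0) \<eta>) (carrier G)) = tile_sum \<psi>"
  unfolding tile_sum_def
proof (rule restrict_ext)
  fix \<eta> assume \<eta>: "\<eta> \<in> C"
  have sub: "act \<tau> ` \<Lambda>0 \<subseteq> V" if "\<tau> \<in> carrier G" for \<tau>
    using fd act_V[OF that] unfolding fundamental_domain_def by blast
  have part: "{x \<in> act \<tau> ` \<Lambda>0. \<eta> x \<noteq> b} = {x \<in> supp \<eta>. tile x = \<tau>}" if \<tau>: "\<tau> \<in> carrier G" for \<tau>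
    using sub[OF \<tau>] tile_eqI[OF _ \<tau>] tile(2) unfolding supp_def by blast
  have xi: "xi_sum (\<psi> \<tau>) (act \<tau> ` \<Lambda>0) \<eta> = (\<Sum>x\<in>{x \<in> supp \<eta>. tile x = \<tau>}. \<psi> (tile x) (\<eta> x))"
    if \<tau>: "\<tau> \<in> carrier G" for \<tau>
  proof -
    have fin: "finite {x \<in> supp \<eta>. tile x = \<tau>}" using finite_supp[OF \<eta>] by simp
    have "xi_sum (\<psi> \<tau>) (act \<tau> ` \<Lambda>0) \<eta> = (\<Sum>x\<in>{x \<in> supp \<eta>. tile x = \<tau>}. \<psi> \<tau> (\<eta> x))"
      by (rule xi_sum_fin[OF \<psi>[OF \<tau>]]) (use part[OF \<tau>] fin in auto)
    also have "\<dots> = (\<Sum>x\<in>{x \<in> supp \<eta>. tile x = \<tau>}. \<psi> (tile x) (\<eta> x))" by (rule sum.cong) simp_all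
    finally show ?thesis .
  qed
  have tG: "tile ` supp \<eta> \<subseteq> carrier G" using tile(1) supp_V by blast
  have "sum' (\<lambda>\<tau>. xi_sum (\<psi> \<tau>) (act \<tau> ` \<Lambda>0) \<eta>) (carrier G) =
      sum' (\<lambda>\<tau>. xi_sum (\<psi> \<tau>) (act \<tau> ` \<Lambda>0) \<eta>) (tile ` supp \<eta>)"
  proof (rule sum.mono_neutral_right'[OF tG], intro ballI)
    fix \<tau> assume \<tau>: "\<tau> \<in> carrier G - tile ` supp \<eta>"
    then have "{x \<in> supp \<eta>. tile x = \<tau>} = {}" by blast
    with xi[OF DiffD1[OF \<tau>]] show "xi_sum (\<psi> \<tau>) (act \<tau> ` \<Lambda>0) \<eta> = 0" by (simp only: sum.empty)
  qed
  also have "\<dots> = (\<Sum>\<tau>\<in>tile ` supp \<eta>. xi_sum (\<psi> \<tau>) (act \<tau> ` \<Lambda>0) \<eta>)" using finite_supp[OF \<eta>] by simp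
  also have "\<dots> = (\<Sum>\<tau>\<in>tile ` supp \<eta>. \<Sum>x\<in>{x \<in> supp \<eta>. tile x = \<tau>}. \<psi> (tile x) (\<eta> x))"
    by (rule sum.cong) (use xi tG in auto)
  also have "\<dots> = (\<Sum>x\<in>supp \<eta>. \<psi> (tile x) (\<eta> x))"
    by (rule sum.image_gen[OF finite_supp[OF \<eta>], symmetric])
  finally show "sum' (\<lambda>\<tau>. xi_sum (\<psi> \<tau>) (act \<tau> ` \<Lambda>0) \<eta>) (carrier G) = (\<Sum>x\<in>supp \<eta>. \<psi> (tile x) (\<eta> x))" .
qed

lemma tile_sum_unif:
  assumes \<psi>: "\<And>\<tau>. \<tau> \<in> carrier G \<Longrightarrow> \<psi> \<tau> \<in> consv b \<phi>"
  shows "tile_sum \<psi> \<in> unif_funs0 V E b"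
proof -
  define c where "c x = (if x \<in> V then \<psi> (tile x) else (\<lambda>s. 0))" for x
  have "c x b = 0" for x
  proof (cases "x \<in> V")
    case True
    then show ?thesis using \<psi>[OF tile(1)[OF True]] by (simp add: c_def consv_def)
  qed (simp add: c_def)
  then have "(\<lambda>\<eta>\<in>C. \<Sum>x\<in>supp \<eta>. c x (\<eta> x)) \<in> unif_funs0 V E b" by (rule site_sum_unif)
  moreover have "tile_sum \<psi> = (\<lambda>\<eta>\<in>C. \<Sum>x\<in>supp \<eta>. c x (\<eta> x))"
    unfolding tile_sum_def
  proof (intro restrict_ext sum.cong refl)
    fix \<eta> x assume "x \<in> supp \<eta>"
    then have "x \<in> V" using supp_V by blast
    then show "\<psi> (tile x) (\<eta> x) = c x (\<eta> x)" by (simp add: c_def)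
  qed
  ultimately show ?thesis by simp
qed

text \<open>Shifting by \<open>\<sigma>\<close> relabels the tiles by left multiplication, which changes the value of the
  homomorphism \<open>\<psi>\<close> on every tile by \<open>\<psi> \<sigma>\<close>.\<close>

lemma tile_sum_connecting:
  assumes \<psi>: "\<And>\<tau>. \<tau> \<in> carrier G \<Longrightarrow> \<psi> \<tau> \<in> consv b \<phi>"
    and hom: "\<And>\<sigma> \<tau> s. \<sigma> \<in> carrier G \<Longrightarrow> \<tau> \<in> carrier G \<Longrightarrow> \<psi> (\<sigma> \<otimes>\<^bsub>G\<^esub> \<tau>) s = \<psi> \<sigma> s + \<psi> \<tau> s"
    and \<sigma>: "\<sigma> \<in> carrier G"
  shows "connecting_at V b \<phi> act (tile_sum \<psi>) \<sigma> (\<psi> \<sigma>)"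
  unfolding connecting_at_def
proof (intro conjI ballI \<psi>[OF \<sigma>])
  fix \<eta> assume \<eta>: "\<eta> \<in> C"
  let ?S = "supp (sh \<sigma> \<eta>)"
  have "tile_sum \<psi> \<eta> = (\<Sum>x\<in>?S. \<psi> (tile (act \<sigma> x)) (\<eta> (act \<sigma> x)))"
    using \<eta> sum.reindex_bij_betw[OF bij_supp_sh[OF \<sigma>], of "\<lambda>y. \<psi> (tile y) (\<eta> y)" \<eta>] by (simp add: tile_sum_def)
  also have "\<dots> = (\<Sum>x\<in>?S. \<psi> \<sigma> (\<eta> (act \<sigma> x)) + \<psi> (tile x) (sh \<sigma> \<eta> x))"
  proof (rule sum.cong)
    fix x assume "x \<in> ?S"
    then have x: "x \<in> V" using supp_V by blast
    then show "\<psi> (tile (act \<sigma> x)) (\<eta> (act \<sigma> x)) = \<psi> \<sigma> (\<eta> (act \<sigma> x)) + \<psi> (tile x) (sh \<sigma> \<eta> x)"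
      using tile_act[OF \<sigma> x] hom[OF \<sigma> tile(1)[OF x]] by (simp add: shift_config_def)
  qed simp
  also have "\<dots> = (\<Sum>x\<in>?S. \<psi> \<sigma> (\<eta> (act \<sigma> x))) + tile_sum \<psi> (sh \<sigma> \<eta>)"
    using sh_C[OF \<sigma> \<eta>] by (simp add: sum.distrib tile_sum_def)
  also have "(\<Sum>x\<in>?S. \<psi> \<sigma> (\<eta> (act \<sigma> x))) = (\<Sum>y\<in>supp \<eta>. \<psi> \<sigma> (\<eta> y))"
    by (rule sum.reindex_bij_betw[OF bij_supp_sh[OF \<sigma>]])
  also have "\<dots> = xi_sum (\<psi> \<sigma>) V \<eta>"
    by (rule xi_sum_fin[OF \<psi>[OF \<sigma>], symmetric]) (use finite_supp[OF \<eta>] in \<open>auto simp: supp_def\<close>)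
  finally show "xi_sum (\<psi> \<sigma>) V \<eta> = tile_sum \<psi> \<eta> - shift_fun V b act \<sigma> (tile_sum \<psi>) \<eta>"
    using \<eta> by (simp add: shift_fun_def)
qed

lemma section_map_eq:
  assumes "\<And>\<tau>. \<tau> \<in> carrier G \<Longrightarrow> \<psi> \<tau> \<in> consv b \<phi>"
  shows "section_map V E b \<phi> G act \<Lambda>0 \<psi> = boundary V E b \<phi> (tile_sum \<psi>)"
  unfolding section_map_def by (rule arg_cong[OF tile_sum_eq[OF assms]])

end

end

section \<open>Linear algebra with explicit carriers\<close>

lemma real_ring_simps [simp]:
  "carrier real_ring = UNIV" "p \<otimes>\<^bsub>real_ring\<^esub> q = p * q" "\<one>\<^bsub>real_ring\<^esub> = 1"
  "\<zero>\<^bsub>real_ring\<^esub> = 0" "p \<oplus>\<^bsub>real_ring\<^esub> q = p + q"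
  by (simp_all add: real_ring_def)

lemma cring_real_ring: "cring real_ring"
proof (rule cringI)
  show "abelian_group real_ring"
    by (rule abelian_groupI) (auto intro: exI[of _ "- x" for x])
  show "Group.comm_monoid real_ring"
    by (rule comm_monoidI) (auto simp: mult.commute mult.assoc)
qed (auto simp: distrib_right)

lemma real_module_iff:
  "Module.module real_ring M \<longleftrightarrow> abelian_group M \<and>
     (\<forall>p. \<forall>x\<in>carrier M. p \<odot>\<^bsub>M\<^esub> x \<in> carrier M) \<and>
     (\<forall>p q. \<forall>x\<in>carrier M. (p + q) \<odot>\<^bsub>M\<^esub> x = p \<odot>\<^bsub>M\<^esub> x \<oplus>\<^bsub>M\<^esub> q \<odot>\<^bsub>M\<^esub> x) \<and>
     (\<forall>p. \<forall>x\<in>carrier M. \<forall>y\<in>carrier M. p \<odot>\<^bsub>M\<^esub> (x \<oplus>\<^bsub>M\<^esub> y) = p \<odot>\<^bsub>M\<^esub> x \<oplus>\<^bsub>M\<^esub> p \<odot>\<^bsub>M\<^esub> y) \<and>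
     (\<forall>p q. \<forall>x\<in>carrier M. (p * q) \<odot>\<^bsub>M\<^esub> x = p \<odot>\<^bsub>M\<^esub> (q \<odot>\<^bsub>M\<^esub> x)) \<and>
     (\<forall>x\<in>carrier M. 1 \<odot>\<^bsub>M\<^esub> x = x)"
  using cring_real_ring by (auto simp: Module.module_def module_axioms_def)

lemma real_moduleI:
  assumes "\<And>x y. x \<in> carrier M \<Longrightarrow> y \<in> carrier M \<Longrightarrow> x \<oplus>\<^bsub>M\<^esub> y \<in> carrier M" "\<zero>\<^bsub>M\<^esub> \<in> carrier M"
    "\<And>x y z. x \<in> carrier M \<Longrightarrow> y \<in> carrier M \<Longrightarrow> z \<in> carrier M \<Longrightarrow> (x \<oplus>\<^bsub>M\<^esub> y) \<oplus>\<^bsub>M\<^esub> z = x \<oplus>\<^bsub>M\<^esub> (y \<oplus>\<^bsub>M\<^esub> z)"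
    "\<And>x y. x \<in> carrier M \<Longrightarrow> y \<in> carrier M \<Longrightarrow> x \<oplus>\<^bsub>M\<^esub> y = y \<oplus>\<^bsub>M\<^esub> x"
    "\<And>x. x \<in> carrier M \<Longrightarrow> \<zero>\<^bsub>M\<^esub> \<oplus>\<^bsub>M\<^esub> x = x"
    "\<And>x. x \<in> carrier M \<Longrightarrow> (-1) \<odot>\<^bsub>M\<^esub> x \<oplus>\<^bsub>M\<^esub> x = \<zero>\<^bsub>M\<^esub>"
    "\<And>p x. x \<in> carrier M \<Longrightarrow> p \<odot>\<^bsub>M\<^esub> x \<in> carrier M"
    "\<And>p q x. x \<in> carrier M \<Longrightarrow> (p + q) \<odot>\<^bsub>M\<^esub> x = p \<odot>\<^bsub>M\<^esub> x \<oplus>\<^bsub>M\<^esub> q \<odot>\<^bsub>M\<^esub> x"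
    "\<And>p x y. x \<in> carrier M \<Longrightarrow> y \<in> carrier M \<Longrightarrow> p \<odot>\<^bsub>M\<^esub> (x \<oplus>\<^bsub>M\<^esub> y) = p \<odot>\<^bsub>M\<^esub> x \<oplus>\<^bsub>M\<^esub> p \<odot>\<^bsub>M\<^esub> y"
    "\<And>p q x. x \<in> carrier M \<Longrightarrow> (p * q) \<odot>\<^bsub>M\<^esub> x = p \<odot>\<^bsub>M\<^esub> (q \<odot>\<^bsub>M\<^esub> x)"
    "\<And>x. x \<in> carrier M \<Longrightarrow> 1 \<odot>\<^bsub>M\<^esub> x = x"
  shows "Module.module real_ring M"
proof -
  have "abelian_group M"
  proof (rule abelian_groupI)
    fix x assume "x \<in> carrier M"
    then show "\<exists>y\<in>carrier M. y \<oplus>\<^bsub>M\<^esub> x = \<zero>\<^bsub>M\<^esub>" using assms(6,7) by blast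
  qed (fact assms(1-5))+
  then show ?thesis unfolding real_module_iff using assms(7-11) by simp
qed

lemma real_moduleD:
  assumes "Module.module real_ring M"
  shows "abelian_group M" "\<And>p x. x \<in> carrier M \<Longrightarrow> p \<odot>\<^bsub>M\<^esub> x \<in> carrier M"
    "\<And>p q x. x \<in> carrier M \<Longrightarrow> (p + q) \<odot>\<^bsub>M\<^esub> x = p \<odot>\<^bsub>M\<^esub> x \<oplus>\<^bsub>M\<^esub> q \<odot>\<^bsub>M\<^esub> x"
    "\<And>p x y. x \<in> carrier M \<Longrightarrow> y \<in> carrier M \<Longrightarrow> p \<odot>\<^bsub>M\<^esub> (x \<oplus>\<^bsub>M\<^esub> y) = p \<odot>\<^bsub>M\<^esub> x \<oplus>\<^bsub>M\<^esub> p \<odot>\<^bsub>M\<^esub> y"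
    "\<And>p q x. x \<in> carrier M \<Longrightarrow> (p * q) \<odot>\<^bsub>M\<^esub> x = p \<odot>\<^bsub>M\<^esub> (q \<odot>\<^bsub>M\<^esub> x)"
    "\<And>x. x \<in> carrier M \<Longrightarrow> 1 \<odot>\<^bsub>M\<^esub> x = x"
  using assms unfolding real_module_iff by blast+

lemma real_module_zero_smult:
  assumes "Module.module real_ring M" "x \<in> carrier M"
  shows "0 \<odot>\<^bsub>M\<^esub> x = \<zero>\<^bsub>M\<^esub>" "(-1) \<odot>\<^bsub>M\<^esub> x \<oplus>\<^bsub>M\<^esub> x = \<zero>\<^bsub>M\<^esub>" "\<ominus>\<^bsub>M\<^esub> x = (-1) \<odot>\<^bsub>M\<^esub> x"
    "x \<oplus>\<^bsub>M\<^esub> (-1) \<odot>\<^bsub>M\<^esub> x = \<zero>\<^bsub>M\<^esub>"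
proof -
  interpret abelian_group M by (rule real_moduleD(1)[OF assms(1)])
  note m = real_moduleD[OF assms(1)]
  have c: "p \<odot>\<^bsub>M\<^esub> x \<in> carrier M" for p using m(2) assms(2) by simp
  have "0 \<odot>\<^bsub>M\<^esub> x \<oplus>\<^bsub>M\<^esub> 0 \<odot>\<^bsub>M\<^esub> x = 0 \<odot>\<^bsub>M\<^esub> x" using m(3)[OF assms(2), of 0 0] by simp
  then show zero: "0 \<odot>\<^bsub>M\<^esub> x = \<zero>\<^bsub>M\<^esub>" using c by (simp add: add.r_cancel_one')
  show neg: "(-1) \<odot>\<^bsub>M\<^esub> x \<oplus>\<^bsub>M\<^esub> x = \<zero>\<^bsub>M\<^esub>"
    using m(3)[OF assms(2), of "-1" 1] m(6)[OF assms(2)] zero by simp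
  show "\<ominus>\<^bsub>M\<^esub> x = (-1) \<odot>\<^bsub>M\<^esub> x" by (rule minus_equality[OF neg assms(2) c])
  show "x \<oplus>\<^bsub>M\<^esub> (-1) \<odot>\<^bsub>M\<^esub> x = \<zero>\<^bsub>M\<^esub>" using neg c assms(2) by (simp add: a_comm)
qed

lemma module_fun_subspace:
  assumes sub: "H \<subseteq> A \<rightarrow>\<^sub>E UNIV" and ne: "H \<noteq> {}"
    and lin: "\<And>f g p q. f \<in> H \<Longrightarrow> g \<in> H \<Longrightarrow> (\<lambda>a\<in>A. p * f a + q * g a) \<in> H"
  shows "Module.module real_ring ((fun_space A)\<lparr>carrier := H\<rparr>)"
proof -
  have ext: "f a = undefined" if "f \<in> H" "a \<notin> A" for f a using sub that by (auto simp: PiE_def extensional_def)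
  have add: "(\<lambda>a\<in>A. f a + g a) \<in> H" if "f \<in> H" "g \<in> H" for f g using lin[OF that, of 1 1] by simp
  have smult: "(\<lambda>a\<in>A. p * f a) \<in> H" if "f \<in> H" for f p using lin[OF that that, of p 0] by simp
  have zero: "(\<lambda>a\<in>A. 0) \<in> H" using ne lin[of _ _ 0 0] by (auto simp: ex_in_conv[symmetric])
  show ?thesis
    by (rule real_moduleI, simp_all add: fun_space_def add smult zero)
      (auto simp: fun_eq_iff restrict_def ext algebra_simps)
qed

text \<open>All axioms are equations, so they can be checked after an injective map that preserves the operations.\<close>

lemma module_transfer:
  assumes N: "Module.module real_ring N" and inj: "inj_on g (carrier M)" and g: "g ` carrier M \<subseteq> carrier N"
    and closed: "\<And>x y. x \<in> carrier M \<Longrightarrow> y \<in> carrier M \<Longrightarrow> x \<oplus>\<^bsub>M\<^esub> y \<in> carrier M" "\<zero>\<^bsub>M\<^esub> \<in> carrier M"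
      "\<And>p x. x \<in> carrier M \<Longrightarrow> p \<odot>\<^bsub>M\<^esub> x \<in> carrier M"
    and pres: "\<And>x y. x \<in> carrier M \<Longrightarrow> y \<in> carrier M \<Longrightarrow> g (x \<oplus>\<^bsub>M\<^esub> y) = g x \<oplus>\<^bsub>N\<^esub> g y" "g \<zero>\<^bsub>M\<^esub> = \<zero>\<^bsub>N\<^esub>"
      "\<And>p x. x \<in> carrier M \<Longrightarrow> g (p \<odot>\<^bsub>M\<^esub> x) = p \<odot>\<^bsub>N\<^esub> g x"
  shows "Module.module real_ring M"
proof -
  interpret N: abelian_group N by (rule real_moduleD(1)[OF N])
  note n = real_moduleD[OF N] real_module_zero_smult[OF N]
  have gN: "g x \<in> carrier N" if "x \<in> carrier M" for x using g that by blast
  have eq: "x = y" if "g x = g y" "x \<in> carrier M" "y \<in> carrier M" for x y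
    using inj that by (auto simp: inj_on_def)
  show ?thesis
    by (rule real_moduleI; (intro closed | rule eq); (assumption | intro closed | simp add: closed pres gN n N.a_ac)?)
qed

lemma module_direct_sum:
  assumes "Module.module real_ring M" "Module.module real_ring N"
  shows "Module.module real_ring (direct_sum M N)"
proof -
  interpret M: abelian_group M by (rule real_moduleD(1)[OF assms(1)])
  interpret N: abelian_group N by (rule real_moduleD(1)[OF assms(2)])
  note m = real_moduleD[OF assms(1)] real_module_zero_smult[OF assms(1)]
  note n = real_moduleD[OF assms(2)] real_module_zero_smult[OF assms(2)]
  show ?thesis
    by (rule real_moduleI) (auto simp: direct_sum_def m n M.a_ac N.a_ac)
qed

lemma module_Hom_space:
  assumes "group G" "Module.module real_ring M"
  shows "Module.module real_ring (Hom_space G M)"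
proof -
  interpret G: group G by fact
  interpret M: abelian_group M by (rule real_moduleD(1)[OF assms(2)])
  note m = real_moduleD[OF assms(2)] real_module_zero_smult[OF assms(2)]
  have val: "\<psi> \<sigma> \<in> carrier M" if "\<psi> \<in> hom G (add_monoid M)" "\<sigma> \<in> carrier G" for \<psi> \<sigma>
    using hom_in_carrier[OF that] by simp
  have mult: "\<psi> (\<sigma> \<otimes>\<^bsub>G\<^esub> \<tau>) = \<psi> \<sigma> \<oplus>\<^bsub>M\<^esub> \<psi> \<tau>" if "\<psi> \<in> hom G (add_monoid M)" "\<sigma> \<in> carrier G" "\<tau> \<in> carrier G" for \<psi> \<sigma> \<tau>
    using hom_mult[OF that] by simp
  have ext: "\<psi> \<sigma> = undefined" if "\<psi> \<in> extensional (carrier G)" "\<sigma> \<notin> carrier G" for \<psi> :: "'a \<Rightarrow> 'c" and \<sigma>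
    using that by (simp add: extensional_def)
  have hom: "(\<lambda>\<sigma>\<in>carrier G. p \<odot>\<^bsub>M\<^esub> \<psi> \<sigma> \<oplus>\<^bsub>M\<^esub> q \<odot>\<^bsub>M\<^esub> \<chi> \<sigma>) \<in> hom G (add_monoid M)"
    if "\<psi> \<in> hom G (add_monoid M)" "\<chi> \<in> hom G (add_monoid M)" for \<psi> \<chi> p q
    by (rule homI) (use that in \<open>simp_all add: val mult m M.a_ac\<close>)
  have add: "(\<lambda>\<sigma>\<in>carrier G. \<psi> \<sigma> \<oplus>\<^bsub>M\<^esub> \<chi> \<sigma>) \<in> hom G (add_monoid M)"
    if "\<psi> \<in> hom G (add_monoid M)" "\<chi> \<in> hom G (add_monoid M)" for \<psi> \<chi>
    by (rule homI) (use that in \<open>simp_all add: val mult M.a_ac\<close>)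
  have smult: "(\<lambda>\<sigma>\<in>carrier G. p \<odot>\<^bsub>M\<^esub> \<psi> \<sigma>) \<in> hom G (add_monoid M)" if "\<psi> \<in> hom G (add_monoid M)" for \<psi> p
    by (rule homI) (use that in \<open>simp_all add: val mult m\<close>)
  have zero: "(\<lambda>\<sigma>\<in>carrier G. \<zero>\<^bsub>M\<^esub>) \<in> hom G (add_monoid M)"
    by (rule homI) simp_all
  show ?thesis
  proof (rule real_moduleI)
    fix \<psi> \<chi> \<theta> and p q :: real
    assume \<psi>: "\<psi> \<in> carrier (Hom_space G M)"
    then have v: "\<And>\<sigma>. \<sigma> \<in> carrier G \<Longrightarrow> \<psi> \<sigma> \<in> carrier M" and e: "\<psi> \<in> extensional (carrier G)"
      using val by (simp_all add: Hom_space_def)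
    have restr: "(\<lambda>\<sigma>\<in>carrier G. \<psi> \<sigma>) = \<psi>" by (rule extensional_restrict[OF e])
    show "\<zero>\<^bsub>Hom_space G M\<^esub> \<oplus>\<^bsub>Hom_space G M\<^esub> \<psi> = \<psi>"
    proof -
      have "\<zero>\<^bsub>Hom_space G M\<^esub> \<oplus>\<^bsub>Hom_space G M\<^esub> \<psi> = (\<lambda>\<sigma>\<in>carrier G. \<psi> \<sigma>)"
        unfolding Hom_space_def using v by (simp cong: restrict_cong)
      then show ?thesis using restr by simp
    qed
    show "1 \<odot>\<^bsub>Hom_space G M\<^esub> \<psi> = \<psi>"
    proof -
      have "1 \<odot>\<^bsub>Hom_space G M\<^esub> \<psi> = (\<lambda>\<sigma>\<in>carrier G. \<psi> \<sigma>)"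
        unfolding Hom_space_def using v m(6) by (simp cong: restrict_cong)
      then show ?thesis using restr by simp
    qed
    show "(-1) \<odot>\<^bsub>Hom_space G M\<^esub> \<psi> \<oplus>\<^bsub>Hom_space G M\<^esub> \<psi> = \<zero>\<^bsub>Hom_space G M\<^esub>"
      unfolding Hom_space_def using v m(8) by (simp cong: restrict_cong)
    show "p \<odot>\<^bsub>Hom_space G M\<^esub> \<psi> \<in> carrier (Hom_space G M)"
      using smult \<psi> by (simp add: Hom_space_def)
    show "(p + q) \<odot>\<^bsub>Hom_space G M\<^esub> \<psi> = p \<odot>\<^bsub>Hom_space G M\<^esub> \<psi> \<oplus>\<^bsub>Hom_space G M\<^esub> q \<odot>\<^bsub>Hom_space G M\<^esub> \<psi>"
      unfolding Hom_space_def using v m(3) by (simp cong: restrict_cong)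
    show "(p * q) \<odot>\<^bsub>Hom_space G M\<^esub> \<psi> = p \<odot>\<^bsub>Hom_space G M\<^esub> (q \<odot>\<^bsub>Hom_space G M\<^esub> \<psi>)"
      unfolding Hom_space_def using v m(5) by (simp cong: restrict_cong)
    assume \<chi>: "\<chi> \<in> carrier (Hom_space G M)"
    then have v': "\<And>\<sigma>. \<sigma> \<in> carrier G \<Longrightarrow> \<chi> \<sigma> \<in> carrier M" using val by (simp add: Hom_space_def)
    show "\<psi> \<oplus>\<^bsub>Hom_space G M\<^esub> \<chi> \<in> carrier (Hom_space G M)"
      using add \<psi> \<chi> by (simp add: Hom_space_def)
    show "\<psi> \<oplus>\<^bsub>Hom_space G M\<^esub> \<chi> = \<chi> \<oplus>\<^bsub>Hom_space G M\<^esub> \<psi>"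
      unfolding Hom_space_def using v v' M.a_comm by (simp cong: restrict_cong)
    show "p \<odot>\<^bsub>Hom_space G M\<^esub> (\<psi> \<oplus>\<^bsub>Hom_space G M\<^esub> \<chi>) = p \<odot>\<^bsub>Hom_space G M\<^esub> \<psi> \<oplus>\<^bsub>Hom_space G M\<^esub> p \<odot>\<^bsub>Hom_space G M\<^esub> \<chi>"
      unfolding Hom_space_def using v v' m(4) by (simp cong: restrict_cong)
    assume "\<theta> \<in> carrier (Hom_space G M)"
    then have "\<And>\<sigma>. \<sigma> \<in> carrier G \<Longrightarrow> \<theta> \<sigma> \<in> carrier M" using val by (simp add: Hom_space_def)
    then show "(\<psi> \<oplus>\<^bsub>Hom_space G M\<^esub> \<chi>) \<oplus>\<^bsub>Hom_space G M\<^esub> \<theta> = \<psi> \<oplus>\<^bsub>Hom_space G M\<^esub> (\<chi> \<oplus>\<^bsub>Hom_space G M\<^esub> \<theta>)"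
      unfolding Hom_space_def using v v' M.a_assoc by (simp cong: restrict_cong)
  qed (simp add: Hom_space_def zero)
qed

lemma linear_mapD:
  assumes "linear_map M N h"
  shows "Module.module real_ring M" "Module.module real_ring N"
    "\<And>x. x \<in> carrier M \<Longrightarrow> h x \<in> carrier N"
    "\<And>x y. x \<in> carrier M \<Longrightarrow> y \<in> carrier M \<Longrightarrow> h (x \<oplus>\<^bsub>M\<^esub> y) = h x \<oplus>\<^bsub>N\<^esub> h y"
    "\<And>p x. x \<in> carrier M \<Longrightarrow> h (p \<odot>\<^bsub>M\<^esub> x) = p \<odot>\<^bsub>N\<^esub> h x"
proof -
  note l = assms[unfolded linear_map_def]
  show "Module.module real_ring M" "Module.module real_ring N" by (rule conjunct1[OF l], rule conjunct1[OF conjunct2[OF l]])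
  note l3 = conjunct2[OF conjunct2[OF l]]
  show "h x \<in> carrier N" if "x \<in> carrier M" for x by (rule funcset_mem[OF conjunct1[OF l3] that])
  note l4 = conjunct2[OF l3]
  show "h (x \<oplus>\<^bsub>M\<^esub> y) = h x \<oplus>\<^bsub>N\<^esub> h y" if "x \<in> carrier M" "y \<in> carrier M" for x y
    by (rule bspec[OF bspec[OF conjunct1[OF l4] that(1)] that(2)])
  show "h (p \<odot>\<^bsub>M\<^esub> x) = p \<odot>\<^bsub>N\<^esub> h x" if "x \<in> carrier M" for p x
    by (rule bspec[OF spec[OF conjunct2[OF l4]] that])
qed

text \<open>The cosets of the kernel are the fibres of the map, so that the quotient is in bijection with the
  target; the module axioms of the quotient are pulled back along this bijection.\<close>

context
  fixes M :: "(real, 'a) module" and N :: "(real, 'b) module" and h H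
  assumes h: "linear_map M N h" and surj: "h ` carrier M = carrier N"
    and H: "H = {a \<in> carrier M. h a = \<zero>\<^bsub>N\<^esub>}"
begin

lemma kernel_coset:
  assumes a: "a \<in> carrier M" shows "H +>\<^bsub>M\<^esub> a = {x \<in> carrier M. h x = h a}"
proof -
  note M = linear_mapD(1)[OF h] and N = linear_mapD(2)[OF h] and hN = linear_mapD(3)[OF h]
    and hadd = linear_mapD(4)[OF h] and hsm = linear_mapD(5)[OF h]
  interpret M: abelian_group M by (rule real_moduleD(1)[OF M])
  interpret N: abelian_group N by (rule real_moduleD(1)[OF N])
  show ?thesis
  proof (intro equalityI subsetI)
    fix x assume "x \<in> H +>\<^bsub>M\<^esub> a"
    then obtain k where k: "k \<in> H" "x = k \<oplus>\<^bsub>M\<^esub> a" unfolding a_r_coset_def' by blast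
    then have kM: "k \<in> carrier M" "h k = \<zero>\<^bsub>N\<^esub>" unfolding H by simp_all
    have "h x = \<zero>\<^bsub>N\<^esub> \<oplus>\<^bsub>N\<^esub> h a" unfolding k(2) hadd[OF kM(1) a] kM(2) ..
    also have "\<dots> = h a" by (rule N.l_zero[OF hN[OF a]])
    finally show "x \<in> {x \<in> carrier M. h x = h a}" unfolding k(2) using M.a_closed[OF kM(1) a] by simp
  next
    fix x assume "x \<in> {x \<in> carrier M. h x = h a}"
    then have x: "x \<in> carrier M" "h x = h a" by simp_all
    have ma: "(-1) \<odot>\<^bsub>M\<^esub> a \<in> carrier M" using real_moduleD(2)[OF M a] .
    define k where "k = x \<oplus>\<^bsub>M\<^esub> (-1) \<odot>\<^bsub>M\<^esub> a"
    have "h k = h a \<oplus>\<^bsub>N\<^esub> (-1) \<odot>\<^bsub>N\<^esub> h a" unfolding k_def hadd[OF x(1) ma] hsm[OF a] x(2) ..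
    also have "\<dots> = \<zero>\<^bsub>N\<^esub>" by (rule real_module_zero_smult(4)[OF N hN[OF a]])
    finally have "k \<in> H" unfolding H k_def using M.a_closed[OF x(1) ma] by simp
    moreover have "k \<oplus>\<^bsub>M\<^esub> a = x"
      unfolding k_def M.a_assoc[OF x(1) ma a] real_module_zero_smult(2)[OF M a] by (rule M.r_zero[OF x(1)])
    ultimately show "x \<in> H +>\<^bsub>M\<^esub> a" unfolding a_r_coset_def' by blast
  qed
qed

lemma induced_map_coset: assumes "a \<in> carrier M" shows "induced_map h (H +>\<^bsub>M\<^esub> a) = h a"
proof -
  have "h ` (H +>\<^bsub>M\<^esub> a) = {h a}" unfolding kernel_coset[OF assms] using assms by auto
  then show ?thesis by (simp add: induced_map_def)
qed

lemma quotient_by_kernel: "linear_iso (quot_space M H) N (induced_map h)"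
proof -
  note M = linear_mapD(1)[OF h] and N = linear_mapD(2)[OF h] and hN = linear_mapD(3)[OF h]
    and hadd = linear_mapD(4)[OF h] and hsm = linear_mapD(5)[OF h]
  interpret M: abelian_group M by (rule real_moduleD(1)[OF M])
  interpret N: abelian_group N by (rule real_moduleD(1)[OF N])
  note smM = real_moduleD(2)[OF M]
  define K where "K a = H +>\<^bsub>M\<^esub> a" for a
  have K: "K a = {x \<in> carrier M. h x = h a}" if "a \<in> carrier M" for a
    unfolding K_def by (rule kernel_coset[OF that])
  have car: "carrier (quot_space M H) = K ` carrier M"
    by (auto simp: quot_space_def A_RCOSETS_def' K_def)
  have ind: "induced_map h (K a) = h a" if "a \<in> carrier M" for a
    unfolding K_def by (rule induced_map_coset[OF that])
  have h0: "h \<zero>\<^bsub>M\<^esub> = \<zero>\<^bsub>N\<^esub>"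
    using hsm[OF M.zero_closed, of 0] real_module_zero_smult(1)[OF M M.zero_closed]
      real_module_zero_smult(1)[OF N hN[OF M.zero_closed]] by simp
  have Kzero: "\<zero>\<^bsub>quot_space M H\<^esub> = K \<zero>\<^bsub>M\<^esub>" using K[OF M.zero_closed] h0 by (simp add: quot_space_def H)
  have Kadd: "K a \<oplus>\<^bsub>quot_space M H\<^esub> K c = K (a \<oplus>\<^bsub>M\<^esub> c)" if a: "a \<in> carrier M" and c: "c \<in> carrier M" for a c
  proof -
    have "set_add M (K a) (K c) = K (a \<oplus>\<^bsub>M\<^esub> c)"
    proof (intro equalityI subsetI)
      fix z assume "z \<in> set_add M (K a) (K c)"
      then obtain x y where xy: "x \<in> K a" "y \<in> K c" "z = x \<oplus>\<^bsub>M\<^esub> y" unfolding set_add_def' by blast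
      then have x: "x \<in> carrier M" "h x = h a" and y: "y \<in> carrier M" "h y = h c"
        unfolding K[OF a] K[OF c] by simp_all
      have "h z = h (a \<oplus>\<^bsub>M\<^esub> c)" unfolding xy(3) hadd[OF x(1) y(1)] hadd[OF a c] x(2) y(2) ..
      then show "z \<in> K (a \<oplus>\<^bsub>M\<^esub> c)"
        unfolding K[OF M.a_closed[OF a c]] using M.a_closed[OF x(1) y(1)] xy(3) by simp
    next
      fix z assume "z \<in> K (a \<oplus>\<^bsub>M\<^esub> c)"
      then have z: "z \<in> carrier M" "h z = h (a \<oplus>\<^bsub>M\<^esub> c)" unfolding K[OF M.a_closed[OF a c]] by simp_all
      note na = smM[OF a, of "-1"]
      define y where "y = (-1) \<odot>\<^bsub>M\<^esub> a \<oplus>\<^bsub>M\<^esub> z"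
      have ay: "a \<oplus>\<^bsub>M\<^esub> y = z"
        unfolding y_def M.a_assoc[OF a na z(1), symmetric] real_module_zero_smult(4)[OF M a]
        by (rule M.l_zero[OF z(1)])
      have "h y = (-1) \<odot>\<^bsub>N\<^esub> h a \<oplus>\<^bsub>N\<^esub> (h a \<oplus>\<^bsub>N\<^esub> h c)"
        unfolding y_def hadd[OF na z(1)] z(2) hadd[OF a c] hsm[OF a] ..
      also have "\<dots> = h c"
        unfolding N.a_assoc[OF real_moduleD(2)[OF N hN[OF a]] hN[OF a] hN[OF c], symmetric]
          real_module_zero_smult(2)[OF N hN[OF a]] by (rule N.l_zero[OF hN[OF c]])
      finally have "y \<in> K c" unfolding K[OF c] using M.a_closed[OF na z(1)] by (simp add: y_def)
      moreover have "a \<in> K a" unfolding K[OF a] using a by simp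
      ultimately show "z \<in> set_add M (K a) (K c)" unfolding set_add_def' using ay by blast
    qed
    then show ?thesis by (simp add: quot_space_def)
  qed
  have Ksm: "p \<odot>\<^bsub>quot_space M H\<^esub> K a = K (p \<odot>\<^bsub>M\<^esub> a)" if a: "a \<in> carrier M" for p a
  proof -
    have "K (p \<odot>\<^bsub>M\<^esub> x) = K (p \<odot>\<^bsub>M\<^esub> a)" if x: "x \<in> K a" for x
    proof -
      have x: "x \<in> carrier M" "h x = h a" using x unfolding K[OF a] by simp_all
      show ?thesis unfolding K[OF smM[OF x(1)]] K[OF smM[OF a]] hsm[OF x(1)] hsm[OF a] x(2) ..
    qed
    moreover have "a \<in> K a" unfolding K[OF a] using a by simp
    ultimately have "(\<Union>x\<in>K a. K (p \<odot>\<^bsub>M\<^esub> x)) = K (p \<odot>\<^bsub>M\<^esub> a)" by blast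
    then show ?thesis by (simp add: quot_space_def K_def)
  qed
  let ?q = "quot_space M H"
  have inj: "inj_on (induced_map h) (carrier ?q)"
  proof (rule inj_onI)
    fix A B assume "A \<in> carrier ?q" "B \<in> carrier ?q" and eq: "induced_map h A = induced_map h B"
    then obtain a c where ac: "a \<in> carrier M" "A = K a" "c \<in> carrier M" "B = K c" unfolding car by blast
    have "h a = h c" using eq ind[OF ac(1)] ind[OF ac(3)] unfolding ac(2,4) by simp
    then show "A = B" unfolding ac(2,4) K[OF ac(1)] K[OF ac(3)] by simp
  qed
  have img: "induced_map h ` carrier ?q = carrier N"
  proof -
    have "induced_map h ` carrier ?q = h ` carrier M" unfolding car image_image by (rule image_cong[OF refl ind])
    then show ?thesis using surj by simp
  qed
  have add: "A \<oplus>\<^bsub>?q\<^esub> B \<in> carrier ?q \<and> induced_map h (A \<oplus>\<^bsub>?q\<^esub> B) = induced_map h A \<oplus>\<^bsub>N\<^esub> induced_map h B"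
    if AB: "A \<in> carrier ?q" "B \<in> carrier ?q" for A B
  proof -
    obtain a c where ac: "a \<in> carrier M" "A = K a" "c \<in> carrier M" "B = K c" using AB unfolding car by blast
    show ?thesis
      unfolding ac(2,4) Kadd[OF ac(1,3)] ind[OF ac(1)] ind[OF ac(3)] ind[OF M.a_closed[OF ac(1,3)]] hadd[OF ac(1,3)] car
      using M.a_closed[OF ac(1,3)] by blast
  qed
  have sm: "p \<odot>\<^bsub>?q\<^esub> A \<in> carrier ?q \<and> induced_map h (p \<odot>\<^bsub>?q\<^esub> A) = p \<odot>\<^bsub>N\<^esub> induced_map h A"
    if A: "A \<in> carrier ?q" for p A
  proof -
    obtain a where a: "a \<in> carrier M" "A = K a" using A unfolding car by blast
    show ?thesis
      unfolding a(2) Ksm[OF a(1)] ind[OF a(1)] ind[OF smM[OF a(1)]] hsm[OF a(1)] car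
      using smM[OF a(1)] by blast
  qed
  have zero: "\<zero>\<^bsub>?q\<^esub> \<in> carrier ?q" "induced_map h \<zero>\<^bsub>?q\<^esub> = \<zero>\<^bsub>N\<^esub>"
    unfolding Kzero ind[OF M.zero_closed] h0 car using M.zero_closed by blast+
  have "Module.module real_ring ?q"
    by (rule module_transfer[OF N inj]) (use img add sm zero in blast)+
  then have "linear_map ?q N (induced_map h)"
    unfolding linear_map_def
  proof (intro conjI ballI allI funcsetI N)
    show "induced_map h A \<in> carrier N" if "A \<in> carrier ?q" for A using img that by blast
  qed (use add sm in blast)+
  then show ?thesis unfolding linear_iso_def bij_betw_def using inj img by blast
qed

end

text \<open>The inverse map is \<open>(k, y) \<mapsto> k + s y\<close>.\<close>

lemma linear_split:
  fixes M :: "(real, 'a) module" and N :: "(real, 'b) module"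
  assumes h: "linear_map M N h" and s: "linear_map N M s" and hs: "\<And>y. y \<in> carrier N \<Longrightarrow> h (s y) = y"
    and L: "L = M\<lparr>carrier := {a \<in> carrier M. h a = \<zero>\<^bsub>N\<^esub>}\<rparr>" and modL: "Module.module real_ring L"
  shows "linear_iso M (direct_sum L N) (\<lambda>a. (a \<ominus>\<^bsub>M\<^esub> s (h a), h a))"
proof -
  note M = linear_mapD(1)[OF h] and N = linear_mapD(2)[OF h] and hN = linear_mapD(3)[OF h]
    and hadd = linear_mapD(4)[OF h] and hsm = linear_mapD(5)[OF h]
    and sM = linear_mapD(3)[OF s] and sadd = linear_mapD(4)[OF s] and ssm = linear_mapD(5)[OF s]
  interpret M: abelian_group M by (rule real_moduleD(1)[OF M])
  interpret N: abelian_group N by (rule real_moduleD(1)[OF N])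
  note m = real_moduleD[OF M] and n = real_moduleD[OF N]
  have minus: "a \<ominus>\<^bsub>M\<^esub> c = a \<oplus>\<^bsub>M\<^esub> (-1) \<odot>\<^bsub>M\<^esub> c" if "c \<in> carrier M" for a c
    using real_module_zero_smult(3)[OF M that] by (simp add: a_minus_def)
  have cancel: "(-1) \<odot>\<^bsub>M\<^esub> c \<oplus>\<^bsub>M\<^esub> c = \<zero>\<^bsub>M\<^esub>" "c \<oplus>\<^bsub>M\<^esub> (-1) \<odot>\<^bsub>M\<^esub> c = \<zero>\<^bsub>M\<^esub>" if "c \<in> carrier M" for c
    using real_module_zero_smult(2)[OF M that] m(2)[OF that] that by (simp_all add: M.a_comm)
  have cancelN: "c \<oplus>\<^bsub>N\<^esub> (-1) \<odot>\<^bsub>N\<^esub> c = \<zero>\<^bsub>N\<^esub>" if "c \<in> carrier N" for c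
    using real_module_zero_smult(2)[OF N that] n(2)[OF that] that by (simp add: N.a_comm)
  let ?F = "\<lambda>a. (a \<oplus>\<^bsub>M\<^esub> (-1) \<odot>\<^bsub>M\<^esub> s (h a), h a)"
  have ker: "a \<oplus>\<^bsub>M\<^esub> (-1) \<odot>\<^bsub>M\<^esub> s (h a) \<in> carrier L" if a: "a \<in> carrier M" for a
  proof -
    have sa: "s (h a) \<in> carrier M" using sM hN a by simp
    have "h (a \<oplus>\<^bsub>M\<^esub> (-1) \<odot>\<^bsub>M\<^esub> s (h a)) = \<zero>\<^bsub>N\<^esub>"
      using a sa m(2)[OF sa] hadd hsm hs[OF hN[OF a]] cancelN[OF hN[OF a]] by simp
    then show ?thesis using a m(2)[OF sa] by (simp add: L)
  qed
  have Fadd: "?F (a \<oplus>\<^bsub>M\<^esub> c) = ?F a \<oplus>\<^bsub>direct_sum L N\<^esub> ?F c" if a: "a \<in> carrier M" and c: "c \<in> carrier M" for a c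
  proof -
    have sa: "s (h a) \<in> carrier M" "s (h c) \<in> carrier M" using sM hN a c by simp_all
    then show ?thesis using a c m hN hadd sadd by (simp add: direct_sum_def L M.a_ac)
  qed
  have Fsm: "?F (p \<odot>\<^bsub>M\<^esub> a) = p \<odot>\<^bsub>direct_sum L N\<^esub> ?F a" if a: "a \<in> carrier M" for p a
  proof -
    have sa: "s (h a) \<in> carrier M" using sM hN a by simp
    have "(-1) \<odot>\<^bsub>M\<^esub> (p \<odot>\<^bsub>M\<^esub> s (h a)) = p \<odot>\<^bsub>M\<^esub> ((-1) \<odot>\<^bsub>M\<^esub> s (h a))"
      using m(5)[OF sa, of "-1" p] m(5)[OF sa, of p "-1"] by simp
    then show ?thesis using a sa m hN hsm ssm by (simp add: direct_sum_def L)
  qed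
  have "linear_map M (direct_sum L N) ?F"
    unfolding linear_map_def
  proof (intro conjI ballI allI funcsetI M module_direct_sum[OF modL N] Fadd Fsm)
    show "?F a \<in> carrier (direct_sum L N)" if "a \<in> carrier M" for a
      using ker[OF that] hN[OF that] by (simp add: direct_sum_def)
  qed
  moreover have "bij_betw ?F (carrier M) (carrier (direct_sum L N))"
  proof (rule bij_betw_byWitness[where f' = "\<lambda>(k, y). k \<oplus>\<^bsub>M\<^esub> s y"])
    show "\<forall>a\<in>carrier M. (\<lambda>(k, y). k \<oplus>\<^bsub>M\<^esub> s y) (?F a) = a"
      using m(2) sM hN cancel by (simp add: M.a_assoc)
    show "\<forall>z\<in>carrier (direct_sum L N). ?F ((\<lambda>(k, y). k \<oplus>\<^bsub>M\<^esub> s y) z) = z"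
    proof
      fix z assume "z \<in> carrier (direct_sum L N)"
      then obtain k y where z: "z = (k, y)" "k \<in> carrier M" "h k = \<zero>\<^bsub>N\<^esub>" "y \<in> carrier N"
        by (auto simp: direct_sum_def L)
      have "h (k \<oplus>\<^bsub>M\<^esub> s y) = y" using z hadd sM hs by simp
      then show "?F ((\<lambda>(k, y). k \<oplus>\<^bsub>M\<^esub> s y) z) = z"
        using z(1,2) sM[OF z(4)] m(2) cancel by (simp add: M.a_assoc)
    qed
    show "?F ` carrier M \<subseteq> carrier (direct_sum L N)" using ker hN by (auto simp: direct_sum_def)
    show "(\<lambda>(k, y). k \<oplus>\<^bsub>M\<^esub> s y) ` carrier (direct_sum L N) \<subseteq> carrier M"
      using sM by (auto simp: direct_sum_def L)
  qed
  ultimately have iso: "linear_iso M (direct_sum L N) ?F" unfolding linear_iso_def by blast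
  have eq: "(a \<ominus>\<^bsub>M\<^esub> s (h a), h a) = ?F a" if "a \<in> carrier M" for a
    using minus sM hN that by simp
  show ?thesis
    using iso bij_betw_cong[of "carrier M" "\<lambda>a. (a \<ominus>\<^bsub>M\<^esub> s (h a), h a)" ?F] eq
    unfolding linear_iso_def linear_map_def by (simp add: M.a_closed m(2) Pi_iff)
qed

section \<open>Decomposition of the shift-invariant closed uniform forms\<close>

text \<open>One representative of each orbit. The section attached to any fundamental domain shows that
  \<open>\<delta>\<close> is surjective.\<close>

lemma (in group_action) fundamental_domain_exists: "\<exists>\<Lambda>0. fundamental_domain G E \<phi> \<Lambda>0"
proof -
  define p where "p U = (SOME x. x \<in> U)" for U :: "'c set"
  have p: "p U \<in> U" if U: "U \<in> orbits G E \<phi>" for U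
  proof -
    obtain x where "x \<in> E" "U = orbit G \<phi> x" using U unfolding orbits_def by blast
    then have "x \<in> U" using orbit_refl by blast
    then show ?thesis unfolding p_def by (rule someI)
  qed
  have "fundamental_domain G E \<phi> (p ` orbits G E \<phi>)"
    unfolding fundamental_domain_def
  proof (intro conjI ballI)
    show "p ` orbits G E \<phi> \<subseteq> E"
    proof
      fix x assume "x \<in> p ` orbits G E \<phi>"
      then obtain U where U: "U \<in> orbits G E \<phi>" "x \<in> U" using p by blast
      then obtain y where "y \<in> E" "x \<in> orbit G \<phi> y" unfolding orbits_def by blast
      then show "x \<in> E" using element_image unfolding orbit_def by blast
    qed
    fix U assume U: "U \<in> orbits G E \<phi>"
    show "\<exists>!x. x \<in> p ` orbits G E \<phi> \<inter> U"
    proof (rule ex1I[of _ "p U"])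
      show "p U \<in> p ` orbits G E \<phi> \<inter> U" using p[OF U] U by blast
      fix x assume "x \<in> p ` orbits G E \<phi> \<inter> U"
      then obtain W where W: "W \<in> orbits G E \<phi>" "x = p W" "x \<in> U" by blast
      then have "W \<inter> U \<noteq> {}" using p[OF W(1)] by blast
      then have "W = U" using disjoint_union[OF W(1) U] by blast
      then show "x = p U" using W(2) by simp
    qed
  qed
  then show ?thesis by blast
qed

context action_system
begin

lemma restrict_UNIV: "restrict f UNIV = f" by (simp add: restrict_def)

abbreviation "\<C> \<equiv> inv_closed_space V E b \<phi> G act"
abbreviation "\<E> \<equiv> inv_exact_space V E b \<phi> G act"
abbreviation "\<H> \<equiv> Hom_space G (consv_space b \<phi>)"

lemma module_consv: "Module.module real_ring (consv_space b \<phi>)"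
  unfolding consv_space_def
proof (rule module_fun_subspace)
  show "consv b \<phi> \<noteq> {}" using consv_zero by blast
  show "(\<lambda>a\<in>UNIV. p * f a + q * g a) \<in> consv b \<phi>" if "f \<in> consv b \<phi>" "g \<in> consv b \<phi>" for f g p q
    using consv_lincomb[OF that] by (simp add: restrict_UNIV)
qed simp

lemma module_H: "Module.module real_ring \<H>"
  by (rule module_Hom_space[OF G.group_axioms module_consv])

lemma H_iff:
  "\<psi> \<in> carrier \<H> \<longleftrightarrow> \<psi> \<in> extensional (carrier G) \<and> (\<forall>\<sigma>\<in>carrier G. \<psi> \<sigma> \<in> consv b \<phi>) \<and>
     (\<forall>\<sigma>\<in>carrier G. \<forall>\<tau>\<in>carrier G. \<psi> (\<sigma> \<otimes>\<^bsub>G\<^esub> \<tau>) = (\<lambda>s. \<psi> \<sigma> s + \<psi> \<tau> s))"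
  unfolding Hom_space_def hom_def consv_space_def fun_space_def Pi_iff by (simp add: restrict_UNIV) blast

lemma H_ops:
  "\<zero>\<^bsub>\<H>\<^esub> = (\<lambda>\<sigma>\<in>carrier G. \<lambda>s. 0)" "\<psi> \<oplus>\<^bsub>\<H>\<^esub> \<chi> = (\<lambda>\<sigma>\<in>carrier G. \<lambda>s. \<psi> \<sigma> s + \<chi> \<sigma> s)"
  "p \<odot>\<^bsub>\<H>\<^esub> \<psi> = (\<lambda>\<sigma>\<in>carrier G. \<lambda>s. p * \<psi> \<sigma> s)"
  by (simp_all add: Hom_space_def consv_space_def fun_space_def restrict_UNIV)

lemma C_ops:
  "carrier \<C> = \<Omega>" "\<omega> \<oplus>\<^bsub>\<C>\<^esub> \<omega>' = (\<lambda>t\<in>T. \<omega> t + \<omega>' t)" "p \<odot>\<^bsub>\<C>\<^esub> \<omega> = (\<lambda>t\<in>T. p * \<omega> t)"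
  by (simp_all add: inv_closed_space_def fun_space_def)

lemma zero_form: "(\<lambda>t\<in>T. 0) \<in> inv_exact_forms V E b \<phi> G act"
proof -
  define f where "f = (\<lambda>\<eta>\<in>C. 0 :: real)"
  have f: "f \<in> unif_funs0 V E b" using site_sum_unif[of "\<lambda>_ _. 0"] by (simp add: f_def)
  moreover have "shift_fun V b act \<sigma> f = f" if "\<sigma> \<in> carrier G" for \<sigma>
    unfolding shift_fun_def f_def using sh_C[OF that] by (intro restrict_ext) simp
  moreover have "boundary V E b \<phi> f = (\<lambda>t\<in>T. 0)"
    unfolding boundary_def f_def using T_C by (intro restrict_ext) simp
  ultimately show ?thesis
    unfolding inv_exact_forms_def inv_unif_funs0_def by (intro image_eqI[of _ _ f]) simp_all
qed

lemma \<Omega>_ext: "\<Omega> \<subseteq> T \<rightarrow>\<^sub>E UNIV"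
  unfolding inv_closed_forms_def unif_closed_forms_def forms_def by blast

lemma module_C: "Module.module real_ring \<C>"
  unfolding inv_closed_space_def
proof (rule module_fun_subspace[OF \<Omega>_ext])
  show "\<Omega> \<noteq> {}" using zero_form inv_exact_iff by blast
qed (rule inv_closed_lincomb)

lemma module_E: "Module.module real_ring \<E>"
  unfolding inv_exact_space_def
proof (rule module_fun_subspace)
  show "inv_exact_forms V E b \<phi> G act \<subseteq> T \<rightarrow>\<^sub>E UNIV" using \<Omega>_ext inv_exact_iff by blast
  show "inv_exact_forms V E b \<phi> G act \<noteq> {}" using zero_form by blast
  fix \<omega> \<omega>' p q assume "\<omega> \<in> inv_exact_forms V E b \<phi> G act" "\<omega>' \<in> inv_exact_forms V E b \<phi> G act"
  then have *: "\<omega> \<in> \<Omega>" "\<omega>' \<in> \<Omega>" "\<And>\<sigma>. \<sigma> \<in> carrier G \<Longrightarrow> \<delta> \<omega> \<sigma> = (\<lambda>s. 0)" "\<And>\<sigma>. \<sigma> \<in> carrier G \<Longrightarrow> \<delta> \<omega>' \<sigma> = (\<lambda>s. 0)"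
    unfolding inv_exact_iff by blast+
  show "(\<lambda>t\<in>T. p * \<omega> t + q * \<omega>' t) \<in> inv_exact_forms V E b \<phi> G act"
    unfolding inv_exact_iff using inv_closed_lincomb[OF *(1,2)] \<delta>_lincomb[OF *(1,2)] *(3,4) by simp
qed

lemma \<delta>_H: assumes "\<omega> \<in> \<Omega>" shows "\<delta> \<omega> \<in> carrier \<H>"
  unfolding H_iff by (intro conjI ballI \<delta>_ext \<delta>_consv[OF assms] \<delta>_mult[OF assms])

lemma \<delta>_linear: "linear_map \<C> \<H> \<delta>"
  unfolding linear_map_def C_ops
proof (intro conjI ballI allI)
  show "\<delta> \<in> \<Omega> \<rightarrow> carrier \<H>" by (rule funcsetI) (rule \<delta>_H)
next
  fix \<omega> \<omega>' assume *: "\<omega> \<in> \<Omega>" "\<omega>' \<in> \<Omega>"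
  show "\<delta> (\<lambda>t\<in>T. \<omega> t + \<omega>' t) = \<delta> \<omega> \<oplus>\<^bsub>\<H>\<^esub> \<delta> \<omega>'"
    by (rule extensionalityI[OF \<delta>_ext]) (use \<delta>_lincomb[OF *, of _ 1 1] in \<open>simp_all add: H_ops\<close>)
next
  fix p \<omega> assume *: "\<omega> \<in> \<Omega>"
  show "\<delta> (\<lambda>t\<in>T. p * \<omega> t) = p \<odot>\<^bsub>\<H>\<^esub> \<delta> \<omega>"
    by (rule extensionalityI[OF \<delta>_ext]) (use \<delta>_lincomb[OF * *, of _ p 0] in \<open>simp_all add: H_ops\<close>)
qed (rule module_C module_H)+

lemma exact_kernel: "carrier \<E> = {\<omega> \<in> carrier \<C>. \<delta> \<omega> = \<zero>\<^bsub>\<H>\<^esub>}"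
proof -
  have "\<delta> \<omega> = \<zero>\<^bsub>\<H>\<^esub> \<longleftrightarrow> (\<forall>\<sigma>\<in>carrier G. \<delta> \<omega> \<sigma> = (\<lambda>s. 0))" for \<omega>
  proof
    assume "\<forall>\<sigma>\<in>carrier G. \<delta> \<omega> \<sigma> = (\<lambda>s. 0)"
    then show "\<delta> \<omega> = \<zero>\<^bsub>\<H>\<^esub>" by (intro extensionalityI[OF \<delta>_ext]) (simp_all add: H_ops)
  qed (simp add: H_ops)
  then show ?thesis unfolding C_ops using inv_exact_iff by (auto simp: inv_exact_space_def)
qed

lemma exact_space_eq: "\<E> = \<C>\<lparr>carrier := {\<omega> \<in> carrier \<C>. \<delta> \<omega> = \<zero>\<^bsub>\<H>\<^esub>}\<rparr>"
  unfolding exact_kernel[symmetric] by (simp add: inv_exact_space_def inv_closed_space_def)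

lemma section_props:
  assumes fd: "fundamental_domain G V act \<Lambda>0"
  shows "linear_map \<H> \<C> (section_map V E b \<phi> G act \<Lambda>0)"
    and "\<psi> \<in> carrier \<H> \<Longrightarrow> \<delta> (section_map V E b \<phi> G act \<Lambda>0 \<psi>) = \<psi>"
proof -
  let ?lam = "section_map V E b \<phi> G act \<Lambda>0"
  have cons: "\<psi> \<tau> \<in> consv b \<phi>" if "\<psi> \<in> carrier \<H>" "\<tau> \<in> carrier G" for \<psi> \<tau>
    using that unfolding H_iff by blast
  have lam: "?lam \<psi> = boundary V E b \<phi> (tile_sum \<Lambda>0 \<psi>)" if "\<psi> \<in> carrier \<H>" for \<psi>
    by (rule section_map_eq[OF fd cons[OF that]])
  have unif: "tile_sum \<Lambda>0 \<psi> \<in> unif_funs0 V E b" if "\<psi> \<in> carrier \<H>" for \<psi>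
    by (rule tile_sum_unif[OF fd cons[OF that]])
  have conn: "connecting_at V b \<phi> act (tile_sum \<Lambda>0 \<psi>) \<sigma> (\<psi> \<sigma>)" if "\<psi> \<in> carrier \<H>" "\<sigma> \<in> carrier G" for \<psi> \<sigma>
  proof (rule tile_sum_connecting[OF fd cons[OF that(1)] _ that(2)])
    fix \<rho> \<tau> s assume "\<rho> \<in> carrier G" "\<tau> \<in> carrier G"
    then have "\<psi> (\<rho> \<otimes>\<^bsub>G\<^esub> \<tau>) = (\<lambda>s. \<psi> \<rho> s + \<psi> \<tau> s)" using that(1) unfolding H_iff by blast
    then show "\<psi> (\<rho> \<otimes>\<^bsub>G\<^esub> \<tau>) s = \<psi> \<rho> s + \<psi> \<tau> s" by (rule fun_cong)
  qed
  have inv: "?lam \<psi> \<in> \<Omega>" if "\<psi> \<in> carrier \<H>" for \<psi>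
    unfolding lam[OF that] by (rule boundary_invariant[OF unif[OF that] conn[OF that]])
  show "\<delta> (?lam \<psi>) = \<psi>" if \<psi>: "\<psi> \<in> carrier \<H>" for \<psi>
  proof (rule extensionalityI[OF \<delta>_ext])
    show "\<psi> \<in> extensional (carrier G)" using \<psi> unfolding H_iff by blast
    show "\<delta> (?lam \<psi>) \<sigma> = \<psi> \<sigma>" if "\<sigma> \<in> carrier G" for \<sigma>
      by (rule \<delta>_eqI[OF inv[OF \<psi>] unif[OF \<psi>] lam[OF \<psi>, symmetric] that conn[OF \<psi> that]])
  qed
  have lincomb: "boundary V E b \<phi> (tile_sum \<Lambda>0 (\<lambda>\<sigma>\<in>carrier G. \<lambda>s. p * \<psi> \<sigma> s + q * \<chi> \<sigma> s)) =
      (\<lambda>t\<in>T. p * boundary V E b \<phi> (tile_sum \<Lambda>0 \<psi>) t + q * boundary V E b \<phi> (tile_sum \<Lambda>0 \<chi>) t)" for p q \<psi> \<chi>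
  proof -
    have "tile_sum \<Lambda>0 (\<lambda>\<sigma>\<in>carrier G. \<lambda>s. p * \<psi> \<sigma> s + q * \<chi> \<sigma> s) =
        (\<lambda>\<eta>\<in>C. p * tile_sum \<Lambda>0 \<psi> \<eta> + q * tile_sum \<Lambda>0 \<chi> \<eta>)"
      unfolding tile_sum_def[OF fd]
    proof (rule restrict_ext)
      fix \<eta> assume \<eta>: "\<eta> \<in> C"
      have "tile \<Lambda>0 x \<in> carrier G" if "x \<in> supp \<eta>" for x using tile(1)[OF fd] supp_V that by blast
      then show "(\<Sum>x\<in>supp \<eta>. (\<lambda>\<sigma>\<in>carrier G. \<lambda>s. p * \<psi> \<sigma> s + q * \<chi> \<sigma> s) (tile \<Lambda>0 x) (\<eta> x)) =
          p * (\<lambda>\<eta>\<in>C. \<Sum>x\<in>supp \<eta>. \<psi> (tile \<Lambda>0 x) (\<eta> x)) \<eta> + q * (\<lambda>\<eta>\<in>C. \<Sum>x\<in>supp \<eta>. \<chi> (tile \<Lambda>0 x) (\<eta> x)) \<eta>"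
        using \<eta> by (simp add: sum.distrib sum_distrib_left)
    qed
    then show ?thesis by (simp only: boundary_lincomb)
  qed
  interpret H: abelian_group \<H> by (rule real_moduleD(1)[OF module_H])
  show "linear_map \<H> \<C> ?lam"
    unfolding linear_map_def C_ops
  proof (intro conjI ballI allI)
    show "?lam \<in> carrier \<H> \<rightarrow> \<Omega>" by (rule funcsetI) (rule inv)
  next
    fix \<psi> \<chi> assume *: "\<psi> \<in> carrier \<H>" "\<chi> \<in> carrier \<H>"
    show "?lam (\<psi> \<oplus>\<^bsub>\<H>\<^esub> \<chi>) = (\<lambda>t\<in>T. ?lam \<psi> t + ?lam \<chi> t)"
      unfolding lam[OF H.a_closed[OF *]] lam[OF *(1)] lam[OF *(2)] using lincomb[of 1 \<psi> 1 \<chi>] by (simp add: H_ops)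
  next
    fix p \<psi> assume *: "\<psi> \<in> carrier \<H>"
    show "?lam (p \<odot>\<^bsub>\<H>\<^esub> \<psi>) = (\<lambda>t\<in>T. p * ?lam \<psi> t)"
      unfolding lam[OF real_moduleD(2)[OF module_H *]] lam[OF *] using lincomb[of p \<psi> 0 \<psi>] by (simp add: H_ops)
  qed (rule module_C module_H)+
qed

lemma \<delta>_surj: "\<delta> ` carrier \<C> = carrier \<H>"
proof (intro equalityI subsetI)
  fix \<psi> assume \<psi>: "\<psi> \<in> carrier \<H>"
  obtain \<Lambda>0 where "fundamental_domain G V act \<Lambda>0" using A.fundamental_domain_exists by blast
  note s = section_props[OF this]
  have "section_map V E b \<phi> G act \<Lambda>0 \<psi> \<in> carrier \<C>" by (rule linear_mapD(3)[OF s(1) \<psi>])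
  then show "\<psi> \<in> \<delta> ` carrier \<C>" using s(2)[OF \<psi>] by (metis imageI)
qed (use \<delta>_H C_ops(1) in blast)

end

theorem theorem1:
  fixes V :: "'x set" and E :: "('x \<times> 'x) set"
    and b :: 's and \<phi> :: "'s interaction"
    and G :: "('g, 'm) monoid_scheme" and act :: "'g \<Rightarrow> 'x \<Rightarrow> 'x"
  defines "\<C> \<equiv> inv_closed_space V E b \<phi> G act"
    and "\<E> \<equiv> inv_exact_space V E b \<phi> G act"
    and "\<H> \<equiv> Hom_space G (consv_space b \<phi>)"
    and "\<delta> \<equiv> connecting_map V E b \<phi> G act"
    and "lam \<equiv> section_map V E b \<phi> G act"
  assumes "graph_locale V E"
    and "interaction \<phi>"
    and "irreducibly_quantified b \<phi>"
    and "locale_action G V E act"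
    and "free_action G V act"
    and "transferable V E \<or> simple_interaction b \<phi> \<and> weakly_transferable V E"
  shows
    "(\<comment> \<open>\<open>\<delta>\<close> does not depend on the choice of \<open>f\<close>\<close>
      \<forall>\<omega>\<in>carrier \<C>.
        (\<exists>f\<in>unif_funs0 V E b. boundary V E b \<phi> f = \<omega>) \<and>
        (\<forall>f\<in>unif_funs0 V E b. boundary V E b \<phi> f = \<omega> \<longrightarrow>
           (\<forall>\<sigma>\<in>carrier G. connecting_at V b \<phi> act f \<sigma> (\<delta> \<omega> \<sigma>)))) \<and>
     linear_map \<C> \<H> \<delta> \<and>
     (\<forall>\<omega>\<in>carrier \<C>. induced_map \<delta> (carrier \<E> +>\<^bsub>\<C>\<^esub> \<omega>) = \<delta> \<omega>) \<and>
     linear_iso (quot_space \<C> (carrier \<E>)) \<H> (induced_map \<delta>) \<and>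
     (\<forall>\<Lambda>0. fundamental_domain G V act \<Lambda>0 \<longrightarrow>
        linear_map \<H> \<C> (lam \<Lambda>0) \<and>
        (\<forall>\<psi>\<in>carrier \<H>. \<delta> (lam \<Lambda>0 \<psi>) = \<psi>) \<and>
        linear_iso \<C> (direct_sum \<E> \<H>) (\<lambda>\<omega>. (\<omega> \<ominus>\<^bsub>\<C>\<^esub> lam \<Lambda>0 (\<delta> \<omega>), \<delta> \<omega>)))"
proof -
  have wt: "weakly_transferable V E"
    using assms(11) unfolding transferable_def by blast
  interpret action_system V E b \<phi> G act
    by unfold_locales (use assms(6-11) wt in blast)+
  have lift: "\<forall>\<omega>\<in>carrier \<C>.
      (\<exists>f\<in>unif_funs0 V E b. boundary V E b \<phi> f = \<omega>) \<and>
      (\<forall>f\<in>unif_funs0 V E b. boundary V E b \<phi> f = \<omega> \<longrightarrow>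
        (\<forall>\<sigma>\<in>carrier G. connecting_at V b \<phi> act f \<sigma> (\<delta> \<omega> \<sigma>)))"
    unfolding \<C>_def \<delta>_def C_ops(1) using inv_form_exact \<delta>_connecting by blast
  have linear: "linear_map \<C> \<H> \<delta>"
    unfolding \<C>_def \<H>_def \<delta>_def by (rule \<delta>_linear)
  have kernel: "carrier \<E> = {\<omega> \<in> carrier \<C>. \<delta> \<omega> = \<zero>\<^bsub>\<H>\<^esub>}"
    unfolding \<C>_def \<E>_def \<H>_def \<delta>_def by (rule exact_kernel)
  have surj: "\<delta> ` carrier \<C> = carrier \<H>"
    unfolding \<C>_def \<H>_def \<delta>_def by (rule \<delta>_surj)
  have split: "linear_map \<H> \<C> (lam \<Lambda>0) \<and> (\<forall>\<psi>\<in>carrier \<H>. \<delta> (lam \<Lambda>0 \<psi>) = \<psi>) \<and>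
      linear_iso \<C> (direct_sum \<E> \<H>) (\<lambda>\<omega>. (\<omega> \<ominus>\<^bsub>\<C>\<^esub> lam \<Lambda>0 (\<delta> \<omega>), \<delta> \<omega>))"
    if "fundamental_domain G V act \<Lambda>0" for \<Lambda>0
  proof -
    have lam: "linear_map \<H> \<C> (lam \<Lambda>0)" "\<And>\<psi>. \<psi> \<in> carrier \<H> \<Longrightarrow> \<delta> (lam \<Lambda>0 \<psi>) = \<psi>"
      unfolding \<C>_def \<H>_def \<delta>_def lam_def using section_props[OF that] by blast+
    have "\<E> = \<C>\<lparr>carrier := {\<omega> \<in> carrier \<C>. \<delta> \<omega> = \<zero>\<^bsub>\<H>\<^esub>}\<rparr>" "Module.module real_ring \<E>"
      unfolding \<C>_def \<E>_def \<H>_def \<delta>_def by (rule exact_space_eq, rule module_E)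
    from linear_split[OF linear lam this] show ?thesis using lam by blast
  qed
  show ?thesis
    using lift linear induced_map_coset[OF linear surj kernel] quotient_by_kernel[OF linear surj kernel] split
    by blast
qed

end
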